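(* Let $n\ge 3$, let $\mathbb{B}^n$ be the open unit ball of $\mathbb{R}^n$, and for $x\in\mathbb{B}^n$ and a unit vector $l\in\mathbb{R}^n$ let $C(x,l)$ denote the smallest constant such that $|\langle \nabla u(x), l\rangle|\le C(x,l)\sup_{|y|<1}|u(y)|$ holds for every bounded real-valued harmonic function $u$ on $\mathbb{B}^n$. Let $0\le\rho<1$, $\alpha\in[0,\tfrac{\pi}{2}]$ and $l=\cos\alpha\, e_1+\sin\alpha\, e_2$. Then $$C(\rho e_1,l)=\frac{n}{1-\rho^2}\frac{\Gamma(\frac{n}{2})}{\Gamma(\frac{1}{2})\Gamma(\frac{n-1}{2})}\int_{-1}^1 \Big| \tfrac{n-2}{n} \rho \cos\alpha - x\Big| \frac{(1-x^2)^{\frac{n-3}{2}}}{(1+\rho^2-2\rho x \cos\alpha)^{\frac{n}{2}-1}}\, {}_2F_1\Big(\tfrac{n-2}{4},\tfrac{n}{4};\tfrac{n-1}{2};\tfrac{4\rho^2 \sin^2\alpha\, (1-x^2)}{(1+\rho^2-2\rho x \cos\alpha)^{2}}\Big)\, dx.$$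
   Context: $e_1,e_2$ are the first two standard basis vectors of $\mathbb{R}^n$, and ${}_2F_1$ is the Gauss hypergeometric function. *)

theory Defs
  imports "HOL-Analysis.Analysis"
begin

definition partial_deriv :: "'n::finite \<Rightarrow> (real^'n \<Rightarrow> real) \<Rightarrow> real^'n \<Rightarrow> real" where
  "partial_deriv i f x = frechet_derivative f (at x) (axis i 1)"

definition harmonic_on :: "(real^'n::finite) set \<Rightarrow> (real^'n \<Rightarrow> real) \<Rightarrow> bool" where
  "harmonic_on S u \<longleftrightarrow>
     (\<forall>x\<in>S. u differentiable (at x)) \<and>
     (\<forall>i. \<forall>x\<in>S. partial_deriv i u differentiable (at x)) \<and>
     (\<forall>i. continuous_on S (partial_deriv i u)) \<and>
     (\<forall>i j. continuous_on S (partial_deriv j (partial_deriv i u))) \<and>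
     (\<forall>x\<in>S. (\<Sum>i\<in>UNIV. partial_deriv i (partial_deriv i u) x) = 0)"

definition opt_const :: "real^'n::finite \<Rightarrow> real^'n \<Rightarrow> real" where
  "opt_const x l = Inf {C. \<forall>u. harmonic_on (ball 0 1) u \<and> bounded (u ` ball 0 1) \<longrightarrow>
       \<bar>frechet_derivative u (at x) l\<bar> \<le> C * (SUP y\<in>ball 0 1. \<bar>u y\<bar>)}"

definition hyp2F1 :: "real \<Rightarrow> real \<Rightarrow> real \<Rightarrow> real \<Rightarrow> real" where
  "hyp2F1 a b c z = (\<Sum>k. pochhammer a k * pochhammer b k / (pochhammer c k * fact k) * z ^ k)"

end

theory Submission
  imports Defs "HOL-Probability.Probability_Measure"
begin

text \<open>
  A bounded harmonic function on the ball is, after a dilation, the Poisson integral of its boundary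
  values, so that \<open>C(x, l)\<close> is the integral of \<open>|\<partial>\<^sub>l P(x, z)|\<close> over the unit sphere; it is attained by the
  Poisson integral of the sign of \<open>\<partial>\<^sub>l P(x, z)\<close>. The Poisson formula follows from the maximum principle,
  since the Poisson integral of continuous data solves the Dirichlet problem.

  Only the two coordinates \<open>z\<^sub>1, z\<^sub>2\<close> of \<open>z\<close> enter the integral. Writing \<open>z\<^sub>2 = v \<surd>(1 - z\<^sub>1\<^sup>2)\<close>, the
  coordinates \<open>z\<^sub>1\<close> and \<open>v\<close> are independent under the uniform measure on the sphere. A Moebius
  substitution in \<open>z\<^sub>1\<close> turns the integrand into
  \<open>|(n - 2) \<rho> cos \<alpha> - n \<langle>z, l\<rangle>| |\<rho> e\<^sub>1 - z|\<^sup>2\<^sup>-\<^sup>n / (1 - \<rho>\<^sup>2)\<close>. After a rotation carrying \<open>l\<close> to the first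
  axis, the integral over \<open>v\<close> is evaluated by the binomial series, which gives the hypergeometric function.
\<close>

section \<open>The maximum principle\<close>

text \<open>At x = \<rho> e_1 the derivative of the Poisson kernel is a power of |x - z| times an
  affine function of both z_1 and <z, l>. Its sign thus depends in general on two coordinates, and
  no rotation alone makes the absolute value constant in an inner integral. The Moebius map is
  chosen because it turns this affine function into one of <z, l> alone, up to positive factors that
  combine with its Jacobian. Once l is the axis, the inner integral contains only a power of an
  affine function of v, to which the binomial series applies. The extremal boundary data are a sign
  function, hence discontinuous, so Poisson integrals are set up for bounded measurable data. A
  bounded harmonic function w comes without boundary values, so only w(r .) with r < 1 is
  represented, and r tends to 1 in the derivative estimate. The evaluation runs in nonnegative
  integrals, so that Tonelli and substitutions need no integrability; finiteness comes from the
  optimal constant being a real number. Open intervals appear because the weight (1 - v^2)^((n-4)/2)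
  is singular at the endpoints for n = 3.\<close>

lemma not_local_max_of_DERIV2_pos:
  fixes f f' :: "real \<Rightarrow> real"
  assumes e: "0 < e"
    and f: "\<And>t. \<bar>t\<bar> < e \<Longrightarrow> (f has_real_derivative f' t) (at t)"
    and f': "(f' has_real_derivative d) (at 0)" and d: "0 < d"
    and max: "\<And>t. \<bar>t\<bar> < e \<Longrightarrow> f t \<le> f 0"
  shows False
proof -
  have "f' 0 = 0"
    using f[of 0] e max by (intro DERIV_local_max[of f _ 0 e]) auto
  with DERIV_pos_inc_right[OF f' d] obtain \<delta> where \<delta>: "\<delta> > 0" "\<And>h. 0 < h \<Longrightarrow> h < \<delta> \<Longrightarrow> 0 < f' h"
    by auto
  define h where "h = min \<delta> e / 2"
  have h: "0 < h" "h < \<delta>" "h < e" using \<delta> e by (auto simp: h_def)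
  have "f 0 < f h"
  proof (rule DERIV_pos_imp_increasing_open[OF h(1)])
    fix t assume "0 < t" "t < h"
    with f[of t] \<delta>(2)[of t] h show "\<exists>y. (f has_real_derivative y) (at t) \<and> 0 < y" by auto
  next
    show "continuous_on {0..h} f"
      using f h by (intro DERIV_continuous_on[of _ _ f']) (auto intro: has_field_derivative_at_within)
  qed
  with max[of h] h show False by simp
qed

text \<open>Only second derivatives along the coordinate axes enter, so that the principle applies
  to rescaled functions without a chain rule for \<^const>\<open>partial_deriv\<close>.\<close>

lemma maximum_principle:
  fixes w :: "real^'n::finite \<Rightarrow> real" and w' w'' :: "'n \<Rightarrow> real^'n \<Rightarrow> real"
  assumes r: "0 < r" and cont: "continuous_on (cball 0 r) w"
    and bdry: "\<And>z. norm z = r \<Longrightarrow> w z \<le> 0"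
    and d1: "\<And>i x. norm x < r \<Longrightarrow> ((\<lambda>t. w (x + t *\<^sub>R axis i 1)) has_real_derivative w' i x) (at 0)"
    and d2: "\<And>i x. norm x < r \<Longrightarrow> ((\<lambda>t. w' i (x + t *\<^sub>R axis i 1)) has_real_derivative w'' i x) (at 0)"
    and lap: "\<And>x. norm x < r \<Longrightarrow> (\<Sum>i\<in>UNIV. w'' i x) = 0"
    and x: "norm x \<le> r"
  shows "w x \<le> 0"
proof (rule ccontr)
  assume "\<not> w x \<le> 0"
  hence pos: "w x > 0" by simp
  \<comment> \<open>The perturbation \<epsilon> |y|^2 raises every second derivative by 2
    \<epsilon>, so the sum of the second derivatives of \<open>v\<close> is strictly positive. The
    factor 1/2 keeps \<epsilon> r^2 below \<open>w x\<close>, so that the maximum of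
    \<open>v\<close> cannot lie on the boundary.\<close>
  define \<epsilon> where "\<epsilon> = w x / (2 * r\<^sup>2)"
  have \<epsilon>: "\<epsilon> > 0" "\<epsilon> * r\<^sup>2 < w x" using pos r by (auto simp: \<epsilon>_def)
  define v where "v = (\<lambda>y. w y + \<epsilon> * (y \<bullet> y))"
  have "continuous_on (cball 0 r) v"
    unfolding v_def by (intro continuous_intros cont)
  from continuous_attains_sup[OF compact_cball _ this] r
  obtain y where y: "norm y \<le> r" "\<And>z. norm z \<le> r \<Longrightarrow> v z \<le> v y"
    by auto
  have "w x \<le> v x" using \<epsilon> by (simp add: v_def)
  also have "v x \<le> v y" using y x by auto
  finally have vy: "w x \<le> v y" .
  have yr: "norm y < r"
  proof (rule ccontr)
    assume "\<not> norm y < r"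
    hence n: "norm y = r" using y by simp
    have "v y \<le> \<epsilon> * r\<^sup>2" using bdry[OF n] by (simp add: v_def power2_norm_eq_inner[symmetric] n)
    with vy \<epsilon> show False by simp
  qed
  \<comment> \<open>A positive value would be a positive second derivative of \<open>v\<close> along
    axis i at its interior maximum. Summation over i contradicts the vanishing sum in
    \<open>lap\<close>.\<close>
  have le: "w'' i y + 2 * \<epsilon> \<le> 0" for i
  proof (rule ccontr)
    assume a: "\<not> w'' i y + 2 * \<epsilon> \<le> 0"
    define e where "e = r - norm y"
    have e: "e > 0" using yr by (simp add: e_def)
    have nrm: "norm (y + t *\<^sub>R axis i 1) < r" if "\<bar>t\<bar> < e" for t
      using norm_triangle_ineq[of y "t *\<^sub>R axis i 1"] that by (simp add: e_def)
    define f where "f = (\<lambda>t. v (y + t *\<^sub>R axis i 1))"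
    define f' where "f' = (\<lambda>t. w' i (y + t *\<^sub>R axis i 1) + \<epsilon> * (2 * y $ i + 2 * t))"
    have f_eq: "f = (\<lambda>t. w (y + t *\<^sub>R axis i 1) + \<epsilon> * (y \<bullet> y + 2 * t * y $ i + t * t))"
      by (rule ext) (simp add: f_def v_def inner_axis inner_axis' algebra_simps inner_commute)
    show False
    proof (rule not_local_max_of_DERIV2_pos[OF e, of f f' "w'' i y + 2 * \<epsilon>"])
      fix t assume t: "\<bar>t\<bar> < e"
      have "((\<lambda>s. w (y + t *\<^sub>R axis i 1 + s *\<^sub>R axis i 1)) has_real_derivative w' i (y + t *\<^sub>R axis i 1)) (at 0)"
        by (rule d1[OF nrm[OF t]])
      hence "((\<lambda>s. (\<lambda>u. w (y + u *\<^sub>R axis i 1)) (s + t)) has_real_derivative w' i (y + t *\<^sub>R axis i 1)) (at 0)"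
        by (simp add: algebra_simps)
      hence "((\<lambda>u. w (y + u *\<^sub>R axis i 1)) has_real_derivative w' i (y + t *\<^sub>R axis i 1)) (at t)"
        by (subst (asm) DERIV_shift[symmetric]) simp
      thus "(f has_real_derivative f' t) (at t)"
        unfolding f_eq f'_def by (auto intro!: derivative_eq_intros simp: algebra_simps)
      show "f t \<le> f 0" using y nrm[OF t] by (simp add: f_def)
    next
      show "(f' has_real_derivative w'' i y + 2 * \<epsilon>) (at 0)"
        unfolding f'_def using d2[OF yr, of i] by (auto intro!: derivative_eq_intros)
      show "0 < w'' i y + 2 * \<epsilon>" using a by simp
    qed
  qed
  have "(\<Sum>i\<in>UNIV. w'' i y + 2 * \<epsilon>) \<le> 0" by (intro sum_nonpos le)
  hence "real CARD('n) * (2 * \<epsilon>) \<le> 0" by (simp add: sum.distrib lap[OF yr])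
  moreover have "real CARD('n) * (2 * \<epsilon>) > 0" using \<epsilon> by simp
  ultimately show False by simp
qed

section \<open>The uniform measure on the sphere\<close>

lemma orthogonal_transformation_borel_measurable:
  fixes f :: "'a::euclidean_space \<Rightarrow> 'a"
  assumes "orthogonal_transformation f"
  shows "f \<in> borel_measurable borel"
  using assms by (intro borel_measurable_continuous_onI linear_continuous_on)
    (auto simp: linear_linear orthogonal_transformation_linear)

text \<open>The library's \<^verbatim>\<open>measure_orthogonal_image\<close> needs a well-ordered index type. Instead,
  compare the image measure with Lebesgue measure by the usual uniqueness argument
  for translation invariant measures; the unit ball fixes the constant.\<close>

lemma distr_lborel_orthogonal_transformation:
  fixes f :: "'a::euclidean_space \<Rightarrow> 'a"
  assumes f: "orthogonal_transformation f"
  shows "distr lborel borel f = lborel"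
proof (rule measure_eqI)
  note [measurable] = orthogonal_transformation_borel_measurable[OF f]
  fix B assume "B \<in> sets (distr lborel borel f)"
  hence [measurable]: "B \<in> sets borel" by simp
  \<comment> \<open>The indicator of the unit ball is even and invariant under \<open>f\<close>; its
    integral is the finite positive constant that is cancelled at the end.\<close>
  define g :: "'a \<Rightarrow> ennreal" where "g = indicator (cball 0 1)"
  have [measurable]: "g \<in> borel_measurable borel"
    unfolding g_def by (intro borel_measurable_indicator borel_closed closed_cball)
  have shift: "(\<integral>\<^sup>+x. h (x + c) \<partial>lborel) = (\<integral>\<^sup>+x. h x \<partial>lborel)"
    if [measurable]: "h \<in> borel_measurable borel" for h :: "'a \<Rightarrow> ennreal" and c
    by (subst (2) lborel_distr_plus[of c, symmetric]) (simp add: nn_integral_distr add.commute)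
  have gshift: "(\<integral>\<^sup>+y. g (y + c) \<partial>lborel) = (\<integral>\<^sup>+y. g y \<partial>lborel)" for c
    by (rule shift) simp
  have gball: "(\<integral>\<^sup>+x. g x \<partial>lborel) = emeasure lborel (cball 0 1 :: 'a set)"
    by (simp add: g_def)
  have gf: "g (f x) = g x" for x
    by (simp add: g_def indicator_def orthogonal_transformation_norm[OF f])
  have finv: "f x + y = f (x + inv f y)" for x y
    using f by (simp add: linear_add orthogonal_transformation_linear orthogonal_transformation_surj surj_f_inv_f)
  \<comment> \<open>The product is a double integral. A translation in y couples the variables,
    Tonelli exchanges them, and the translation of x by \<open>inv f y\<close> moves y from
    \<open>g\<close> into the indicator of B. The inner integral over y is then the Lebesgue measure
    of B.\<close>
  have "emeasure (distr lborel borel f) B * emeasure lborel (cball 0 1 :: 'a set) =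
        (\<integral>\<^sup>+x. indicator B (f x) * (\<integral>\<^sup>+y. g y \<partial>lborel) \<partial>lborel)"
    by (simp add: gball nn_integral_multc nn_integral_distr flip: nn_integral_indicator)
  also have "\<dots> = (\<integral>\<^sup>+x. indicator B (f x) * (\<integral>\<^sup>+y. g (y + - f x) \<partial>lborel) \<partial>lborel)"
    by (simp only: gshift)
  also have "\<dots> = (\<integral>\<^sup>+x. \<integral>\<^sup>+y. indicator B (f x) * g (f x + - y) \<partial>lborel \<partial>lborel)"
    by (subst nn_integral_cmult[symmetric])
      (auto simp: g_def indicator_def norm_minus_commute intro!: nn_integral_cong)
  also have "\<dots> = (\<integral>\<^sup>+y. \<integral>\<^sup>+x. indicator B (f x) * g (f x + - y) \<partial>lborel \<partial>lborel)"
    by (rule lborel_pair.Fubini'[symmetric]) simp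
  also have "\<dots> = (\<integral>\<^sup>+y. \<integral>\<^sup>+x. indicator B (f x + y) * g x \<partial>lborel \<partial>lborel)"
  proof (rule nn_integral_cong)
    fix y :: 'a
    have "(\<integral>\<^sup>+x. indicator B (f x + y) * g x \<partial>lborel) =
      (\<integral>\<^sup>+x. (\<lambda>x. indicator B (f x) * g (f x + - y)) (x + inv f y) \<partial>lborel)"
      by (simp flip: finv add: gf)
    also have "\<dots> = (\<integral>\<^sup>+x. indicator B (f x) * g (f x + - y) \<partial>lborel)"
      by (rule shift) simp
    finally show "(\<integral>\<^sup>+x. indicator B (f x) * g (f x + - y) \<partial>lborel) =
      (\<integral>\<^sup>+x. indicator B (f x + y) * g x \<partial>lborel)" ..
  qed
  also have "\<dots> = (\<integral>\<^sup>+x. \<integral>\<^sup>+y. indicator B (y + f x) * g x \<partial>lborel \<partial>lborel)"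
    by (subst lborel_pair.Fubini') (simp_all add: add.commute)
  also have "\<dots> = (\<integral>\<^sup>+x. emeasure lborel B * g x \<partial>lborel)"
    by (simp add: nn_integral_multc shift)
  also have "\<dots> = emeasure lborel B * emeasure lborel (cball 0 1 :: 'a set)"
    by (simp add: nn_integral_cmult gball)
  finally have eq: "emeasure (distr lborel borel f) B * emeasure lborel (cball 0 1 :: 'a set) =
    emeasure lborel B * emeasure lborel (cball 0 1 :: 'a set)" .
  have c: "emeasure lborel (cball 0 1 :: 'a set) = ennreal (unit_ball_vol (real DIM('a)))"
    by (simp add: emeasure_cball)
  have "unit_ball_vol (real DIM('a)) > 0" by simp
  hence "emeasure lborel (cball 0 1 :: 'a set) \<noteq> 0" "emeasure lborel (cball 0 1 :: 'a set) \<noteq> top"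
    unfolding c by (metis ennreal_eq_0_iff not_le) simp
  from ennreal_mult_divide_eq[OF this] eq
  show "emeasure (distr lborel borel f) B = emeasure lborel B"
    by metis
qed simp

section \<open>The normalized surface measure\<close>

text \<open>The value at 0 is an arbitrary unit vector: \<open>sgn 0\<close> is 0, which would leave
  the sphere. Only the null set {0} is affected.\<close>

definition unit_dir :: "real^'n::finite \<Rightarrow> real^'n" where
  "unit_dir y = (if y = 0 then axis (SOME i. True) 1 else sgn y)"

text \<open>Radial projection of the uniform law on the ball. This encoding inherits orthogonal
  invariance from Lebesgue measure and turns integrals over the sphere into Lebesgue integrals. The
  target space is the sphere itself, so bounds on the sphere are bounds on the whole space.\<close>

definition sphere_measure :: "(real^'n::finite) measure" where
  "sphere_measure = distr (uniform_measure lborel (cball 0 1)) (restrict_space borel (sphere 0 1)) unit_dir"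

lemma unit_dir_measurable [measurable]: "unit_dir \<in> lborel \<rightarrow>\<^sub>M restrict_space borel (sphere 0 1)"
proof -
  have "unit_dir \<in> borel_measurable borel"
    unfolding unit_dir_def[abs_def] sgn_div_norm by measurable
  thus ?thesis
    by (intro measurable_restrict_space2) (auto simp: unit_dir_def norm_sgn)
qed

lemma space_sphere_measure [simp]: "space sphere_measure = sphere 0 1"
  by (simp add: sphere_measure_def space_restrict_space)

lemma measurable_sphere_measureI:
  "f \<in> borel_measurable borel \<Longrightarrow> f \<in> borel_measurable sphere_measure"
  unfolding sphere_measure_def by (simp add: measurable_restrict_space1)

lemma measurable_sphere_measure_contI:
  fixes f :: "real^'n::finite \<Rightarrow> 'b::topological_space"
  shows "continuous_on (sphere 0 1) f \<Longrightarrow> f \<in> borel_measurable sphere_measure"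
  unfolding sphere_measure_def by (simp add: borel_measurable_continuous_on_restrict)

lemma emeasure_unit_cball: 
  "emeasure lborel (cball 0 1 :: (real^'n::finite) set) = ennreal (unit_ball_vol (real CARD('n)))"
  by (simp add: emeasure_cball)

lemma prob_space_sphere_measure: "prob_space (sphere_measure :: (real^'n::finite) measure)"
proof -
  interpret U: prob_space "uniform_measure lborel (cball 0 1 :: (real^'n) set)"
    by (rule prob_space_uniform_measure) (use unit_ball_vol_pos[of "real CARD('n)"] in \<open>auto simp: emeasure_unit_cball simp del: unit_ball_vol_pos\<close>)
  show ?thesis
    unfolding sphere_measure_def by (rule U.prob_space_distr) simp
qed

lemma nn_integral_sphere_measure:
  fixes f :: "real^'n::finite \<Rightarrow> ennreal"
  assumes [measurable]: "f \<in> borel_measurable borel"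
  shows "(\<integral>\<^sup>+z. f z \<partial>sphere_measure) =
    (\<integral>\<^sup>+y. f (sgn y) * indicator (cball 0 1) y \<partial>lborel) / ennreal (unit_ball_vol (real CARD('n)))"
proof -
  have [measurable]: "f \<in> borel_measurable (restrict_space borel (sphere 0 1))"
    by (simp add: measurable_restrict_space1)
  have "(\<integral>\<^sup>+z. f z \<partial>sphere_measure) =
    (\<integral>\<^sup>+y. f (unit_dir y) * indicator (cball 0 1) y \<partial>lborel) / ennreal (unit_ball_vol (real CARD('n)))"
    unfolding sphere_measure_def
    by (subst nn_integral_distr) (auto simp: nn_integral_uniform_measure emeasure_unit_cball)
  also have "(\<integral>\<^sup>+y. f (unit_dir y) * indicator (cball 0 1) y \<partial>lborel) =
    (\<integral>\<^sup>+y. f (sgn y) * indicator (cball 0 1) y \<partial>lborel)"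
    by (intro nn_integral_cong_AE AE_I[of _ _ "{0}"]) (auto simp: unit_dir_def)
  finally show ?thesis .
qed

text \<open>T commutes with \<open>sgn\<close> and preserves the ball, so the invariance of Lebesgue
  measure carries over.\<close>

lemma nn_integral_sphere_measure_orthogonal:
  fixes f :: "real^'n::finite \<Rightarrow> ennreal" and T :: "real^'n \<Rightarrow> real^'n"
  assumes [measurable]: "f \<in> borel_measurable borel" and T: "orthogonal_transformation T"
  shows "(\<integral>\<^sup>+z. f (T z) \<partial>sphere_measure) = (\<integral>\<^sup>+z. f z \<partial>sphere_measure)"
proof -
  note [measurable] = orthogonal_transformation_borel_measurable[OF T]
  have sgn: "T (sgn y) = sgn (T y)" for y
    using T by (simp add: sgn_div_norm orthogonal_transformation_norm orthogonal_transformation_scaleR)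
  have "(\<integral>\<^sup>+y. f (sgn y) * indicator (cball 0 1) y \<partial>lborel) =
        (\<integral>\<^sup>+y. f (sgn y) * indicator (cball 0 1) y \<partial>distr lborel borel T)"
    by (simp add: distr_lborel_orthogonal_transformation[OF T])
  also have "\<dots> = (\<integral>\<^sup>+y. f (T (sgn y)) * indicator (cball 0 1) y \<partial>lborel)"
    by (subst nn_integral_distr) 
      (auto simp: sgn orthogonal_transformation_norm[OF T] indicator_def intro!: nn_integral_cong)
  finally show ?thesis by (simp add: nn_integral_sphere_measure)
qed

section \<open>The joint law of two coordinates on the sphere\<close>

text \<open>The substitution a = c v / sqrt(1 - v^2), whose inverse v = a / sqrt(a^2 + c^2)
  normalizes one coordinate of a vector. As a runs over the whole line, the pushforward of the
  density is identified with Lebesgue measure through its values on bounded intervals.\<close>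

lemma nn_integral_lborel_eq_Ioo:
  fixes \<phi> :: "real \<Rightarrow> ennreal"
  assumes [measurable]: "\<phi> \<in> borel_measurable borel" and c: "0 < c"
  shows "(\<integral>\<^sup>+a. \<phi> a \<partial>lborel) =
    (\<integral>\<^sup>+v. \<phi> (c * v / sqrt (1 - v\<^sup>2)) * ennreal (c * (1 - v\<^sup>2) powr (-3/2)) * indicator {-1<..<1} v \<partial>lborel)"
proof -
  define F where "F = (\<lambda>v::real. c * v / sqrt (1 - v\<^sup>2))"
  define d where "d = (\<lambda>v::real. c * (1 - v\<^sup>2) powr (-3/2))"
  define M where "M = distr (density lborel (\<lambda>v. ennreal (d v) * indicator {-1<..<1} v)) borel F"
  have [measurable]: "F \<in> borel_measurable borel" "d \<in> borel_measurable borel"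
    by (simp_all add: F_def d_def)
  have v1: "1 - v\<^sup>2 > 0" if "v \<in> {-1<..<1}" for v :: real
    using that by (simp add: abs_square_less_1 abs_less_iff)
  have DF: "(F has_real_derivative d v) (at v)" if v: "v \<in> {-1<..<1}" for v
  proof -
    have p: "1 - v\<^sup>2 > 0" by (rule v1[OF v])
    have "(F has_real_derivative
        (c * sqrt (1 - v\<^sup>2) - c * v * (- 2 * v * (inverse (sqrt (1 - v\<^sup>2)) / 2))) / (sqrt (1 - v\<^sup>2))\<^sup>2) (at v)"
      unfolding F_def using p by (auto intro!: derivative_eq_intros simp: power2_eq_square)
    also have "(c * sqrt (1 - v\<^sup>2) - c * v * (- 2 * v * (inverse (sqrt (1 - v\<^sup>2)) / 2))) / (sqrt (1 - v\<^sup>2))\<^sup>2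
       = c * ((sqrt (1 - v\<^sup>2))\<^sup>2 + v\<^sup>2) / (sqrt (1 - v\<^sup>2))^3"
      using p by (simp add: field_simps power2_eq_square power3_eq_cube del: real_sqrt_pow2)
    also have "(sqrt (1 - v\<^sup>2))^3 = (1 - v\<^sup>2) powr (3/2)"
      using p by (simp add: powr_half_sqrt[symmetric] powr_power)
    also have "c * ((sqrt (1 - v\<^sup>2))\<^sup>2 + v\<^sup>2) / (1 - v\<^sup>2) powr (3/2) = d v"
      using p by (simp add: d_def powr_minus divide_simps)
    finally show ?thesis .
  qed
  \<comment> \<open>The inverse of \<open>F\<close>. Up to endpoints it turns the preimage of an
    interval into an interval inside (-1, 1), where the fundamental theorem of calculus
    applies.\<close>
  define G where "G = (\<lambda>l::real. l / sqrt (c\<^sup>2 + l\<^sup>2))"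
  have cl: "c\<^sup>2 + l\<^sup>2 > 0" for l using c by (simp add: add_pos_nonneg)
  have G1: "1 - (G l)\<^sup>2 = c\<^sup>2 / (c\<^sup>2 + l\<^sup>2)" for l
    using cl[of l] c by (simp add: G_def power_divide field_simps)
  have Grange: "G l \<in> {-1<..<1}" for l
  proof -
    have "(G l)\<^sup>2 < 1" using G1[of l] cl[of l] c by (smt (verit) divide_pos_pos zero_less_power)
    thus ?thesis by (simp add: abs_square_less_1 abs_less_iff)
  qed
  have FG: "F (G l) = l" for l
    using cl[of l] c by (simp add: F_def G1 real_sqrt_divide) (simp add: G_def)
  have Fmono: "F x < F y" if "x < y" "x \<in> {-1<..<1}" "y \<in> {-1<..<1}" for x y
  proof (rule DERIV_pos_imp_increasing[OF that(1)])
    fix z assume "x \<le> z" "z \<le> y"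
    hence z: "z \<in> {-1<..<1}" using that by auto
    have "d z > 0" using v1[OF z] c by (simp add: d_def)
    with DF[OF z] show "\<exists>w. (F has_real_derivative w) (at z) \<and> 0 < w" by blast
  qed
  have Fless: "F x < F y \<longleftrightarrow> x < y" if "x \<in> {-1<..<1}" "y \<in> {-1<..<1}" for x y
    using Fmono[of x y] Fmono[of y x] that by (cases x y rule: linorder_cases) auto
  have "lborel = M"
  proof (rule lborel_eqI)
    show "sets M = sets borel" by (simp add: M_def)
    fix l u :: real assume "\<And>b. b \<in> Basis \<Longrightarrow> l \<bullet> b \<le> u \<bullet> b"
    hence lu: "l \<le> u" by simp
    have GG: "G l \<le> G u"
      using Fless[OF Grange Grange, of u l] lu by (simp add: FG)
    have sub: "v \<in> {-1<..<1}" if "v \<in> {G l..G u}" for v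
      using that Grange[of l] Grange[of u] by auto
    have [measurable]: "F -` box l u \<in> sets borel"
      by (rule measurable_sets_borel[where M = borel]) simp_all
    have "emeasure M (box l u) = (\<integral>\<^sup>+v. ennreal (d v) * indicator {-1<..<1} v * indicator (F -` box l u) v \<partial>lborel)"
      unfolding M_def by (subst emeasure_distr) (simp_all add: emeasure_density del: box_real)
    also have "\<dots> = (\<integral>\<^sup>+v. ennreal (d v) * indicator {G l..G u} v \<partial>lborel)"
    proof (intro nn_integral_cong_AE AE_I[of _ _ "{G l, G u}"])
      show "{v \<in> space lborel. \<not> ennreal (d v) * indicator {-1<..<1} v * indicator (F -` box l u) v =
          ennreal (d v) * indicator {G l..G u} v} \<subseteq> {G l, G u}"
      proof (rule subsetI, rule ccontr)
        fix v assume ne: "v \<in> {v \<in> space lborel. \<not> ennreal (d v) * indicator {-1<..<1} v *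
          indicator (F -` box l u) v = ennreal (d v) * indicator {G l..G u} v}" "v \<notin> {G l, G u}"
        have "v \<in> {-1<..<1} \<and> F v \<in> box l u \<longleftrightarrow> v \<in> {G l..G u}"
        proof (cases "v \<in> {-1<..<1}")
          case True
          show ?thesis
            using Fless[OF True Grange[of u]] Fless[OF Grange[of l] True] ne(2) True
            by (auto simp: FG box_real)
        next
          case False
          thus ?thesis using sub by blast
        qed
        with ne(1) show False by (auto simp: indicator_def split: if_splits)
      qed
    qed (auto simp: emeasure_lborel_countable)
    also have "\<dots> = F (G u) - F (G l)"
      using GG sub DF c by (intro nn_integral_FTC_Icc) (auto simp: d_def)
    finally show "emeasure M (box l u) = (\<Prod>b\<in>Basis. (u - l) \<bullet> b)" by (simp add: FG)
  qed
  hence "(\<integral>\<^sup>+a. \<phi> a \<partial>lborel) = (\<integral>\<^sup>+a. \<phi> a \<partial>M)" by simp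
  also have "\<dots> = (\<integral>\<^sup>+v. \<phi> (F v) * ennreal (d v) * indicator {-1<..<1} v \<partial>lborel)"
    unfolding M_def by (simp add: nn_integral_distr nn_integral_density mult_ac)
  finally show ?thesis by (simp add: F_def d_def)
qed

text \<open>Layer cake: |x|^2 is the integral of 2 t over 0 < t < |x|, so the moment is the integral
  of 2 t times the volume of the shell t < |x| \<le> Q. The factor |x|^2 is what remains of the
  Jacobians when two coordinates are normalized.\<close>

lemma nn_integral_sum_squares_ball:
  fixes A :: "'a set" and Q :: real
  assumes A: "finite A" and Q: "0 < Q"
  defines "S \<equiv> (\<lambda>x. \<Sum>a\<in>A. (x a)\<^sup>2)" and "k \<equiv> card A"
  shows "(\<integral>\<^sup>+x. ennreal (S x) * indicator {..Q\<^sup>2} (S x) \<partial>Pi\<^sub>M A (\<lambda>_. lborel)) =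
    ennreal (unit_ball_vol (real k) * (real k / (real k + 2)) * Q ^ (k + 2))"
proof -
  let ?M = "Pi\<^sub>M A (\<lambda>_. lborel :: real measure)"
  interpret product_sigma_finite "\<lambda>_. lborel :: real measure" by standard
  interpret M: sigma_finite_measure ?M by (rule sigma_finite[OF A])
  interpret P: pair_sigma_finite ?M "lborel :: real measure" ..
  have [measurable]: "S \<in> borel_measurable ?M" unfolding S_def using A by measurable
  have S0: "S x \<ge> 0" for x by (simp add: S_def sum_nonneg)
  define \<omega> where "\<omega> = unit_ball_vol (real k)"
  have \<omega>: "\<omega> \<ge> 0" by (simp add: \<omega>_def)
  have meas: "emeasure ?M {x \<in> space ?M. sqrt (S x) \<le> r} = ennreal (\<omega> * r ^ k)" if "r > 0" for r
    using emeasure_cball_aux[OF A that] by (simp add: S_def k_def \<omega>_def Collect_conj_eq Int_commute)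
  have cake: "ennreal (S x) * indicator {..Q\<^sup>2} (S x) =
      (\<integral>\<^sup>+t. ennreal (2 * t) * indicator {0..Q} t * indicator {x. t < sqrt (S x) \<and> sqrt (S x) \<le> Q} x \<partial>lborel)" for x
  proof (cases "S x \<le> Q\<^sup>2")
    case True
    hence sq: "sqrt (S x) \<le> Q" using Q by (simp add: real_le_lsqrt)
    have "(\<integral>\<^sup>+t. ennreal (2 * t) * indicator {0..Q} t * indicator {x. t < sqrt (S x) \<and> sqrt (S x) \<le> Q} x \<partial>lborel)
      = (\<integral>\<^sup>+t. ennreal (2 * t) * indicator {0..sqrt (S x)} t \<partial>lborel)"
      using sq by (intro nn_integral_cong_AE AE_I[of _ _ "{sqrt (S x)}"]) (auto simp: indicator_def)
    also have "\<dots> = (sqrt (S x))\<^sup>2 - 0\<^sup>2"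
      using S0[of x] by (intro nn_integral_FTC_Icc) (auto intro!: derivative_eq_intros)
    finally show ?thesis using True S0[of x] by simp
  next
    case False
    hence "\<not> sqrt (S x) \<le> Q" using sqrt_le_D by blast
    thus ?thesis using False by simp
  qed
  have "(\<integral>\<^sup>+x. ennreal (S x) * indicator {..Q\<^sup>2} (S x) \<partial>?M) =
    (\<integral>\<^sup>+x. \<integral>\<^sup>+t. ennreal (2 * t) * indicator {0..Q} t * indicator {x. t < sqrt (S x) \<and> sqrt (S x) \<le> Q} x \<partial>lborel \<partial>?M)"
    by (simp only: cake)
  also have "\<dots> = (\<integral>\<^sup>+t. \<integral>\<^sup>+x. ennreal (2 * t) * indicator {0..Q} t * indicator {x. t < sqrt (S x) \<and> sqrt (S x) \<le> Q} x \<partial>?M \<partial>lborel)"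
    by (rule P.Fubini'[symmetric]) (simp add: indicator_def)
  also have "\<dots> = (\<integral>\<^sup>+t. ennreal (2 * t * (\<omega> * Q ^ k - \<omega> * t ^ k)) * indicator {0..Q} t \<partial>lborel)"
  \<comment> \<open>The volume formula \<open>meas\<close> is stated for positive radii, so t = 0 is
    removed as a null set.\<close>
  proof (intro nn_integral_cong_AE AE_I[of _ _ "{0}"] subsetI; clarsimp)
    fix t :: real
    assume ne: "(\<integral>\<^sup>+x. ennreal (2 * t) * indicator {0..Q} t * indicator {x. t < sqrt (S x) \<and> sqrt (S x) \<le> Q} x \<partial>?M)
      \<noteq> ennreal (2 * t * (\<omega> * Q ^ k - \<omega> * t ^ k)) * indicator {0..Q} t"
    show "t = 0"
    proof (rule ccontr)
      assume t0: "t \<noteq> 0"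
      have "\<not> t < 0" "\<not> Q < t" using ne by auto
      with t0 have t: "0 < t" "t \<le> Q" by auto
      have "(\<integral>\<^sup>+x. ennreal (2 * t) * indicator {0..Q} t * indicator {x. t < sqrt (S x) \<and> sqrt (S x) \<le> Q} x \<partial>?M)
        = ennreal (2 * t) * (\<integral>\<^sup>+x. indicator {x \<in> space ?M. t < sqrt (S x) \<and> sqrt (S x) \<le> Q} x \<partial>?M)"
        using t by (subst nn_integral_cmult[symmetric]) (auto simp: indicator_def intro!: nn_integral_cong)
      also have "(\<integral>\<^sup>+x. indicator {x \<in> space ?M. t < sqrt (S x) \<and> sqrt (S x) \<le> Q} x \<partial>?M) =
        emeasure ?M {x \<in> space ?M. t < sqrt (S x) \<and> sqrt (S x) \<le> Q}"
        by (subst nn_integral_indicator) auto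
      also have "{x \<in> space ?M. t < sqrt (S x) \<and> sqrt (S x) \<le> Q} =
        {x \<in> space ?M. sqrt (S x) \<le> Q} - {x \<in> space ?M. sqrt (S x) \<le> t}" by auto
      also have "emeasure ?M \<dots> = emeasure ?M {x \<in> space ?M. sqrt (S x) \<le> Q} - emeasure ?M {x \<in> space ?M. sqrt (S x) \<le> t}"
        using t by (intro emeasure_Diff) (auto simp: meas)
      also have "\<dots> = ennreal (\<omega> * Q ^ k - \<omega> * t ^ k)"
        using t Q \<omega> by (simp add: meas ennreal_minus)
      finally show False using ne t by (simp add: ennreal_mult')
    qed
  qed
  also have "\<dots> = (\<omega> * Q ^ k * Q\<^sup>2 - 2 * \<omega> * Q ^ (k + 2) / (real k + 2)) - (\<omega> * Q ^ k * 0\<^sup>2 - 2 * \<omega> * 0 ^ (k + 2) / (real k + 2))"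
  proof (rule nn_integral_FTC_Icc)
    fix t assume t: "t \<in> {0..Q}"
    have [derivative_intros]: "((\<lambda>t. t ^ (k + 2)) has_real_derivative (real k + 2) * t ^ (k + 1)) (at t)"
      using DERIV_pow[of "k + 2" t] by (simp add: add.commute)
    show "((\<lambda>t. \<omega> * Q ^ k * t\<^sup>2 - 2 * \<omega> * t ^ (k + 2) / (real k + 2)) has_real_derivative 2 * t * (\<omega> * Q ^ k - \<omega> * t ^ k)) (at t)"
      by (rule derivative_eq_intros refl | simp)+ (simp add: field_simps)
    show "0 \<le> 2 * t * (\<omega> * Q ^ k - \<omega> * t ^ k)"
      using t \<omega> by (intro mult_nonneg_nonneg) (auto intro!: mult_left_mono power_mono)
  qed (use Q in auto)
  also have "(\<omega> * Q ^ k * Q\<^sup>2 - 2 * \<omega> * Q ^ (k + 2) / (real k + 2)) - (\<omega> * Q ^ k * 0\<^sup>2 - 2 * \<omega> * 0 ^ (k + 2) / (real k + 2))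
     = \<omega> * (real k / (real k + 2)) * Q ^ (k + 2)"
    by (simp add: power_add power2_eq_square field_simps)
  finally show ?thesis by (simp add: \<omega>_def)
qed

text \<open>The zero set lies in every centered ball of radius r, whose volume is a constant times
  r^k with k = \<open>card A\<close> > 0, and this tends to 0 with r.\<close>

lemma AE_sum_squares_pos:
  fixes A :: "'a set"
  assumes A: "finite A" "A \<noteq> {}"
  shows "AE x in Pi\<^sub>M A (\<lambda>_. lborel). 0 < (\<Sum>a\<in>A. (x a :: real)\<^sup>2)"
proof -
  let ?M = "Pi\<^sub>M A (\<lambda>_. lborel :: real measure)"
  define N where "N = {x \<in> space ?M. (\<Sum>a\<in>A. (x a)\<^sup>2) \<le> 0}"
  define \<omega> where "\<omega> = unit_ball_vol (real (card A))"
  have [measurable]: "N \<in> sets ?M" unfolding N_def using A by measurable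
  have k: "card A > 0" using A by (simp add: card_gt_0_iff)
  have le: "emeasure ?M N \<le> ennreal (\<omega> * r ^ card A)" if r: "r > 0" for r
  proof -
    have "N \<subseteq> {f. sqrt (\<Sum>i\<in>A. (f i)\<^sup>2) \<le> r} \<inter> space ?M"
      using r by (auto simp: N_def intro: order_trans[of _ 0])
    hence "emeasure ?M N \<le> emeasure ?M ({f. sqrt (\<Sum>i\<in>A. (f i)\<^sup>2) \<le> r} \<inter> space ?M)"
      using A by (intro emeasure_mono) auto
    also have "\<dots> = ennreal (\<omega> * r ^ card A)"
      using emeasure_cball_aux[OF A(1) r] by (simp add: \<omega>_def)
    finally show ?thesis .
  qed
  have "((\<lambda>r. \<omega> * r ^ card A) \<longlongrightarrow> \<omega> * 0 ^ card A) (at_right (0::real))"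
    by (intro tendsto_intros)
  hence "((\<lambda>r. \<omega> * r ^ card A) \<longlongrightarrow> 0) (at_right (0::real))"
    using k by (simp only: zero_power mult_zero_right)
  from tendsto_ennrealI[OF this]
  have "((\<lambda>r. ennreal (\<omega> * r ^ card A)) \<longlongrightarrow> 0) (at_right (0::real))"
    by (simp only: ennreal_0)
  moreover have "eventually (\<lambda>r. emeasure ?M N \<le> ennreal (\<omega> * r ^ card A)) (at_right (0::real))"
    using le eventually_at_right_less by (rule eventually_mono[rotated])
  ultimately have "emeasure ?M N \<le> 0"
    by (intro tendsto_lowerbound[of _ _ "at_right (0::real)"]) auto
  thus ?thesis
    by (intro AE_I[of _ _ N]) (auto simp: N_def)
qed

text \<open>For fixed b substitute a = c s / sqrt(1 - s^2) with c^2 = b^2 + q, and afterwards b = r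
  v / sqrt(1 - v^2) with r^2 = q. The normalized pair becomes (s, v sqrt(1 - s^2)), and the
  condition a^2 + b^2 + q \<le> 1 becomes q \<le> (1 - s^2)(1 - v^2). Here q stands for the sum of
  squares of the remaining coordinates.\<close>

lemma nn_integral_normalized_pair:
  fixes F :: "real \<Rightarrow> real \<Rightarrow> ennreal" and q :: real
  assumes [measurable]: "case_prod F \<in> borel_measurable (borel \<Otimes>\<^sub>M borel)" and q: "0 < q"
  shows "(\<integral>\<^sup>+b. \<integral>\<^sup>+a. F (a / sqrt (a\<^sup>2 + b\<^sup>2 + q)) (b / sqrt (a\<^sup>2 + b\<^sup>2 + q)) *
            indicator {..1} (a\<^sup>2 + b\<^sup>2 + q) \<partial>lborel \<partial>lborel) =
    (\<integral>\<^sup>+s. \<integral>\<^sup>+v. ennreal ((1 - s\<^sup>2) powr (-3/2) * (1 - v\<^sup>2) powr (-2)) *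
       indicator {-1<..<1} s * indicator {-1<..<1} v * F s (v * sqrt (1 - s\<^sup>2)) *
       (ennreal q * indicator {..(1 - s\<^sup>2) * (1 - v\<^sup>2)} q) \<partial>lborel \<partial>lborel)"
proof -
  have pos: "1 - v\<^sup>2 > 0" if "v \<in> {-1<..<1}" for v :: real
    using that by (simp add: abs_square_less_1 abs_less_iff)
  let ?J = "\<lambda>x. indicator {-1<..<1::real} x :: ennreal"
  have rad: "(c * s / sqrt (1 - s\<^sup>2))\<^sup>2 + c\<^sup>2 = c\<^sup>2 / (1 - s\<^sup>2)" if "s \<in> {-1<..<1}" for c s :: real
    using pos[OF that] by (simp add: power_divide power_mult_distrib divide_simps) (simp add: algebra_simps)
  have "(\<integral>\<^sup>+b. \<integral>\<^sup>+a. F (a / sqrt (a\<^sup>2 + b\<^sup>2 + q)) (b / sqrt (a\<^sup>2 + b\<^sup>2 + q)) *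
            indicator {..1} (a\<^sup>2 + b\<^sup>2 + q) \<partial>lborel \<partial>lborel) =
    (\<integral>\<^sup>+b. \<integral>\<^sup>+s. F s (b * sqrt (1 - s\<^sup>2) / sqrt (b\<^sup>2 + q)) * indicator {..1 - s\<^sup>2} (b\<^sup>2 + q) *
       ennreal (sqrt (b\<^sup>2 + q) * (1 - s\<^sup>2) powr (-3/2)) * ?J s \<partial>lborel \<partial>lborel)"
  proof (rule nn_integral_cong)
    fix b :: real
    define c where "c = sqrt (b\<^sup>2 + q)"
    have c: "c > 0" "c\<^sup>2 = b\<^sup>2 + q" using q by (simp_all add: c_def add_nonneg_pos)
    have "(\<integral>\<^sup>+a. F (a / sqrt (a\<^sup>2 + b\<^sup>2 + q)) (b / sqrt (a\<^sup>2 + b\<^sup>2 + q)) * indicator {..1} (a\<^sup>2 + b\<^sup>2 + q) \<partial>lborel) =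
      (\<integral>\<^sup>+a. F (a / sqrt (a\<^sup>2 + c\<^sup>2)) (b / sqrt (a\<^sup>2 + c\<^sup>2)) * indicator {..1} (a\<^sup>2 + c\<^sup>2) \<partial>lborel)"
      by (simp add: c(2) add.assoc)
    also have "\<dots> = (\<integral>\<^sup>+s. F s (b * sqrt (1 - s\<^sup>2) / c) * indicator {..1 - s\<^sup>2} (c\<^sup>2) *
       ennreal (c * (1 - s\<^sup>2) powr (-3/2)) * ?J s \<partial>lborel)"
    proof (subst nn_integral_lborel_eq_Ioo[OF _ c(1)], simp, rule nn_integral_cong)
      fix s :: real
      show "F (c * s / sqrt (1 - s\<^sup>2) / sqrt ((c * s / sqrt (1 - s\<^sup>2))\<^sup>2 + c\<^sup>2))
          (b / sqrt ((c * s / sqrt (1 - s\<^sup>2))\<^sup>2 + c\<^sup>2)) *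
          indicator {..1} ((c * s / sqrt (1 - s\<^sup>2))\<^sup>2 + c\<^sup>2) *
          ennreal (c * (1 - s\<^sup>2) powr (-3/2)) * ?J s =
        F s (b * sqrt (1 - s\<^sup>2) / c) * indicator {..1 - s\<^sup>2} (c\<^sup>2) *
          ennreal (c * (1 - s\<^sup>2) powr (-3/2)) * ?J s"
      proof (cases "s \<in> {-1<..<1}")
        case True
        have p: "1 - s\<^sup>2 > 0" by (rule pos[OF True])
        hence "c\<^sup>2 / (1 - s\<^sup>2) \<le> 1 \<longleftrightarrow> c\<^sup>2 \<le> 1 - s\<^sup>2" by (simp add: divide_simps)
        thus ?thesis
          unfolding rad[OF True] using p c(1) by (simp add: real_sqrt_divide indicator_def)
      qed simp
    qed
    finally show "(\<integral>\<^sup>+a. F (a / sqrt (a\<^sup>2 + b\<^sup>2 + q)) (b / sqrt (a\<^sup>2 + b\<^sup>2 + q)) * indicator {..1} (a\<^sup>2 + b\<^sup>2 + q) \<partial>lborel) =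
      (\<integral>\<^sup>+s. F s (b * sqrt (1 - s\<^sup>2) / sqrt (b\<^sup>2 + q)) * indicator {..1 - s\<^sup>2} (b\<^sup>2 + q) *
       ennreal (sqrt (b\<^sup>2 + q) * (1 - s\<^sup>2) powr (-3/2)) * ?J s \<partial>lborel)"
      unfolding c(2) unfolding c_def .
  qed
  also have "\<dots> = (\<integral>\<^sup>+s. \<integral>\<^sup>+b. F s (b * sqrt (1 - s\<^sup>2) / sqrt (b\<^sup>2 + q)) * indicator {..1 - s\<^sup>2} (b\<^sup>2 + q) *
       ennreal (sqrt (b\<^sup>2 + q) * (1 - s\<^sup>2) powr (-3/2)) * ?J s \<partial>lborel \<partial>lborel)"
    by (rule lborel_pair.Fubini'[symmetric]) (simp add: indicator_def)
  also have "\<dots> = (\<integral>\<^sup>+s. \<integral>\<^sup>+v. ennreal ((1 - s\<^sup>2) powr (-3/2) * (1 - v\<^sup>2) powr (-2)) *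
       ?J s * ?J v * F s (v * sqrt (1 - s\<^sup>2)) *
       (ennreal q * indicator {..(1 - s\<^sup>2) * (1 - v\<^sup>2)} q) \<partial>lborel \<partial>lborel)"
  proof (rule nn_integral_cong)
    fix s :: real
    define r where "r = sqrt q"
    have r: "r > 0" "r\<^sup>2 = q" using q by (simp_all add: r_def)
    show "(\<integral>\<^sup>+b. F s (b * sqrt (1 - s\<^sup>2) / sqrt (b\<^sup>2 + q)) * indicator {..1 - s\<^sup>2} (b\<^sup>2 + q) *
       ennreal (sqrt (b\<^sup>2 + q) * (1 - s\<^sup>2) powr (-3/2)) * ?J s \<partial>lborel) =
     (\<integral>\<^sup>+v. ennreal ((1 - s\<^sup>2) powr (-3/2) * (1 - v\<^sup>2) powr (-2)) *
       ?J s * ?J v * F s (v * sqrt (1 - s\<^sup>2)) *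
       (ennreal q * indicator {..(1 - s\<^sup>2) * (1 - v\<^sup>2)} q) \<partial>lborel)"
    proof (subst nn_integral_lborel_eq_Ioo[OF _ r(1)], simp, rule nn_integral_cong)
      fix v :: real
      show "F s (r * v / sqrt (1 - v\<^sup>2) * sqrt (1 - s\<^sup>2) / sqrt ((r * v / sqrt (1 - v\<^sup>2))\<^sup>2 + q)) *
         indicator {..1 - s\<^sup>2} ((r * v / sqrt (1 - v\<^sup>2))\<^sup>2 + q) *
         ennreal (sqrt ((r * v / sqrt (1 - v\<^sup>2))\<^sup>2 + q) * (1 - s\<^sup>2) powr (-3/2)) * ?J s *
         ennreal (r * (1 - v\<^sup>2) powr (-3/2)) * ?J v =
        ennreal ((1 - s\<^sup>2) powr (-3/2) * (1 - v\<^sup>2) powr (-2)) *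
         ?J s * ?J v * F s (v * sqrt (1 - s\<^sup>2)) *
         (ennreal q * indicator {..(1 - s\<^sup>2) * (1 - v\<^sup>2)} q)"
      proof (cases "v \<in> {-1<..<1}")
        case True
        have p: "1 - v\<^sup>2 > 0" by (rule pos[OF True])
        have rq: "(r * v / sqrt (1 - v\<^sup>2))\<^sup>2 + q = q / (1 - v\<^sup>2)"
          using rad[OF True, of r] by (simp add: r(2))
        have arg: "r * v / sqrt (1 - v\<^sup>2) * sqrt (1 - s\<^sup>2) / sqrt (q / (1 - v\<^sup>2)) = v * sqrt (1 - s\<^sup>2)"
          using p r(1) by (simp add: real_sqrt_divide flip: r_def)
        have ind: "q / (1 - v\<^sup>2) \<le> 1 - s\<^sup>2 \<longleftrightarrow> q \<le> (1 - s\<^sup>2) * (1 - v\<^sup>2)"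
          using p by (simp add: pos_divide_le_eq)
        \<comment> \<open>The Jacobian in s has the factor c = sqrt(b^2 + q), which equals sqrt(q /
          (1 - v^2)) after the substitution for b. Together with the Jacobian in v it gives the
          exponent -2 and the factor q.\<close>
        have "sqrt (q / (1 - v\<^sup>2)) * r * (1 - v\<^sup>2) powr (-3/2) = q * (1 - v\<^sup>2) powr (-2)"
        proof -
          have "sqrt (q / (1 - v\<^sup>2)) * r = q * (1 - v\<^sup>2) powr (-1/2)"
            using p q r by (simp add: real_sqrt_divide powr_minus powr_half_sqrt divide_simps power2_eq_square flip: r_def)
          thus ?thesis by (simp flip: powr_add)
        qed
        hence w: "ennreal (sqrt (q / (1 - v\<^sup>2)) * (1 - s\<^sup>2) powr (-3/2)) * ennreal (r * (1 - v\<^sup>2) powr (-3/2)) =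
          ennreal ((1 - s\<^sup>2) powr (-3/2) * (1 - v\<^sup>2) powr (-2)) * ennreal q"
          using p q r(1) by (simp flip: ennreal_mult' ennreal_mult add: mult_ac)
        show ?thesis
          unfolding rq arg using True w by (simp add: indicator_def ind mult_ac)
      qed simp
    qed
  qed
  finally show ?thesis .
qed

text \<open>Lebesgue measure is a product over coordinates. Normalizing the pair leaves S, the sum
  of squares of the other n - 2 coordinates, as a factor cut off at (1 - s^2)(1 - v^2). The second
  moment of a ball in these coordinates is a constant times the power n/2 of that cutoff, so the
  density factors in s and v.\<close>

theorem nn_integral_sphere_measure_two_coords:
  fixes F :: "real \<Rightarrow> real \<Rightarrow> ennreal" and i j :: "'n::finite"
  assumes [measurable]: "case_prod F \<in> borel_measurable (borel \<Otimes>\<^sub>M borel)"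
    and ij: "i \<noteq> j" and card: "CARD('n) \<ge> 3"
  defines "n \<equiv> real CARD('n)"
  shows "(\<integral>\<^sup>+z. F (z $ i) (z $ j) \<partial>(sphere_measure :: (real^'n) measure)) =
    ennreal ((n - 2) / (2 * pi)) *
    (\<integral>\<^sup>+s. \<integral>\<^sup>+v. ennreal ((1 - s\<^sup>2) powr ((n - 3) / 2) * (1 - v\<^sup>2) powr ((n - 4) / 2)) *
       indicator {-1<..<1} s * indicator {-1<..<1} v * F s (v * sqrt (1 - s\<^sup>2)) \<partial>lborel \<partial>lborel)"
proof -
  let ?J = "\<lambda>x. indicator {-1<..<1::real} x :: ennreal"
  define ei ej :: "real^'n" where "ei = axis i 1" and "ej = axis j 1"
  define A where "A = Basis - {ei, ej}"
  have B: "ei \<in> Basis" "ej \<in> Basis" "ei \<noteq> ej"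
    using ij by (auto simp: ei_def ej_def axis_in_Basis_iff axis_eq_axis)
  have A: "finite A" "ei \<notin> insert ej A" "ej \<notin> A" "Basis = insert ei (insert ej A)"
    using B by (auto simp: A_def)
  have cA: "card A = CARD('n) - 2"
    using B by (simp add: A_def card_Diff_subset DIM_cart)
  have A0: "A \<noteq> {}" using cA card by auto
  define M where "M = Pi\<^sub>M A (\<lambda>_. lborel :: real measure)"
  define S :: "(real^'n \<Rightarrow> real) \<Rightarrow> real" where "S = (\<lambda>x. \<Sum>b\<in>A. (x b)\<^sup>2)"
  interpret product_sigma_finite "\<lambda>_. lborel :: real measure" by standard
  interpret M: sigma_finite_measure M unfolding M_def by (rule sigma_finite[OF A(1)])
  interpret P: pair_sigma_finite M "lborel :: real measure" ..
  have [measurable]: "S \<in> borel_measurable M" unfolding S_def M_def using A by measurable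
  define g where "g = (\<lambda>a b q. F (a / sqrt (a\<^sup>2 + b\<^sup>2 + q)) (b / sqrt (a\<^sup>2 + b\<^sup>2 + q)) * indicator {..1} (a\<^sup>2 + b\<^sup>2 + q))"
  have [measurable (raw)]: "(\<lambda>x. g (f1 x) (f2 x) (f3 x)) \<in> borel_measurable N"
    if [measurable]: "f1 \<in> borel_measurable N" "f2 \<in> borel_measurable N" "f3 \<in> borel_measurable N"
    for f1 f2 f3 :: "'x \<Rightarrow> real" and N
    unfolding g_def by measurable
  define vec :: "(real^'n \<Rightarrow> real) \<Rightarrow> real^'n" where "vec = (\<lambda>f. \<Sum>b\<in>Basis. f b *\<^sub>R b)"
  have vec_nth: "vec f $ i = f ei" "vec f $ j = f ej" for f
    using B unfolding cart_eq_inner_axis ei_def ej_def vec_def by (simp_all only: inner_sum_left_Basis)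
  have vec_norm: "norm (vec f) = sqrt ((f ei)\<^sup>2 + (f ej)\<^sup>2 + S f)" for f
  proof -
    have "norm (vec f) = sqrt (\<Sum>b\<in>Basis. (f b)\<^sup>2)"
      unfolding norm_conv_dist by (subst euclidean_dist_l2) (simp add: vec_def L2_set_def)
    also have "(\<Sum>b\<in>Basis. (f b)\<^sup>2) = (f ei)\<^sup>2 + (f ej)\<^sup>2 + S f"
      using A(1-3) by (simp add: A(4) S_def)
    finally show ?thesis .
  qed
  have Fm [measurable]: "(\<lambda>z::real^'n. F (z $ i) (z $ j)) \<in> borel_measurable borel"
    by measurable
  have "(\<lambda>y::real^'n. F (sgn y $ i) (sgn y $ j)) \<in> borel_measurable borel"
    by (rule measurable_compose[OF _ Fm]) (simp add: sgn_div_norm)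
  hence Fsgn: "(\<lambda>y::real^'n. F (sgn y $ i) (sgn y $ j) * indicator (cball 0 1) y) \<in> borel_measurable borel"
    by (intro borel_measurable_times_ennreal borel_measurable_indicator borel_closed closed_cball)
  have "(\<integral>\<^sup>+y. F (sgn y $ i) (sgn y $ j) * indicator (cball 0 1) y \<partial>(lborel :: (real^'n) measure)) =
    (\<integral>\<^sup>+y. F (sgn y $ i) (sgn y $ j) * indicator (cball 0 1) y
       \<partial>(distr (Pi\<^sub>M Basis (\<lambda>_. lborel)) borel (\<lambda>f. \<Sum>b\<in>Basis. f b *\<^sub>R b)))"
    by (subst lborel_eq) simp
  also have "\<dots> = (\<integral>\<^sup>+f. F (sgn (vec f) $ i) (sgn (vec f) $ j) * indicator (cball 0 1) (vec f) \<partial>Pi\<^sub>M Basis (\<lambda>_. lborel))"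
    using Fsgn by (subst nn_integral_distr) (simp_all add: vec_def)
  also have "\<dots> = (\<integral>\<^sup>+f. g (f ei) (f ej) (S f) \<partial>Pi\<^sub>M (insert ei (insert ej A)) (\<lambda>_. lborel))"
    by (simp add: g_def sgn_div_norm vec_nth vec_norm indicator_def divide_inverse mult.commute flip: A(4))
  also have "\<dots> = (\<integral>\<^sup>+x. \<integral>\<^sup>+a. g a (x ej) (S x) \<partial>lborel \<partial>Pi\<^sub>M (insert ej A) (\<lambda>_. lborel))"
  proof (subst product_nn_integral_insert)
    have "S \<in> borel_measurable (Pi\<^sub>M (insert ei (insert ej A)) (\<lambda>_. lborel))"
      unfolding S_def by measurable
    thus "(\<lambda>f. g (f ei) (f ej) (S f)) \<in> borel_measurable (Pi\<^sub>M (insert ei (insert ej A)) (\<lambda>_. lborel))"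
      by measurable
    have "S (x(ei := a)) = S x" for x a
      unfolding S_def using A by (intro sum.cong) auto
    thus "(\<integral>\<^sup>+x. \<integral>\<^sup>+y. g ((x(ei := y)) ei) ((x(ei := y)) ej) (S (x(ei := y))) \<partial>lborel \<partial>Pi\<^sub>M (insert ej A) (\<lambda>_. lborel)) =
      (\<integral>\<^sup>+x. \<integral>\<^sup>+a. g a (x ej) (S x) \<partial>lborel \<partial>Pi\<^sub>M (insert ej A) (\<lambda>_. lborel))"
      using B(3) by simp
  qed (use A in auto)
  also have "\<dots> = (\<integral>\<^sup>+x. \<integral>\<^sup>+b. \<integral>\<^sup>+a. g a b (S x) \<partial>lborel \<partial>lborel \<partial>M)"
  proof (subst product_nn_integral_insert)
    have [measurable]: "S \<in> borel_measurable (Pi\<^sub>M (insert ej A) (\<lambda>_. lborel))"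
      unfolding S_def by measurable
    show "(\<lambda>x. \<integral>\<^sup>+a. g a (x ej) (S x) \<partial>lborel) \<in> borel_measurable (Pi\<^sub>M (insert ej A) (\<lambda>_. lborel))"
      by measurable
    have "S (x(ej := a)) = S x" for x a
      unfolding S_def using A by (intro sum.cong) auto
    thus "(\<integral>\<^sup>+x. \<integral>\<^sup>+y. \<integral>\<^sup>+a. g a ((x(ej := y)) ej) (S (x(ej := y))) \<partial>lborel \<partial>lborel \<partial>Pi\<^sub>M A (\<lambda>_. lborel)) =
      (\<integral>\<^sup>+x. \<integral>\<^sup>+b. \<integral>\<^sup>+a. g a b (S x) \<partial>lborel \<partial>lborel \<partial>M)"
      by (simp add: M_def)
  qed (use A in auto)
  also have "\<dots> = (\<integral>\<^sup>+x. \<integral>\<^sup>+s. \<integral>\<^sup>+v. ennreal ((1 - s\<^sup>2) powr (-3/2) * (1 - v\<^sup>2) powr (-2)) *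
       ?J s * ?J v * F s (v * sqrt (1 - s\<^sup>2)) *
       (ennreal (S x) * indicator {..(1 - s\<^sup>2) * (1 - v\<^sup>2)} (S x)) \<partial>lborel \<partial>lborel \<partial>M)"
  proof (rule nn_integral_cong_AE)
    have "AE x in M. 0 < S x"
      unfolding M_def S_def by (rule AE_sum_squares_pos[OF A(1) A0])
    thus "AE x in M. (\<integral>\<^sup>+b. \<integral>\<^sup>+a. g a b (S x) \<partial>lborel \<partial>lborel) =
      (\<integral>\<^sup>+s. \<integral>\<^sup>+v. ennreal ((1 - s\<^sup>2) powr (-3/2) * (1 - v\<^sup>2) powr (-2)) *
       ?J s * ?J v * F s (v * sqrt (1 - s\<^sup>2)) *
       (ennreal (S x) * indicator {..(1 - s\<^sup>2) * (1 - v\<^sup>2)} (S x)) \<partial>lborel \<partial>lborel)"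
      unfolding g_def by eventually_elim (rule nn_integral_normalized_pair[OF assms(1)])
  qed
  \<comment> \<open>The remaining coordinates are moved innermost, where they enter only through S
    and its cutoff.\<close>
  also have "\<dots> = (\<integral>\<^sup>+s. \<integral>\<^sup>+x. \<integral>\<^sup>+v. ennreal ((1 - s\<^sup>2) powr (-3/2) * (1 - v\<^sup>2) powr (-2)) *
       ?J s * ?J v * F s (v * sqrt (1 - s\<^sup>2)) *
       (ennreal (S x) * indicator {..(1 - s\<^sup>2) * (1 - v\<^sup>2)} (S x)) \<partial>lborel \<partial>M \<partial>lborel)"
    by (rule P.Fubini'[symmetric]) (simp add: indicator_def)
  also have "\<dots> = (\<integral>\<^sup>+s. \<integral>\<^sup>+v. \<integral>\<^sup>+x. ennreal ((1 - s\<^sup>2) powr (-3/2) * (1 - v\<^sup>2) powr (-2)) *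
       ?J s * ?J v * F s (v * sqrt (1 - s\<^sup>2)) *
       (ennreal (S x) * indicator {..(1 - s\<^sup>2) * (1 - v\<^sup>2)} (S x)) \<partial>M \<partial>lborel \<partial>lborel)"
    by (rule nn_integral_cong, rule P.Fubini'[symmetric]) (simp add: indicator_def)
  also have "\<dots> = (\<integral>\<^sup>+s. \<integral>\<^sup>+v. ennreal (unit_ball_vol (n - 2) * ((n - 2) / n)) *
      (ennreal ((1 - s\<^sup>2) powr ((n - 3) / 2) * (1 - v\<^sup>2) powr ((n - 4) / 2)) *
       ?J s * ?J v * F s (v * sqrt (1 - s\<^sup>2))) \<partial>lborel \<partial>lborel)"
  proof (intro nn_integral_cong)
    fix s v :: real
    define W where "W = ennreal ((1 - s\<^sup>2) powr (-3/2) * (1 - v\<^sup>2) powr (-2)) * ?J s * ?J v * F s (v * sqrt (1 - s\<^sup>2))"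
    have nn: "n = real (card A) + 2" using cA card by (simp add: n_def of_nat_diff)
    have "(\<integral>\<^sup>+x. W * (ennreal (S x) * indicator {..(1 - s\<^sup>2) * (1 - v\<^sup>2)} (S x)) \<partial>M) =
      W * (\<integral>\<^sup>+x. ennreal (S x) * indicator {..(1 - s\<^sup>2) * (1 - v\<^sup>2)} (S x) \<partial>M)"
      by (rule nn_integral_cmult) simp
    also have "\<dots> = ennreal (unit_ball_vol (n - 2) * ((n - 2) / n)) *
      (ennreal ((1 - s\<^sup>2) powr ((n - 3) / 2) * (1 - v\<^sup>2) powr ((n - 4) / 2)) *
       ?J s * ?J v * F s (v * sqrt (1 - s\<^sup>2)))"
    proof (cases "s \<in> {-1<..<1} \<and> v \<in> {-1<..<1}")
      case True
      have p: "1 - s\<^sup>2 > 0" "1 - v\<^sup>2 > 0"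
        using True by (simp_all add: abs_square_less_1 abs_less_iff)
      \<comment> \<open>The cutoff radius in the remaining coordinates. Their moment scales as Q^n,
        which adds n/2 to the exponents -3/2 and -2.\<close>
      define Q where "Q = sqrt ((1 - s\<^sup>2) * (1 - v\<^sup>2))"
      have Q: "Q > 0" "(1 - s\<^sup>2) * (1 - v\<^sup>2) = Q\<^sup>2" using p by (simp_all add: Q_def)
      have Qn: "Q ^ (card A + 2) = (1 - s\<^sup>2) powr (n / 2) * (1 - v\<^sup>2) powr (n / 2)"
      proof -
        have "Q ^ (card A + 2) = Q powr real (card A + 2)" using Q(1) by (rule powr_realpow[symmetric])
        also have "real (card A + 2) = n" by (simp add: nn)
        also have "Q powr n = (((1 - s\<^sup>2) * (1 - v\<^sup>2)) powr (1 / 2)) powr n"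
          using p by (subst powr_half_sqrt) (simp_all add: Q_def)
        also have "\<dots> = ((1 - s\<^sup>2) * (1 - v\<^sup>2)) powr (n / 2)"
          by (simp add: powr_powr)
        also have "\<dots> = (1 - s\<^sup>2) powr (n / 2) * (1 - v\<^sup>2) powr (n / 2)" using p by (simp add: powr_mult)
        finally show ?thesis .
      qed
      have "(1 - s\<^sup>2) powr (-3/2) * (1 - v\<^sup>2) powr (-2) * Q ^ (card A + 2) =
          ((1 - s\<^sup>2) powr (-3/2) * (1 - s\<^sup>2) powr (n / 2)) * ((1 - v\<^sup>2) powr (-2) * (1 - v\<^sup>2) powr (n / 2))"
        unfolding Qn by (simp add: mult_ac)
      also have "\<dots> = (1 - s\<^sup>2) powr ((n - 3) / 2) * (1 - v\<^sup>2) powr ((n - 4) / 2)"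
        by (simp flip: powr_add add: diff_divide_distrib)
      finally have w: "(1 - s\<^sup>2) powr (-3/2) * (1 - v\<^sup>2) powr (-2) * Q ^ (card A + 2) =
        (1 - s\<^sup>2) powr ((n - 3) / 2) * (1 - v\<^sup>2) powr ((n - 4) / 2)" .
      have "(\<integral>\<^sup>+x. ennreal (S x) * indicator {..(1 - s\<^sup>2) * (1 - v\<^sup>2)} (S x) \<partial>M) =
        ennreal (unit_ball_vol (n - 2) * ((n - 2) / n) * Q ^ (card A + 2))"
        unfolding M_def S_def Q(2)
        by (subst nn_integral_sum_squares_ball[OF A(1) Q(1)]) (simp add: nn)
      moreover have "ennreal ((1 - s\<^sup>2) powr (-3/2) * (1 - v\<^sup>2) powr (-2)) *
          ennreal (unit_ball_vol (n - 2) * ((n - 2) / n) * Q ^ (card A + 2)) =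
        ennreal (unit_ball_vol (n - 2) * ((n - 2) / n)) *
          ennreal ((1 - s\<^sup>2) powr ((n - 3) / 2) * (1 - v\<^sup>2) powr ((n - 4) / 2))"
        unfolding w[symmetric] using Q(1) by (simp add: nn mult_ac flip: ennreal_mult' ennreal_mult)
      ultimately show ?thesis using True by (simp add: W_def mult_ac)
    qed (auto simp: W_def)
    finally show "(\<integral>\<^sup>+x. ennreal ((1 - s\<^sup>2) powr (-3/2) * (1 - v\<^sup>2) powr (-2)) *
       ?J s * ?J v * F s (v * sqrt (1 - s\<^sup>2)) *
       (ennreal (S x) * indicator {..(1 - s\<^sup>2) * (1 - v\<^sup>2)} (S x)) \<partial>M) =
      ennreal (unit_ball_vol (n - 2) * ((n - 2) / n)) *
      (ennreal ((1 - s\<^sup>2) powr ((n - 3) / 2) * (1 - v\<^sup>2) powr ((n - 4) / 2)) *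
       ?J s * ?J v * F s (v * sqrt (1 - s\<^sup>2)))"
      unfolding W_def .
  qed
  also have "\<dots> = ennreal (unit_ball_vol (n - 2) * ((n - 2) / n)) * (\<integral>\<^sup>+s. \<integral>\<^sup>+v.
      (ennreal ((1 - s\<^sup>2) powr ((n - 3) / 2) * (1 - v\<^sup>2) powr ((n - 4) / 2)) *
       ?J s * ?J v * F s (v * sqrt (1 - s\<^sup>2))) \<partial>lborel \<partial>lborel)"
    by (simp add: nn_integral_cmult)
  finally have *: "(\<integral>\<^sup>+y. F (sgn y $ i) (sgn y $ j) * indicator (cball 0 1) y \<partial>(lborel :: (real^'n) measure)) = \<dots>" .
  have "n \<ge> 3" using card by (simp add: n_def)
  \<comment> \<open>The ratio of the ball volumes in dimensions n - 2 and n is n / (2 pi); the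
    moment factor (n - 2) / n cancels the n.\<close>
  hence c: "unit_ball_vol (n - 2) * ((n - 2) / n) / unit_ball_vol n = (n - 2) / (2 * pi)"
  proof -
    have "n / 2 > 0" using \<open>n \<ge> 3\<close> by simp
    hence g1: "Gamma (n / 2 + 1) = n / 2 * Gamma (n / 2)" by (intro Gamma_plus1) (auto elim: nonpos_Ints_cases)
    have g2: "Gamma (n / 2) \<noteq> 0" using Gamma_real_pos[OF \<open>n / 2 > 0\<close>] by linarith
    have g3: "pi powr ((n - 2) / 2) = pi powr (n / 2) / pi" by (simp add: diff_divide_distrib powr_diff)
    have g4: "(n - 2) / 2 + 1 = n / 2" by (simp add: diff_divide_distrib)
    show ?thesis
      unfolding unit_ball_vol_def g4 g3 g1 using \<open>n \<ge> 3\<close> g2 by (simp add: divide_simps)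
  qed
  have "(\<integral>\<^sup>+z. F (z $ i) (z $ j) \<partial>(sphere_measure :: (real^'n) measure)) =
    ennreal (unit_ball_vol (n - 2) * ((n - 2) / n)) / ennreal (unit_ball_vol n) * (\<integral>\<^sup>+s. \<integral>\<^sup>+v.
      (ennreal ((1 - s\<^sup>2) powr ((n - 3) / 2) * (1 - v\<^sup>2) powr ((n - 4) / 2)) *
       ?J s * ?J v * F s (v * sqrt (1 - s\<^sup>2))) \<partial>lborel \<partial>lborel)"
    unfolding nn_integral_sphere_measure[OF Fm] * n_def[symmetric]
    by (simp add: divide_ennreal_def mult_ac)
  also have "ennreal (unit_ball_vol (n - 2) * ((n - 2) / n)) / ennreal (unit_ball_vol n) = ennreal ((n - 2) / (2 * pi))"
    unfolding c[symmetric] using \<open>n \<ge> 3\<close> by (intro divide_ennreal) auto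
  finally show ?thesis .
qed

section \<open>A hypergeometric integral\<close>

text \<open>The Beta integral under t = v^2 becomes twice the integral over (0, 1), and evenness of
  the integrand spreads it over (-1, 1).\<close>

lemma nn_integral_even_moment:
  fixes b :: real
  assumes b: "b > 0"
  shows "(\<integral>\<^sup>+v. ennreal (v ^ (2 * k) * (1 - v\<^sup>2) powr (b - 1)) * indicator {-1<..<1} v \<partial>lborel) =
    ennreal (Beta (real k + 1/2) b)"
proof -
  define a where "a = real k + 1/2"
  have a: "a > 0" by (simp add: a_def add_nonneg_pos)
  define h where "h = (\<lambda>v::real. v ^ (2 * k) * (1 - v\<^sup>2) powr (b - 1))"
  have [measurable]: "h \<in> borel_measurable borel" by (simp add: h_def)
  have heven: "h (- v) = h v" for v by (simp add: h_def)
  have h0: "h v \<ge> 0" for v by (simp add: h_def)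
  have "ennreal (Beta a b) = nn_integral lborel (\<lambda>t. ennreal (t powr (a - 1) * (1 - t) powr (b - 1) * indicator {0^2..1^2} t))"
    using nn_integral_has_integral_lebesgue[OF _ has_integral_Beta_real[OF a b]]
    by (simp add: mult_ac ennreal_mult' ennreal_indicator)
  also have "\<dots> = (\<integral>\<^sup>+ x. ennreal (x\<^sup>2 powr (a - 1) * (1 - x\<^sup>2) powr (b - 1) * (2 * x) * indicator {0..1} x) \<partial>lborel)"
    by (subst nn_integral_substitution[where g = "\<lambda>x. x ^ 2" and g' = "\<lambda>x. 2 * x"])
       (auto intro!: derivative_eq_intros continuous_intros simp: set_borel_measurable_def)
  also have "\<dots> = (\<integral>\<^sup>+ x. 2 * (ennreal (h x) * indicator {0<..<1} x) \<partial>lborel)"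
  proof (intro nn_integral_cong_AE AE_I[of _ _ "{0, 1}"] subsetI)
    fix x :: real
    assume x: "x \<in> {x \<in> space lborel. \<not> ennreal (x\<^sup>2 powr (a - 1) * (1 - x\<^sup>2) powr (b - 1) * (2 * x) * indicator {0..1} x) =
      2 * (ennreal (h x) * indicator {0<..<1} x)}"
    show "x \<in> {0, 1}"
    proof (rule ccontr)
      assume x01: "x \<notin> {0, 1}"
      have "x \<in> {0<..<1}"
      proof (rule ccontr)
        assume "x \<notin> {0<..<1}"
        with x01 have "x \<notin> {0..1}" "x \<notin> {0<..<1}" by auto
        with x show False by simp
      qed
      hence x0: "0 < x" "x < 1" by auto
      have "x\<^sup>2 powr (a - 1) * x = x powr (2 * (a - 1)) * x powr 1"
        using x0 by (simp flip: powr_numeral add: powr_powr)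
      also have "\<dots> = x powr (real (2 * k))"
        unfolding powr_add[symmetric] by (simp add: a_def algebra_simps)
      also have "\<dots> = x ^ (2 * k)" using x0(1) by (rule powr_realpow)
      finally have "x\<^sup>2 powr (a - 1) * (1 - x\<^sup>2) powr (b - 1) * (2 * x) = 2 * h x"
        by (simp add: h_def mult_ac)
      with x x0 show False by (simp add: ennreal_mult')
    qed
  qed (auto simp: emeasure_lborel_countable)
  also have "\<dots> = (\<integral>\<^sup>+ x. ennreal (h x) * indicator {0<..<1} x \<partial>lborel) + (\<integral>\<^sup>+ x. ennreal (h x) * indicator {0<..<1} x \<partial>lborel)"
    by (simp add: mult_2 nn_integral_add)
  also have "(\<integral>\<^sup>+ x. ennreal (h x) * indicator {0<..<1} x \<partial>lborel) = (\<integral>\<^sup>+ x. ennreal (h x) * indicator {-1<..<0} x \<partial>lborel)"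
    by (subst nn_integral_real_affine[of _ "-1" 0]) (auto simp: heven indicator_def intro!: nn_integral_cong)
  hence "(\<integral>\<^sup>+ x. ennreal (h x) * indicator {0<..<1} x \<partial>lborel) + (\<integral>\<^sup>+ x. ennreal (h x) * indicator {0<..<1} x \<partial>lborel)
    = (\<integral>\<^sup>+ x. ennreal (h x) * indicator {-1<..<0} x \<partial>lborel) + (\<integral>\<^sup>+ x. ennreal (h x) * indicator {0<..<1} x \<partial>lborel)"
    by simp
  also have "\<dots> = (\<integral>\<^sup>+ x. ennreal (h x) * (indicator {-1<..<0} x + indicator {0<..<1} x) \<partial>lborel)"
    by (subst nn_integral_add[symmetric]) (auto simp: algebra_simps)
  also have "\<dots> = (\<integral>\<^sup>+ x. ennreal (h x) * indicator {-1<..<1} x \<partial>lborel)"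
    by (intro nn_integral_cong_AE AE_I[of _ _ "{0}"]) (auto simp: indicator_def)
  finally show ?thesis by (simp add: h_def a_def)
qed

text \<open>Relative to the moment of order 0, the moments become Pochhammer quotients whose
  denominator is already that of the hypergeometric series.\<close>

lemma Beta_half_shift:
  fixes b :: real
  assumes b: "b > 0"
  shows "Beta (real k + 1/2) b = Beta (1/2) b * (pochhammer (1/2) k / pochhammer (b + 1/2) k)"
proof -
  have np: "x \<notin> \<int>\<^sub>\<le>\<^sub>0" if "x > 0" for x :: real using that by (auto elim: nonpos_Ints_cases)
  have "pochhammer (1/2) k = Gamma (1/2 + real k) / Gamma (1/2 :: real)"
    by (rule pochhammer_Gamma) (simp add: np)
  moreover have "pochhammer (b + 1/2) k = Gamma (b + 1/2 + real k) / Gamma (b + 1/2)"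
    using b by (intro pochhammer_Gamma np) simp
  moreover have "Gamma (1/2 :: real) \<noteq> 0" by (simp add: Gamma_one_half_real)
  moreover have "Gamma (b + 1/2) > 0" "Gamma (b + 1/2 + real k) > 0"
    using b by (auto intro!: Gamma_real_pos)
  ultimately show ?thesis by (simp add: Beta_def add.commute add.left_commute)
qed

text \<open>Termwise integration of (1 - z v)^(-m) = sum of (m)_k / k! (z v)^k. Odd moments vanish.
  In the even terms (m)_(2k) = 4^k (m/2)_k ((m+1)/2)_k and (2k)! = 4^k (1/2)_k k!, and the factor
  (1/2)_k cancels against the Beta moment. Nonnegativity of the hypergeometric value is read off
  from the integral.\<close>

lemma binomial_hypergeometric_integral:
  fixes b m z :: real
  assumes b: "b > 0" and z: "\<bar>z\<bar> < 1"
  shows "(\<integral>\<^sup>+v. ennreal ((1 - z * v) powr (- m) * (1 - v\<^sup>2) powr (b - 1)) * indicator {-1<..<1} v \<partial>lborel) =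
    ennreal (Beta (1/2) b * hyp2F1 (m / 2) ((m + 1) / 2) (b + 1/2) (z\<^sup>2))"
    and hyp2F1_nonneg: "hyp2F1 (m / 2) ((m + 1) / 2) (b + 1/2) (z\<^sup>2) \<ge> 0"
proof -
  define w where "w = (\<lambda>v::real. (1 - v\<^sup>2) powr (b - 1) * indicator {-1<..<1} v)"
  have [measurable]: "w \<in> borel_measurable borel" by (simp add: w_def)
  have w0: "w v \<ge> 0" for v by (simp add: w_def)
  have weven: "w (- v) = w v" for v by (auto simp: w_def indicator_def)
  have wout: "w v = 0" if "v \<notin> {-1<..<1}" for v using that by (simp add: w_def)
  have np: "x \<notin> \<int>\<^sub>\<le>\<^sub>0" if "x > 0" for x :: real using that by (auto elim: nonpos_Ints_cases)
  have Bpos: "Beta (real k + 1/2) b > 0" for k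
    using b by (simp add: Beta_def)
  have even: "has_bochner_integral lborel (\<lambda>v. v ^ (2 * k) * w v) (Beta (real k + 1/2) b)" for k
  proof (rule has_bochner_integral_nn_integral)
    have "(\<integral>\<^sup>+v. ennreal (v ^ (2 * k) * w v) \<partial>lborel) =
      (\<integral>\<^sup>+v. ennreal (v ^ (2 * k) * (1 - v\<^sup>2) powr (b - 1)) * indicator {-1<..<1} v \<partial>lborel)"
      by (intro nn_integral_cong) (auto simp: w_def indicator_def)
    thus "(\<integral>\<^sup>+v. ennreal (v ^ (2 * k) * w v) \<partial>lborel) = ennreal (Beta (real k + 1/2) b)"
      using nn_integral_even_moment[OF b] by simp
  qed (use w0 Bpos[of k] in \<open>auto intro: less_imp_le\<close>)
  have int_w: "integrable lborel w"
    using even[of 0] by (simp add: has_bochner_integral_iff)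
  have int: "integrable lborel (\<lambda>v. v ^ k * w v)" for k
  proof (rule Bochner_Integration.integrable_bound[OF int_w])
    show "AE v in lborel. norm (v ^ k * w v) \<le> norm (w v)"
    proof (rule AE_I2)
      fix v
      show "norm (v ^ k * w v) \<le> norm (w v)"
        using wout[of v] w0[of v]
        by (cases "v \<in> {-1<..<1}") (auto simp: abs_mult power_abs intro!: mult_left_le_one_le power_le_one)
    qed
  qed simp
  have odd: "(\<integral>v. v ^ k * w v \<partial>lborel) = 0" if "odd k" for k
  proof -
    have "(\<integral>v. v ^ k * w v \<partial>lborel) = (\<integral>v. (- v) ^ k * w (- v) \<partial>lborel)"
      by (subst lborel_integral_real_affine[of "-1" _ 0]) auto
    also have "\<dots> = - (\<integral>v. v ^ k * w v \<partial>lborel)"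
      using that by (simp add: weven)
    finally show ?thesis by simp
  qed
  define c where "c = (\<lambda>k. pochhammer m k / fact k)"
  have ser: "(\<lambda>k. c k * x ^ k) sums (1 - x) powr (- m)" if "\<bar>x\<bar> < 1" for x
  proof -
    have eq: "(- m gchoose k) * (- x) ^ k = c k * x ^ k" for k
    proof -
      have "(-1) ^ k * (-1) ^ k = (1::real)" by (simp flip: power_mult_distrib)
      thus ?thesis
        unfolding c_def gbinomial_pochhammer power_minus[of x k] by simp
    qed
    have "\<bar>- x\<bar> < 1" using that by simp
    from gen_binomial_real[OF this, of "- m"]
    have "(\<lambda>k. c k * x ^ k) sums (1 + - x) powr (- m)" unfolding eq .
    thus ?thesis by simp
  qed
  \<comment> \<open>The coefficients may change sign, so absolute convergence is derived from
    convergence at a point y with |x| < y < 1.\<close>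
  have abs_ser: "summable (\<lambda>k. \<bar>c k\<bar> * \<bar>x\<bar> ^ k)" if "\<bar>x\<bar> < 1" for x
  proof -
    from dense[OF that] obtain y where y: "\<bar>x\<bar> < y" "y < 1" by blast
    have "summable (\<lambda>k. c k * y ^ k)" using ser[of y] y by (auto simp: sums_iff)
    from powser_insidea[OF this, of x] y show ?thesis by (simp add: abs_mult power_abs)
  qed
  define f where "f = (\<lambda>k v. c k * z ^ k * (v ^ k * w v))"
  have fint: "integrable lborel (f k)" for k
    unfolding f_def by (intro integrable_mult_right int)
  have fsum: "(\<lambda>k. f k v) sums ((1 - z * v) powr (- m) * w v)" and fabs: "summable (\<lambda>k. norm (f k v))" for v
  proof -
    have 1: "f k v = c k * (z * v) ^ k * w v" for k
      by (simp add: f_def power_mult_distrib mult_ac)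
    have 2: "norm (f k v) = (\<bar>c k\<bar> * \<bar>z * v\<bar> ^ k) * w v" for k
      using w0[of v] by (simp add: 1 abs_mult power_abs)
    have zv: "\<bar>z * v\<bar> < 1" if "v \<in> {-1<..<1}"
    proof -
      have "\<bar>z * v\<bar> \<le> \<bar>z\<bar> * 1" unfolding abs_mult using that by (intro mult_left_mono) auto
      thus ?thesis using z by simp
    qed
    show "(\<lambda>k. f k v) sums ((1 - z * v) powr (- m) * w v)"
      unfolding 1 using ser[OF zv] wout[of v] by (cases "v \<in> {-1<..<1}") (auto intro: sums_mult2)
    show "summable (\<lambda>k. norm (f k v))"
      unfolding 2 using abs_ser[OF zv] wout[of v] by (cases "v \<in> {-1<..<1}") (auto intro: summable_mult2)
  qed
  \<comment> \<open>On the support of \<open>w\<close> the factor |v|^k is at most 1, so the norms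
    are dominated by the power series at |z| < 1. This justifies exchanging sum and
    integral.\<close>
  have fsumint: "summable (\<lambda>k. \<integral>v. norm (f k v) \<partial>lborel)"
  proof (rule summable_comparison_test')
    show "summable (\<lambda>k. \<bar>c k\<bar> * \<bar>z\<bar> ^ k * (\<integral>v. w v \<partial>lborel))"
      by (rule summable_mult2[OF abs_ser[OF z]])
    fix k :: nat
    have "(\<integral>v. norm (f k v) \<partial>lborel) \<le> (\<integral>v. \<bar>c k\<bar> * \<bar>z\<bar> ^ k * w v \<partial>lborel)"
    proof (rule integral_mono)
      show "integrable lborel (\<lambda>v. norm (f k v))" using fint by (rule integrable_norm)
      show "integrable lborel (\<lambda>v. \<bar>c k\<bar> * \<bar>z\<bar> ^ k * w v)" by (intro integrable_mult_right int_w)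
      fix v :: real
      have "\<bar>v ^ k * w v\<bar> \<le> w v"
        using wout[of v] w0[of v]
        by (cases "v \<in> {-1<..<1}") (auto simp: abs_mult power_abs intro!: mult_left_le_one_le power_le_one)
      thus "norm (f k v) \<le> \<bar>c k\<bar> * \<bar>z\<bar> ^ k * w v"
        by (simp add: f_def abs_mult[of "c k * z ^ k"]) (simp add: abs_mult power_abs mult_left_mono)
    qed
    thus "norm (\<integral>v. norm (f k v) \<partial>lborel) \<le> \<bar>c k\<bar> * \<bar>z\<bar> ^ k * (\<integral>v. w v \<partial>lborel)"
      by simp
  qed
  have S: "(\<Sum>k. f k v) = (1 - z * v) powr (- m) * w v" for v
    using fsum by (simp add: sums_iff)
  have I: "integrable lborel (\<lambda>v. (1 - z * v) powr (- m) * w v)"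
    using integrable_suminf[of lborel f, OF fint _ fsumint] fabs by (simp add: S)
  have "(\<lambda>k. \<integral>v. f k v \<partial>lborel) sums (\<integral>v. (1 - z * v) powr (- m) * w v \<partial>lborel)"
    using sums_integral[of lborel f, OF fint _ fsumint] fabs by (simp add: S)
  also have "(\<lambda>k. \<integral>v. f k v \<partial>lborel) = (\<lambda>k. c k * z ^ k * (\<integral>v. v ^ k * w v \<partial>lborel))"
    by (simp add: f_def)
  finally have all: "(\<lambda>k. c k * z ^ k * (\<integral>v. v ^ k * w v \<partial>lborel)) sums (\<integral>v. (1 - z * v) powr (- m) * w v \<partial>lborel)" .
  have zero: "c k * z ^ k * (\<integral>v. v ^ k * w v \<partial>lborel) = 0" if "k \<notin> range (\<lambda>k. 2 * k)" for k
  proof -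
    have "odd k" using that by (auto elim: evenE)
    thus ?thesis by (simp add: odd)
  qed
  have "(\<lambda>k. c (2 * k) * z ^ (2 * k) * (\<integral>v. v ^ (2 * k) * w v \<partial>lborel)) sums (\<integral>v. (1 - z * v) powr (- m) * w v \<partial>lborel)"
    using all by (subst sums_mono_reindex[of "\<lambda>k. 2 * k" "\<lambda>k. c k * z ^ k * (\<integral>v. v ^ k * w v \<partial>lborel)", OF _ zero])
      (auto simp: strict_mono_def)
  also have "(\<lambda>k. c (2 * k) * z ^ (2 * k) * (\<integral>v. v ^ (2 * k) * w v \<partial>lborel)) =
    (\<lambda>k. Beta (1/2) b * (pochhammer (m / 2) k * pochhammer ((m + 1) / 2) k / (pochhammer (b + 1/2) k * fact k) * (z\<^sup>2) ^ k))"
  proof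
    fix k
    have "pochhammer m (2 * k) = 4 ^ k * pochhammer (m / 2) k * pochhammer ((m + 1) / 2) k"
      using pochhammer_double[of "m / 2" k] by (simp add: power_mult add_divide_distrib)
    moreover have "(fact (2 * k) :: real) = 4 ^ k * pochhammer (1/2) k * fact k"
      using fact_double[of k, where 'a = real] by (simp add: power_mult)
    moreover have "pochhammer (1/2 :: real) k > 0" "pochhammer (b + 1/2) k > 0"
      using b by (auto intro!: pochhammer_pos)
    moreover have "(\<integral>v. v ^ (2 * k) * w v \<partial>lborel) = Beta (1/2) b * (pochhammer (1/2) k / pochhammer (b + 1/2) k)"
      using even[of k] Beta_half_shift[OF b, of k] by (simp add: has_bochner_integral_iff)
    ultimately show "c (2 * k) * z ^ (2 * k) * (\<integral>v. v ^ (2 * k) * w v \<partial>lborel) =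
      Beta (1/2) b * (pochhammer (m / 2) k * pochhammer ((m + 1) / 2) k / (pochhammer (b + 1/2) k * fact k) * (z\<^sup>2) ^ k)"
      by (simp add: c_def power_mult[symmetric] field_simps)
  qed
  finally have sums: "(\<lambda>k. Beta (1/2) b * (pochhammer (m / 2) k * pochhammer ((m + 1) / 2) k / (pochhammer (b + 1/2) k * fact k) * (z\<^sup>2) ^ k))
    sums (\<integral>v. (1 - z * v) powr (- m) * w v \<partial>lborel)" .
  have Bne: "Beta (1/2) b \<noteq> 0" using Bpos[of 0] by simp
  have summ: "summable (\<lambda>k. pochhammer (m / 2) k * pochhammer ((m + 1) / 2) k / (pochhammer (b + 1/2) k * fact k) * (z\<^sup>2) ^ k)"
    using sums_summable[OF sums] Bne by (simp only: summable_cmult_iff) simp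
  have val: "(\<integral>v. (1 - z * v) powr (- m) * w v \<partial>lborel) = Beta (1/2) b * hyp2F1 (m / 2) ((m + 1) / 2) (b + 1/2) (z\<^sup>2)"
    unfolding hyp2F1_def suminf_mult[OF summ, symmetric] by (rule sums_unique[OF sums])
  have "(\<integral>\<^sup>+v. ennreal ((1 - z * v) powr (- m) * (1 - v\<^sup>2) powr (b - 1)) * indicator {-1<..<1} v \<partial>lborel) =
    (\<integral>\<^sup>+v. ennreal ((1 - z * v) powr (- m) * w v) \<partial>lborel)"
    by (intro nn_integral_cong) (auto simp: w_def indicator_def)
  also have "\<dots> = ennreal (\<integral>v. (1 - z * v) powr (- m) * w v \<partial>lborel)"
    using w0 by (intro nn_integral_eq_integral I) auto
  finally show "(\<integral>\<^sup>+v. ennreal ((1 - z * v) powr (- m) * (1 - v\<^sup>2) powr (b - 1)) * indicator {-1<..<1} v \<partial>lborel) =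
    ennreal (Beta (1/2) b * hyp2F1 (m / 2) ((m + 1) / 2) (b + 1/2) (z\<^sup>2))" by (simp add: val)
  have "0 \<le> (\<integral>v. (1 - z * v) powr (- m) * w v \<partial>lborel)" using w0 by (intro integral_nonneg_AE) auto
  thus "hyp2F1 (m / 2) ((m + 1) / 2) (b + 1/2) (z\<^sup>2) \<ge> 0"
    using Bpos[of 0] unfolding val by (simp add: zero_le_mult_iff)
qed

text \<open>Extracting A reduces to z = B / A; the bound |B| < A places z inside the disc of
  convergence.\<close>

lemma hypergeometric_integral:
  fixes A B b m :: real
  assumes b: "b > 0" and AB: "\<bar>B\<bar> < A"
  shows "(\<integral>\<^sup>+v. ennreal ((A - B * v) powr (- m) * (1 - v\<^sup>2) powr (b - 1)) * indicator {-1<..<1} v \<partial>lborel) =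
    ennreal (A powr (- m) * (Beta (1/2) b * hyp2F1 (m / 2) ((m + 1) / 2) (b + 1/2) (B\<^sup>2 / A\<^sup>2)))"
proof -
  have A: "A > 0" using AB by linarith
  have z: "\<bar>B / A\<bar> < 1" using AB A by simp
  have "(\<integral>\<^sup>+v. ennreal ((A - B * v) powr (- m) * (1 - v\<^sup>2) powr (b - 1)) * indicator {-1<..<1} v \<partial>lborel) =
    (\<integral>\<^sup>+v. ennreal (A powr (- m)) * (ennreal ((1 - B / A * v) powr (- m) * (1 - v\<^sup>2) powr (b - 1)) * indicator {-1<..<1} v) \<partial>lborel)"
  proof (intro nn_integral_cong)
    fix v :: real
    show "ennreal ((A - B * v) powr (- m) * (1 - v\<^sup>2) powr (b - 1)) * indicator {-1<..<1} v =
      ennreal (A powr (- m)) * (ennreal ((1 - B / A * v) powr (- m) * (1 - v\<^sup>2) powr (b - 1)) * indicator {-1<..<1} v)"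
    proof (cases "v \<in> {-1<..<1}")
      case True
      have "\<bar>B / A * v\<bar> \<le> \<bar>B / A\<bar> * 1" unfolding abs_mult using True by (intro mult_left_mono) auto
      hence "1 - B / A * v \<ge> 0" using z by linarith
      moreover have "A - B * v = A * (1 - B / A * v)" using A by (simp add: field_simps)
      ultimately have "(A - B * v) powr (- m) = A powr (- m) * (1 - B / A * v) powr (- m)"
        using A by (simp only: powr_mult less_imp_le)
      thus ?thesis using True by (simp add: ennreal_mult' mult.assoc)
    qed simp
  qed
  also have "\<dots> = ennreal (A powr (- m)) * ennreal (Beta (1/2) b * hyp2F1 (m / 2) ((m + 1) / 2) (b + 1/2) ((B / A)\<^sup>2))"
    by (subst nn_integral_cmult) (simp_all only: binomial_hypergeometric_integral[OF b z], measurable)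
  finally show ?thesis by (simp add: ennreal_mult' power_divide)
qed

section \<open>Differentiation under the integral sign\<close>

text \<open>Links the gradient form, in which the kernels are differentiated, to
  \<open>partial_deriv\<close> and to the derivatives along axes in which the maximum principle is
  stated.\<close>

lemma has_derivative_gradient_axis:
  fixes f :: "real^'n::finite \<Rightarrow> real"
  assumes "(f has_derivative (\<lambda>h. \<Sum>k\<in>UNIV. c k * h $ k)) (at x)"
  shows partial_deriv_gradient: "partial_deriv i f x = c i"
    and DERIV_axis_gradient: "((\<lambda>t. f (x + t *\<^sub>R axis i 1)) has_real_derivative c i) (at 0)"
proof -
  have axis: "(\<Sum>k\<in>UNIV. c k * (t *\<^sub>R axis i 1) $ k) = t * c i" for t
    by (simp add: axis_def if_distrib[of "\<lambda>x. _ * x"] sum.delta cong: if_cong)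
  have "frechet_derivative f (at x) = (\<lambda>h. \<Sum>k\<in>UNIV. c k * h $ k)"
    using frechet_derivative_at[OF assms] by simp
  thus "partial_deriv i f x = c i"
    using axis[of 1] by (simp add: partial_deriv_def)
  have 1: "((\<lambda>t. x + t *\<^sub>R axis i 1) has_derivative (\<lambda>t. t *\<^sub>R axis i 1)) (at (0::real))"
    by (auto intro!: derivative_eq_intros)
  have "(f has_derivative (\<lambda>h. \<Sum>k\<in>UNIV. c k * h $ k)) (at (x + 0 *\<^sub>R axis i 1))"
    using assms by simp
  from diff_chain_at[OF 1 this] have "((\<lambda>t. f (x + t *\<^sub>R axis i 1)) has_derivative (\<lambda>t. t * c i)) (at 0)"
    by (simp only: o_def axis)
  thus "((\<lambda>t. f (x + t *\<^sub>R axis i 1)) has_real_derivative c i) (at 0)"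
    by (simp add: has_field_derivative_def mult_commute_abs)
qed

lemma abs_sum_coordinates_le:
  fixes h :: "real^'n::finite"
  assumes "\<And>k. \<bar>c k\<bar> \<le> B"
  shows "\<bar>\<Sum>k\<in>UNIV. c k * h $ k\<bar> \<le> real CARD('n) * B * norm h"
proof -
  have "\<bar>\<Sum>k\<in>UNIV. c k * h $ k\<bar> \<le> (\<Sum>k\<in>(UNIV :: 'n set). B * norm h)"
  proof (rule order_trans[OF sum_abs], rule sum_mono)
    fix k
    show "\<bar>c k * h $ k\<bar> \<le> B * norm h"
      unfolding abs_mult using order_trans[OF abs_ge_zero assms[of k]]
      by (intro mult_mono assms component_le_norm_cart) auto
  qed
  thus ?thesis by simp
qed

text \<open>Dominated convergence for the Frechet difference quotients along sequences tending to
  x0. The mean value inequality on the convex set S bounds the increments of K by a multiple of |x -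
  x0|, uniformly in z.\<close>

lemma has_derivative_integral_parameter:
  fixes K :: "real^'n::finite \<Rightarrow> 'a \<Rightarrow> real"
  assumes "finite_measure M" and S: "open S" "convex S" and x0: "x0 \<in> S"
    and deriv: "\<And>x z. x \<in> S \<Longrightarrow> z \<in> space M \<Longrightarrow> ((\<lambda>x. K x z) has_derivative (\<lambda>h. \<Sum>k\<in>UNIV. D k x z * h $ k)) (at x)"
    and KB: "\<And>x z. x \<in> S \<Longrightarrow> z \<in> space M \<Longrightarrow> \<bar>K x z\<bar> \<le> B"
    and DB: "\<And>k x z. x \<in> S \<Longrightarrow> z \<in> space M \<Longrightarrow> \<bar>D k x z\<bar> \<le> B"
    and Km: "\<And>x. x \<in> S \<Longrightarrow> K x \<in> borel_measurable M"
    and Dm: "\<And>k x. x \<in> S \<Longrightarrow> D k x \<in> borel_measurable M"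
    and gm: "g \<in> borel_measurable M" and gG: "\<And>z. z \<in> space M \<Longrightarrow> \<bar>g z\<bar> \<le> G"
  shows "((\<lambda>x. \<integral>z. K x z * g z \<partial>M) has_derivative (\<lambda>h. \<Sum>k\<in>UNIV. (\<integral>z. D k x0 z * g z \<partial>M) * h $ k)) (at x0)"
proof -
  interpret finite_measure M by fact
  have bnd: "integrable M (\<lambda>z. f z * g z)" if "f \<in> borel_measurable M" "\<And>z. z \<in> space M \<Longrightarrow> \<bar>f z\<bar> \<le> B" for f
  proof (rule integrable_const_bound[where B = "B * G"])
    show "AE z in M. norm (f z * g z) \<le> B * G"
      using that(2) gG by (intro AE_I2) (auto simp: abs_mult intro!: mult_mono order_trans[OF abs_ge_zero that(2)])
  qed (use that gm in measurable)
  have Kint: "integrable M (\<lambda>z. K x z * g z)" if "x \<in> S" for x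
    using that by (intro bnd Km KB)
  have Dint: "integrable M (\<lambda>z. D k x z * g z)" if "x \<in> S" for k x
    using that by (intro bnd Dm DB)
  define C where "C = real CARD('n) * B"
  have lip: "\<bar>K y z - K x z\<bar> \<le> C * norm (y - x)" if "x \<in> S" "y \<in> S" "z \<in> space M" for x y z
  proof -
    have "norm (K y z - K x z) \<le> C * norm (y - x)"
    proof (rule differentiable_bound[OF S(2) _ _ that(2,1)])
      fix w assume w: "w \<in> S"
      show "((\<lambda>x. K x z) has_derivative (\<lambda>h. \<Sum>k\<in>UNIV. D k w z * h $ k)) (at w within S)"
        using deriv[OF w that(3)] by (rule has_derivative_at_withinI)
      show "onorm (\<lambda>h. \<Sum>k\<in>UNIV. D k w z * h $ k) \<le> C"
        unfolding C_def by (rule onorm_le) (use abs_sum_coordinates_le[OF DB[OF w that(3)]] in simp)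
    qed
    thus ?thesis by simp
  qed
  show ?thesis
    unfolding has_derivative_iff_norm
  proof
    show "bounded_linear (\<lambda>h. \<Sum>k\<in>UNIV. (\<integral>z. D k x0 z * g z \<partial>M) * h $ k)"
      by (intro bounded_linear_sum bounded_linear_mult_right[THEN bounded_linear_compose] bounded_linear_vec_nth)
    let ?F = "\<lambda>x. \<integral>z. K x z * g z \<partial>M" and ?F' = "\<lambda>h. \<Sum>k\<in>UNIV. (\<integral>z. D k x0 z * g z \<partial>M) * h $ k"
    have "((\<lambda>y. norm (?F y - ?F x0 - ?F' (y - x0)) / norm (y - x0)) \<longlongrightarrow> 0) (at x0 within S)"
      unfolding tendsto_at_iff_sequentially
    proof (intro allI impI)
      fix X assume X: "\<forall>i. X i \<in> S - {x0}" "X \<longlonglongrightarrow> x0"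
      define q where "q = (\<lambda>m z. (K (X m) z - K x0 z - (\<Sum>k\<in>UNIV. D k x0 z * (X m - x0) $ k)) / norm (X m - x0) * g z)"
      have Xne: "norm (X m - x0) > 0" for m using X(1) by auto
      have XS: "X m \<in> S" for m using X(1) by auto
      have qint: "(\<integral>z. q m z \<partial>M) = (?F (X m) - ?F x0 - ?F' (X m - x0)) / norm (X m - x0)" for m
      proof -
        have "q m = (\<lambda>z. (K (X m) z * g z - K x0 z * g z - (\<Sum>k\<in>UNIV. D k x0 z * g z * (X m - x0) $ k)) / norm (X m - x0))"
          by (rule ext) (simp add: q_def left_diff_distrib right_diff_distrib diff_divide_distrib sum_distrib_right sum_distrib_left mult_ac)
        thus ?thesis
          using Kint[OF XS] Kint[OF x0] Dint[OF x0] by (simp add: Bochner_Integration.integral_diff Bochner_Integration.integral_sum)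
      qed
      have "(\<lambda>m. \<integral>z. q m z \<partial>M) \<longlonglongrightarrow> (\<integral>z. 0 \<partial>M)"
      proof (rule integral_dominated_convergence[where w = "\<lambda>_. 2 * C * G"])
        show "q m \<in> borel_measurable M" for m
          unfolding q_def using Km[OF XS] Km[OF x0] Dm[OF x0] gm by measurable
        show "AE z in M. (\<lambda>m. q m z) \<longlonglongrightarrow> 0"
        proof (rule AE_I2)
          fix z assume z: "z \<in> space M"
          have "((\<lambda>y. norm (K y z - K x0 z - (\<Sum>k\<in>UNIV. D k x0 z * (y - x0) $ k)) / norm (y - x0)) \<longlongrightarrow> 0) (at x0)"
            using deriv[OF x0 z] unfolding has_derivative_iff_norm by simp
          hence "((\<lambda>y. norm (K y z - K x0 z - (\<Sum>k\<in>UNIV. D k x0 z * (y - x0) $ k)) / norm (y - x0)) \<circ> X) \<longlonglongrightarrow> 0"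
            unfolding tendsto_at_iff_sequentially using X by auto
          hence "(\<lambda>m. norm ((K (X m) z - K x0 z - (\<Sum>k\<in>UNIV. D k x0 z * (X m - x0) $ k)) / norm (X m - x0))) \<longlonglongrightarrow> 0"
            by (simp add: o_def)
          hence "(\<lambda>m. (K (X m) z - K x0 z - (\<Sum>k\<in>UNIV. D k x0 z * (X m - x0) $ k)) / norm (X m - x0)) \<longlonglongrightarrow> 0"
            by (rule tendsto_norm_zero_cancel)
          from tendsto_mult_left_zero[OF this, of "g z"] show "(\<lambda>m. q m z) \<longlonglongrightarrow> 0"
            by (simp add: q_def)
        qed
        \<comment> \<open>One C bounds the increment of K, the other its linear part; G bounds the
          data.\<close>
        show "AE z in M. norm (q m z) \<le> 2 * C * G" for m
        proof (rule AE_I2)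
          fix z assume z: "z \<in> space M"
          have "\<bar>K (X m) z - K x0 z - (\<Sum>k\<in>UNIV. D k x0 z * (X m - x0) $ k)\<bar> \<le> 2 * C * norm (X m - x0)"
            using lip[OF x0 XS z, of m] abs_sum_coordinates_le[of "\<lambda>k. D k x0 z" B "X m - x0", OF DB[OF x0 z]] unfolding C_def by linarith
          hence q1: "\<bar>(K (X m) z - K x0 z - (\<Sum>k\<in>UNIV. D k x0 z * (X m - x0) $ k)) / norm (X m - x0)\<bar> \<le> 2 * C"
            using Xne[of m] by (simp add: abs_divide pos_divide_le_eq)
          show "norm (q m z) \<le> 2 * C * G"
            unfolding q_def real_norm_def abs_mult[of _ "g z"]
            by (intro mult_mono q1 gG[OF z] order_trans[OF abs_ge_zero q1] abs_ge_zero)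
        qed
      qed auto
      hence "(\<lambda>m. norm (\<integral>z. q m z \<partial>M)) \<longlonglongrightarrow> 0"
        by (intro tendsto_norm_zero) simp
      thus "((\<lambda>y. norm (?F y - ?F x0 - ?F' (y - x0)) / norm (y - x0)) \<circ> X) \<longlonglongrightarrow> 0"
        by (simp add: qint o_def)
    qed
    thus "((\<lambda>y. norm (?F y - ?F x0 - ?F' (y - x0)) / norm (y - x0)) \<longlongrightarrow> 0) (at x0)"
      using at_within_open[OF x0 S(1)] by simp
  qed
qed

lemma kernel_bounded:
  fixes f :: "real^'n::finite \<Rightarrow> real^'n \<Rightarrow> real"
  assumes "continuous_on (ball 0 1 \<times> sphere 0 1) (\<lambda>p. f (fst p) (snd p))" and "r < 1"
  obtains B where "\<And>x z. norm x \<le> r \<Longrightarrow> norm z = 1 \<Longrightarrow> \<bar>f x z\<bar> \<le> B"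
proof -
  have "compact ((\<lambda>p. f (fst p) (snd p)) ` (cball 0 r \<times> sphere 0 1))"
    using assms by (intro compact_continuous_image compact_Times compact_cball compact_sphere)
      (auto elim!: continuous_on_subset)
  hence "bounded ((\<lambda>p. f (fst p) (snd p)) ` (cball 0 r \<times> sphere 0 1))" by (rule compact_imp_bounded)
  then obtain B where "\<And>x. x \<in> (\<lambda>p. f (fst p) (snd p)) ` (cball 0 r \<times> sphere 0 1) \<Longrightarrow> norm x \<le> B"
    unfolding bounded_iff by blast
  hence "\<bar>f x z\<bar> \<le> B" if "norm x \<le> r" "norm z = 1" for x z
    using that by force
  thus thesis by (rule that)
qed

lemma kernel_measurable:
  fixes f :: "real^'n::finite \<Rightarrow> real^'n \<Rightarrow> real"
  assumes "continuous_on (ball 0 1 \<times> sphere 0 1) (\<lambda>p. f (fst p) (snd p))" and "norm x < 1"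
  shows "f x \<in> borel_measurable sphere_measure"
proof (rule measurable_sphere_measure_contI)
  have "continuous_on (sphere 0 1) ((\<lambda>p. f (fst p) (snd p)) \<circ> (\<lambda>z. (x, z)))"
    using assms by (intro continuous_on_compose continuous_intros) (auto elim!: continuous_on_subset)
  thus "continuous_on (sphere 0 1) (f x)" by (simp add: o_def)
qed

lemma has_derivative_sphere_integral:
  fixes K :: "real^'n::finite \<Rightarrow> real^'n \<Rightarrow> real"
  assumes Kc: "continuous_on (ball 0 1 \<times> sphere 0 1) (\<lambda>p. K (fst p) (snd p))"
    and Dc: "\<And>k. continuous_on (ball 0 1 \<times> sphere 0 1) (\<lambda>p. D k (fst p) (snd p))"
    and deriv: "\<And>x z. norm x < 1 \<Longrightarrow> norm z = 1 \<Longrightarrow> ((\<lambda>x. K x z) has_derivative (\<lambda>h. \<Sum>k\<in>UNIV. D k x z * h $ k)) (at x)"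
    and gm: "g \<in> borel_measurable sphere_measure" and gG: "\<And>z. norm z = 1 \<Longrightarrow> \<bar>g z\<bar> \<le> G"
    and x0: "norm x0 < 1"
  shows "((\<lambda>x. \<integral>z. K x z * g z \<partial>sphere_measure) has_derivative
    (\<lambda>h. \<Sum>k\<in>UNIV. (\<integral>z. D k x0 z * g z \<partial>sphere_measure) * h $ k)) (at x0)"
proof -
  \<comment> \<open>Kernels may be unbounded near the boundary of the ball, so uniform bounds are
    taken on a smaller ball that still contains x0.\<close>
  from dense[OF x0] obtain r where r: "norm x0 < r" "r < 1" by blast
  obtain B0 where B0: "\<And>x z. norm x \<le> r \<Longrightarrow> norm z = 1 \<Longrightarrow> \<bar>K x z\<bar> \<le> B0"
    using kernel_bounded[OF Kc r(2)] by blast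
  have "\<forall>k. \<exists>B. \<forall>x z. norm x \<le> r \<longrightarrow> norm z = 1 \<longrightarrow> \<bar>D k x z\<bar> \<le> B"
    using kernel_bounded[OF Dc r(2)] by metis
  then obtain B1 where B1: "\<And>k x z. norm x \<le> r \<Longrightarrow> norm z = 1 \<Longrightarrow> \<bar>D k x z\<bar> \<le> B1 k" by metis
  define B where "B = max B0 (Max (range B1))"
  have B1B: "B1 k \<le> B" for k unfolding B_def by (simp add: max.coboundedI2)
  interpret prob_space "sphere_measure :: (real^'n) measure" by (rule prob_space_sphere_measure)
  show ?thesis
  proof (rule has_derivative_integral_parameter[where S = "ball 0 r" and B = B and G = G])
    fix x z :: "real^'n" and k assume xz: "x \<in> ball 0 r" "z \<in> space sphere_measure"
    show "\<bar>K x z\<bar> \<le> B" using B0[of x z] xz by (simp add: B_def)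
    show "\<bar>D k x z\<bar> \<le> B" using order_trans[OF B1[of x z k] B1B] xz by simp
  qed (use r gm gG deriv in \<open>auto intro!: kernel_measurable[OF Kc] kernel_measurable[OF Dc] finite_measure_axioms\<close>)
qed

text \<open>Serves the second partial derivatives of Poisson integrals: their continuity is obtained
  without differentiating the kernel a third time.\<close>

lemma continuous_on_sphere_integral:
  fixes K :: "real^'n::finite \<Rightarrow> real^'n \<Rightarrow> real"
  assumes Kc: "continuous_on (ball 0 1 \<times> sphere 0 1) (\<lambda>p. K (fst p) (snd p))"
    and gm: "g \<in> borel_measurable sphere_measure" and gG: "\<And>z. norm z = 1 \<Longrightarrow> \<bar>g z\<bar> \<le> G"
  shows "continuous_on (ball 0 1) (\<lambda>x. \<integral>z. K x z * g z \<partial>sphere_measure)"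
proof -
  interpret prob_space "sphere_measure :: (real^'n) measure" by (rule prob_space_sphere_measure)
  have local: "continuous_on (ball 0 r) (\<lambda>x. \<integral>z. K x z * g z \<partial>sphere_measure)" if r: "r < 1" for r
  proof (rule continuous_on_sequentiallyI)
    fix X :: "nat \<Rightarrow> real^'n" and x assume X: "\<forall>m. X m \<in> ball 0 r" "x \<in> ball 0 r" "X \<longlonglongrightarrow> x"
    obtain B where B: "\<And>x z. norm x \<le> r \<Longrightarrow> norm z = 1 \<Longrightarrow> \<bar>K x z\<bar> \<le> B"
      using kernel_bounded[OF Kc r] by blast
    show "(\<lambda>m. \<integral>z. K (X m) z * g z \<partial>sphere_measure) \<longlonglongrightarrow> (\<integral>z. K x z * g z \<partial>sphere_measure)"
    proof (rule integral_dominated_convergence[where w = "\<lambda>_. B * G"])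
      have Km: "(\<lambda>z. K y z * g z) \<in> borel_measurable sphere_measure" if "y \<in> ball 0 r" for y
        using that r by (intro borel_measurable_times kernel_measurable[OF Kc] gm) auto
      show "(\<lambda>z. K x z * g z) \<in> borel_measurable sphere_measure" using X(2) by (rule Km)
      show "(\<lambda>z. K (X m) z * g z) \<in> borel_measurable sphere_measure" for m using X(1) by (blast intro: Km)
      show "AE z in sphere_measure. (\<lambda>m. K (X m) z * g z) \<longlonglongrightarrow> K x z * g z"
      proof (rule AE_I2)
        fix z :: "real^'n" assume z: "z \<in> space sphere_measure"
        have "(\<lambda>m. (\<lambda>p. K (fst p) (snd p)) (X m, z)) \<longlonglongrightarrow> (\<lambda>p. K (fst p) (snd p)) (x, z)"
          using X z r by (intro continuous_on_tendsto_compose[OF Kc] tendsto_Pair tendsto_const always_eventually) (auto intro: less_trans)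
        thus "(\<lambda>m. K (X m) z * g z) \<longlonglongrightarrow> K x z * g z" by (intro tendsto_mult tendsto_const) simp
      qed
      show "AE z in sphere_measure. norm (K (X m) z * g z) \<le> B * G" for m
      proof (rule AE_I2)
        fix z :: "real^'n" assume z: "z \<in> space sphere_measure"
        have "\<bar>K (X m) z\<bar> \<le> B" using X(1) z by (intro B) (auto simp: less_imp_le)
        thus "norm (K (X m) z * g z) \<le> B * G"
          unfolding real_norm_def abs_mult using gG[of z] z by (intro mult_mono) auto
      qed
    qed simp
  qed
  show ?thesis
    unfolding continuous_on_eq_continuous_at[OF open_ball]
  proof
    fix x :: "real^'n" assume "x \<in> ball 0 1"
    hence "norm x < 1" by simp
    from dense[OF this] obtain r where r: "norm x < r" "r < 1" by blast
    thus "continuous (at x) (\<lambda>x. \<integral>z. K x z * g z \<partial>sphere_measure)"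
      using local[OF r(2)] by (simp add: continuous_on_eq_continuous_at)
  qed
qed

section \<open>The Poisson kernel\<close>

text \<open>The base is the squared distance, a polynomial in x, so the value is |x - z|^(2 a) and
  exponents are half the customary ones.\<close>

definition dist_powr :: "real \<Rightarrow> real^'n::finite \<Rightarrow> real^'n \<Rightarrow> real" where
  "dist_powr a x z = ((x - z) \<bullet> (x - z)) powr a"

text \<open>The kernel (1 - |x|^2) / |x - z|^n, without an area constant, since the sphere carries a
  probability measure.\<close>

definition poisson_kernel :: "real^'n::finite \<Rightarrow> real^'n \<Rightarrow> real" where
  "poisson_kernel x z = (1 - x \<bullet> x) * dist_powr (- (real CARD('n) / 2)) x z"

definition poisson_d1 :: "'n::finite \<Rightarrow> real^'n \<Rightarrow> real^'n \<Rightarrow> real" where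
  "poisson_d1 k x z = - 2 * dist_powr (- (real CARD('n) / 2)) x z * x $ k
     - real CARD('n) * (1 - x \<bullet> x) * dist_powr (- (real CARD('n) / 2) - 1) x z * (x - z) $ k"

text \<open>The k-th partial derivative of \<open>poisson_d1 i\<close>, arranged as a Kronecker term
  plus multiples of x_k and (x - z)_k: the pattern that \<open>sum_gradient\<close> turns into inner
  products.\<close>

definition poisson_d2 :: "'n::finite \<Rightarrow> 'n \<Rightarrow> real^'n \<Rightarrow> real^'n \<Rightarrow> real" where
  "poisson_d2 i k x z =
     (if i = k then - 2 * dist_powr (- (real CARD('n) / 2)) x z
        - real CARD('n) * (1 - x \<bullet> x) * dist_powr (- (real CARD('n) / 2) - 1) x z else 0)
     + (2 * real CARD('n) * (x - z) $ i * dist_powr (- (real CARD('n) / 2) - 1) x z * x $ k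
     + (2 * real CARD('n) * x $ i * dist_powr (- (real CARD('n) / 2) - 1) x z
        + real CARD('n) * (real CARD('n) + 2) * (1 - x \<bullet> x) * (x - z) $ i * dist_powr (- (real CARD('n) / 2) - 2) x z) * (x - z) $ k)"

lemma ball_sphere_neq:
  fixes x z :: "real^'n::finite"
  assumes "norm x < 1" "norm z = 1"
  shows "x \<noteq> z" "(x - z) \<bullet> (x - z) > 0"
  using assms by auto

lemma continuous_on_dist_powr [continuous_intros]:
  "continuous_on (ball 0 1 \<times> sphere 0 1) (\<lambda>p. dist_powr a (fst p) (snd p :: real^'n::finite))"
  unfolding dist_powr_def by (intro continuous_intros) auto

lemma continuous_on_poisson_kernel:
  "continuous_on (ball 0 1 \<times> sphere 0 1) (\<lambda>p. poisson_kernel (fst p) (snd p :: real^'n::finite))"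
  unfolding poisson_kernel_def by (intro continuous_intros)

lemma continuous_on_poisson_d1:
  "continuous_on (ball 0 1 \<times> sphere 0 1) (\<lambda>p. poisson_d1 k (fst p) (snd p))"
  unfolding poisson_d1_def by (intro continuous_intros)

lemma continuous_on_poisson_d2:
  "continuous_on (ball 0 1 \<times> sphere 0 1) (\<lambda>p. poisson_d2 i k (fst p) (snd p))"
  unfolding poisson_d2_def by (cases "i = k") (auto intro!: continuous_intros)

lemma has_derivative_dist_powr:
  fixes x z :: "real^'n::finite"
  assumes "x \<noteq> z"
  shows "((\<lambda>x. dist_powr a x z) has_derivative (\<lambda>h. 2 * a * dist_powr (a - 1) x z * ((x - z) \<bullet> h))) (at x)"
proof -
  have p: "(x - z) \<bullet> (x - z) > 0" using assms by simp
  have "((\<lambda>x. (x - z) \<bullet> (x - z)) has_derivative (\<lambda>h. 2 * ((x - z) \<bullet> h))) (at x)"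
    by (auto intro!: derivative_eq_intros simp: inner_commute)
  from DERIV_compose_FDERIV[OF has_real_derivative_powr[OF p, of a] this]
  show ?thesis unfolding dist_powr_def by (simp add: mult_ac)
qed

lemma sum_gradient:
  fixes x y h :: "real^'n::finite"
  shows "(\<Sum>k\<in>UNIV. (a * x $ k + b * y $ k) * h $ k) = a * (x \<bullet> h) + b * (y \<bullet> h)"
    and "(\<Sum>k\<in>UNIV. ((if i = k then c else 0) + (a * x $ k + b * y $ k)) * h $ k) = c * h $ i + (a * (x \<bullet> h) + b * (y \<bullet> h))"
proof -
  show *: "(\<Sum>k\<in>UNIV. (a * x $ k + b * y $ k) * h $ k) = a * (x \<bullet> h) + b * (y \<bullet> h)"
    unfolding inner_vec_def inner_real_def sum_distrib_left sum.distrib[symmetric]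
    by (intro sum.cong refl) (simp add: algebra_simps)
  have "(\<Sum>k\<in>UNIV. ((if i = k then c else 0) + (a * x $ k + b * y $ k)) * h $ k) =
    (\<Sum>k\<in>UNIV. (if i = k then c else 0) * h $ k) + (\<Sum>k\<in>UNIV. (a * x $ k + b * y $ k) * h $ k)"
    by (simp only: distrib_right sum.distrib)
  also have "(\<Sum>k\<in>UNIV. (if i = k then c else 0) * h $ k) = c * h $ i"
    by (simp add: if_distrib[of "\<lambda>x. x * _"] sum.delta cong: if_cong)
  finally show "(\<Sum>k\<in>UNIV. ((if i = k then c else 0) + (a * x $ k + b * y $ k)) * h $ k) = c * h $ i + (a * (x \<bullet> h) + b * (y \<bullet> h))"
    by (simp only: *)
qed

lemma has_derivative_poisson_kernel:
  fixes x z :: "real^'n::finite"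
  assumes "x \<noteq> z"
  shows "((\<lambda>x. poisson_kernel x z) has_derivative (\<lambda>h. \<Sum>k\<in>UNIV. poisson_d1 k x z * h $ k)) (at x)"
proof -
  note [derivative_intros] = has_derivative_dist_powr[OF assms]
  have eq: "(\<Sum>k\<in>UNIV. poisson_d1 k x z * h $ k) =
    - 2 * dist_powr (- (real CARD('n) / 2)) x z * (x \<bullet> h)
    + (- real CARD('n) * (1 - x \<bullet> x) * dist_powr (- (real CARD('n) / 2) - 1) x z) * ((x - z) \<bullet> h)" for h
    unfolding sum_gradient(1)[symmetric] poisson_d1_def by simp
  show ?thesis
    unfolding eq unfolding poisson_kernel_def
    by (rule derivative_eq_intros refl)+ (rule ext, simp add: inner_commute algebra_simps)
qed

lemma has_derivative_poisson_d1:
  fixes x z :: "real^'n::finite"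
  assumes "x \<noteq> z"
  shows "((\<lambda>x. poisson_d1 i x z) has_derivative (\<lambda>h. \<Sum>k\<in>UNIV. poisson_d2 i k x z * h $ k)) (at x)"
proof -
  note [derivative_intros] = has_derivative_dist_powr[OF assms]
    bounded_linear_imp_has_derivative[OF bounded_linear_vec_nth]
  have exp: "- (real CARD('n) / 2) - 1 - 1 = - (real CARD('n) / 2) - 2" by simp
  show ?thesis
    unfolding poisson_d2_def sum_gradient(2) unfolding poisson_d1_def vector_minus_component
    by (rule derivative_eq_intros refl)+ (rule ext, simp add: exp inner_commute, simp add: algebra_simps)
qed

text \<open>With q = |x - z|^2 all terms are multiples of Q = q^(-n/2 - 1), and the sum is n Q (-2 q
  + 4 <x, x - z> + 2 (1 - |x|^2)). For |z| = 1 the bracket vanishes, because q = |x|^2 - 2 <x, z> +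
  1.\<close>

lemma laplacian_poisson_kernel:
  fixes x z :: "real^'n::finite"
  assumes "x \<noteq> z" "norm z = 1"
  shows "(\<Sum>i\<in>UNIV. poisson_d2 i i x z) = 0"
proof -
  define n where "n = real CARD('n)"
  define q where "q = (x - z) \<bullet> (x - z)"
  have q: "q > 0" using assms by (simp add: q_def)
  define Q where "Q = dist_powr (- (n / 2) - 1) x z"
  have Q0: "dist_powr (- (n / 2)) x z = q * Q"
    using q powr_add[of q 1 "- (n / 2) - 1"] by (simp add: Q_def dist_powr_def q_def)
  have Q2: "q * dist_powr (- (n / 2) - 2) x z = Q"
  proof -
    have "1 + (- (n / 2) - 2) = - (n / 2) - 1" by simp
    with powr_add[of q 1 "- (n / 2) - 2"] have "q powr (- (n / 2) - 1) = q * q powr (- (n / 2) - 2)"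
      using q by simp
    thus ?thesis by (simp add: Q_def dist_powr_def q_def)
  qed
  have zz: "z \<bullet> z = 1" using assms(2) by (simp add: norm_eq_1)
  have "(\<Sum>i\<in>UNIV. poisson_d2 i i x z) =
    (\<Sum>i\<in>(UNIV :: 'n set). (- 2 * (q * Q) - n * (1 - x \<bullet> x) * Q)
      + 4 * n * Q * (x $ i * (x - z) $ i) + n * (n + 2) * (1 - x \<bullet> x) * dist_powr (- (n / 2) - 2) x z * ((x - z) $ i * (x - z) $ i))"
    unfolding poisson_d2_def n_def[symmetric] Q0 Q_def[symmetric]
    by (intro sum.cong refl) (simp add: algebra_simps)
  also have "\<dots> = n * (- 2 * (q * Q) - n * (1 - x \<bullet> x) * Q) + 4 * n * Q * (x \<bullet> (x - z))
      + n * (n + 2) * (1 - x \<bullet> x) * dist_powr (- (n / 2) - 2) x z * q"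
    by (simp only: sum.distrib sum_distrib_left[symmetric] q_def inner_vec_def inner_real_def) (simp add: n_def)
  also have "\<dots> = n * (- 2 * (q * Q) - n * (1 - x \<bullet> x) * Q) + 4 * n * Q * (x \<bullet> (x - z))
      + n * (n + 2) * (1 - x \<bullet> x) * (q * dist_powr (- (n / 2) - 2) x z)"
    by (simp add: mult_ac)
  also have "\<dots> = n * Q * (- 2 * q + 4 * (x \<bullet> (x - z)) + 2 * (1 - x \<bullet> x))"
    unfolding Q2 by (simp add: algebra_simps)
  also have "- 2 * q + 4 * (x \<bullet> (x - z)) + 2 * (1 - x \<bullet> x) = 0"
    using zz by (simp add: q_def inner_diff_left inner_diff_right inner_commute)
  finally show ?thesis by simp
qed

lemma poisson_kernel_nonneg: "norm x \<le> 1 \<Longrightarrow> poisson_kernel x z \<ge> 0"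
  using power_le_one[of "norm x" 2]
  by (auto simp: poisson_kernel_def dist_powr_def power2_norm_eq_inner)

lemma poisson_kernel_borel_measurable [measurable]: "poisson_kernel x \<in> borel_measurable borel"
  unfolding poisson_kernel_def[abs_def] dist_powr_def by measurable

section \<open>The Poisson integral\<close>

text \<open>Boundedness and measurability admit the sign function as data; continuity is added only
  where boundary limits are taken.\<close>

locale bounded_boundary_data =
  fixes g :: "real^'n::finite \<Rightarrow> real" and G :: real
  assumes g_measurable: "g \<in> borel_measurable sphere_measure"
    and g_bounded: "\<And>z. norm z = 1 \<Longrightarrow> \<bar>g z\<bar> \<le> G"
begin

definition "u x = (\<integral>z. poisson_kernel x z * g z \<partial>sphere_measure)"
definition "u1 i x = (\<integral>z. poisson_d1 i x z * g z \<partial>sphere_measure)"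
definition "u2 i j x = (\<integral>z. poisson_d2 i j x z * g z \<partial>sphere_measure)"

lemma integrable_kernel:
  fixes f :: "real^'n \<Rightarrow> real^'n \<Rightarrow> real"
  assumes "continuous_on (ball 0 1 \<times> sphere 0 1) (\<lambda>p. f (fst p) (snd p :: real^'n))" "norm x < 1"
  shows "integrable sphere_measure (\<lambda>z. f x z * g z)"
proof -
  interpret prob_space "sphere_measure :: (real^'n) measure" by (rule prob_space_sphere_measure)
  obtain B where B': "\<And>y z. norm y \<le> norm x \<Longrightarrow> norm z = 1 \<Longrightarrow> \<bar>f y z\<bar> \<le> B"
    using kernel_bounded[OF assms] by blast
  hence B: "\<bar>f x z\<bar> \<le> B" if "norm z = 1" for z using that by simp
  show ?thesis
  proof (rule integrable_const_bound[where B = "B * G"])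
    show "AE z in sphere_measure. norm (f x z * g z) \<le> B * G"
    proof (rule AE_I2)
      fix z :: "real^'n" assume "z \<in> space sphere_measure"
      hence z: "norm z = 1" by simp
      show "norm (f x z * g z) \<le> B * G"
        unfolding real_norm_def abs_mult
        by (intro mult_mono B[OF z] g_bounded[OF z] order_trans[OF abs_ge_zero B[OF z]] abs_ge_zero)
    qed
    show "(\<lambda>z. f x z * g z) \<in> borel_measurable sphere_measure"
      by (intro borel_measurable_times kernel_measurable[OF assms] g_measurable)
  qed
qed

lemma has_derivative_u:
  "norm x < 1 \<Longrightarrow> (u has_derivative (\<lambda>h. \<Sum>k\<in>UNIV. u1 k x * h $ k)) (at x)"
  unfolding u_def[abs_def] u1_def
  by (rule has_derivative_sphere_integral[OF continuous_on_poisson_kernel continuous_on_poisson_d1 _ g_measurable g_bounded])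
    (auto intro!: has_derivative_poisson_kernel)

lemma has_derivative_u1:
  "norm x < 1 \<Longrightarrow> (u1 i has_derivative (\<lambda>h. \<Sum>k\<in>UNIV. u2 i k x * h $ k)) (at x)"
  unfolding u1_def[abs_def] u2_def
  by (rule has_derivative_sphere_integral[OF continuous_on_poisson_d1 continuous_on_poisson_d2 _ g_measurable g_bounded])
    (auto intro!: has_derivative_poisson_d1)

lemma laplacian_u: "norm x < 1 \<Longrightarrow> (\<Sum>i\<in>UNIV. u2 i i x) = 0"
proof -
  assume x: "norm x < 1"
  have "(\<Sum>i\<in>UNIV. u2 i i x) = (\<integral>z. (\<Sum>i\<in>UNIV. poisson_d2 i i x z * g z) \<partial>sphere_measure)"
    unfolding u2_def by (rule Bochner_Integration.integral_sum[symmetric]) (rule integrable_kernel[OF continuous_on_poisson_d2 x])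
  also have "\<dots> = (\<integral>z. 0 \<partial>(sphere_measure :: (real^'n) measure))"
    using x by (intro Bochner_Integration.integral_cong refl)
      (auto simp: sum_distrib_right[symmetric] intro!: laplacian_poisson_kernel)
  finally show ?thesis by simp
qed

lemma partial_deriv_u: "norm x < 1 \<Longrightarrow> partial_deriv i u x = u1 i x"
  by (rule partial_deriv_gradient[OF has_derivative_u])

lemma has_derivative_partial_deriv_u:
  assumes x: "norm x < 1"
  shows "(partial_deriv i u has_derivative (\<lambda>h. \<Sum>k\<in>UNIV. u2 i k x * h $ k)) (at x)"
  by (rule has_derivative_transform_within_open[OF has_derivative_u1[OF x] open_ball[of 0 1]])
    (use x in \<open>auto simp: partial_deriv_u\<close>)

lemma partial_deriv_partial_deriv_u:
  "norm x < 1 \<Longrightarrow> partial_deriv j (partial_deriv i u) x = u2 i j x"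
  by (rule partial_deriv_gradient[OF has_derivative_partial_deriv_u])

theorem harmonic_on_u: "harmonic_on (ball 0 1) u"
  unfolding harmonic_on_def
proof (intro conjI ballI allI)
  fix x :: "real^'n" assume "x \<in> ball 0 1"
  hence x: "norm x < 1" by simp
  show "u differentiable at x" using has_derivative_u[OF x] by (auto simp: differentiable_def)
  show "partial_deriv i u differentiable at x" for i
    using has_derivative_partial_deriv_u[OF x] by (auto simp: differentiable_def)
  show "(\<Sum>i\<in>UNIV. partial_deriv i (partial_deriv i u) x) = 0"
    using laplacian_u[OF x] by (simp add: partial_deriv_partial_deriv_u[OF x])
next
  fix i
  show "continuous_on (ball 0 1) (partial_deriv i u)"
    by (rule has_derivative_continuous_on[where f' = "\<lambda>x h. \<Sum>k\<in>UNIV. u2 i k x * h $ k"])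
      (auto intro!: has_derivative_at_withinI has_derivative_partial_deriv_u)
next
  fix i j
  have "continuous_on (ball 0 1) (u2 i j)"
    unfolding u2_def[abs_def]
    by (rule continuous_on_sphere_integral[where K = "poisson_d2 i j", OF continuous_on_poisson_d2 g_measurable g_bounded])
  thus "continuous_on (ball 0 1) (partial_deriv j (partial_deriv i u))"
    by (rule continuous_on_eq) (auto simp: partial_deriv_partial_deriv_u)
qed

end

section \<open>Total mass of the Poisson kernel\<close>

text \<open>The kernel satisfies P(T x, T z) = P(x, z). It is nonnegative, so the invariance of
  nonnegative integrals over the sphere applies.\<close>

lemma integral_poisson_kernel_orthogonal:
  fixes T :: "real^'n::finite \<Rightarrow> real^'n"
  assumes T: "orthogonal_transformation T" and x: "norm x \<le> 1"
  shows "(\<integral>z. poisson_kernel (T x) z \<partial>sphere_measure) = (\<integral>z. poisson_kernel x z \<partial>sphere_measure)"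
proof -
  have eq: "poisson_kernel (T x) (T z) = poisson_kernel x z" for z
  proof -
    have "T x - T z = T (x - z)" using T by (simp add: linear_diff orthogonal_transformation_linear)
    moreover have "T a \<bullet> T a = a \<bullet> a" for a using T by (simp add: orthogonal_transformation_def)
    ultimately show ?thesis by (simp add: poisson_kernel_def dist_powr_def)
  qed
  have Tx: "norm (T x) \<le> 1" using x orthogonal_transformation_norm[OF T] by simp
  have [measurable]: "poisson_kernel y \<in> borel_measurable sphere_measure" for y :: "real^'n"
    by (rule measurable_sphere_measureI) simp
  have val: "(\<integral>z. poisson_kernel y z \<partial>sphere_measure) = enn2real (\<integral>\<^sup>+z. ennreal (poisson_kernel y z) \<partial>sphere_measure)"
    if "norm y \<le> 1" for y :: "real^'n"
    using that by (intro integral_eq_nn_integral) (auto simp: poisson_kernel_nonneg)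
  have "(\<integral>\<^sup>+z. ennreal (poisson_kernel (T x) z) \<partial>sphere_measure) = (\<integral>\<^sup>+z. ennreal (poisson_kernel (T x) (T z)) \<partial>sphere_measure)"
    by (rule nn_integral_sphere_measure_orthogonal[OF _ T, symmetric]) simp
  also have "\<dots> = (\<integral>\<^sup>+z. ennreal (poisson_kernel x z) \<partial>sphere_measure)" by (simp add: eq)
  finally show ?thesis by (simp add: val x Tx)
qed

text \<open>The integral is a harmonic function of \<^term>\<open>x\<close> that depends only on \<^term>\<open>norm x\<close>,
  hence constant by the maximum principle.\<close>

lemma integral_poisson_kernel:
  fixes x :: "real^'n::finite"
  assumes x: "norm x < 1"
  shows "(\<integral>z. poisson_kernel x z \<partial>sphere_measure) = 1"
proof -
  interpret bounded_boundary_data "\<lambda>_::real^'n. 1" 1 by standard auto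
  interpret prob_space "sphere_measure :: (real^'n) measure" by (rule prob_space_sphere_measure)
  have radial: "u y = u y'" if eq: "norm y = norm y'" and le: "norm y \<le> 1" for y y'
  proof -
    obtain T where T: "orthogonal_transformation T" "T y = y'"
      using orthogonal_transformation_exists[OF eq] by blast
    show ?thesis using integral_poisson_kernel_orthogonal[OF T(1) le] T(2) by (simp add: u_def)
  qed
  have "u 0 = (\<integral>z. 1 \<partial>(sphere_measure :: (real^'n) measure))"
    unfolding u_def by (intro Bochner_Integration.integral_cong refl)
      (auto simp: poisson_kernel_def dist_powr_def norm_eq_1)
  hence u0: "u 0 = 1" using prob_space by simp
  have "u x = 1"
  proof (cases "x = 0")
    case False
    define r where "r = norm x"
    have r: "0 < r" "r < 1" using False x by (auto simp: r_def)
    have cont: "continuous_on (cball 0 r) u"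
      using r by (intro has_derivative_continuous_on[where f' = "\<lambda>x h. \<Sum>k\<in>UNIV. u1 k x * h $ k"])
        (auto intro!: has_derivative_at_withinI has_derivative_u)
    \<comment> \<open>On the sphere of radius |x| the function \<open>u\<close> has the constant
      value \<open>u x\<close>, so s = 1 and s = -1 both meet the boundary condition; together they
      give \<open>u 0 = u x\<close>.\<close>
    have le: "s * (u 0 - u x) \<le> 0" for s
    proof (rule maximum_principle[OF r(1), where w = "\<lambda>y. s * (u y - u x)" and w' = "\<lambda>i y. s * u1 i y" and w'' = "\<lambda>i y. s * u2 i i y"])
      show "continuous_on (cball 0 r) (\<lambda>y. s * (u y - u x))" by (intro continuous_intros cont)
      show "s * (u z - u x) \<le> 0" if "norm z = r" for z
        using radial[of z x] that r by (simp add: r_def)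
      fix y :: "real^'n" and i assume y: "norm y < r"
      hence y1: "norm y < 1" using r by simp
      show "((\<lambda>t. s * (u (y + t *\<^sub>R axis i 1) - u x)) has_real_derivative s * u1 i y) (at 0)"
        by (auto intro!: derivative_eq_intros DERIV_axis_gradient[OF has_derivative_u[OF y1]])
      show "((\<lambda>t. s * u1 i (y + t *\<^sub>R axis i 1)) has_real_derivative s * u2 i i y) (at 0)"
        by (auto intro!: derivative_eq_intros DERIV_axis_gradient[OF has_derivative_u1[OF y1]])
      show "(\<Sum>i\<in>UNIV. s * u2 i i y) = 0" using laplacian_u[OF y1] by (simp flip: sum_distrib_left)
    qed (use r in auto)
    from le[of 1] le[of "- 1"] show ?thesis using u0 by simp
  qed (use u0 in simp)
  thus ?thesis by (simp add: u_def)
qed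

section \<open>The Poisson representation of a harmonic function\<close>

context bounded_boundary_data
begin

section \<open>Boundary behaviour and the Dirichlet problem\<close>

lemma integrable_poisson_kernel:
  assumes "norm x < 1"
  shows "integrable sphere_measure (poisson_kernel (x :: real^'n))"
  \<comment> \<open>The Bochner integral of a non-integrable function is 0 by convention, so the
    value 1 forces integrability.\<close>
  using integral_poisson_kernel[OF assms] not_integrable_integral_eq by fastforce

lemma abs_u_le:
  assumes x: "norm x < 1"
  shows "\<bar>u x\<bar> \<le> G"
proof -
  have "\<bar>u x\<bar> \<le> (\<integral>z. \<bar>poisson_kernel x z * g z\<bar> \<partial>sphere_measure)"
    unfolding u_def by (rule integral_abs_bound)
  also have "\<dots> \<le> (\<integral>z. poisson_kernel x z * G \<partial>sphere_measure)"
  proof (rule integral_mono)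
    show "integrable sphere_measure (\<lambda>z. \<bar>poisson_kernel x z * g z\<bar>)"
      using integrable_kernel[OF continuous_on_poisson_kernel x] by (rule integrable_abs)
    show "integrable sphere_measure (\<lambda>z. poisson_kernel x z * G)"
      by (intro integrable_mult_left integrable_poisson_kernel x)
    show "\<bar>poisson_kernel x z * g z\<bar> \<le> poisson_kernel x z * G" if "z \<in> space sphere_measure" for z
      using that x by (auto simp: abs_mult poisson_kernel_nonneg intro!: mult_left_mono g_bounded)
  qed
  also have "\<dots> = G" using integral_poisson_kernel[OF x] by simp
  finally show ?thesis .
qed

text \<open>The kernel is an approximate identity. Near z0 the oscillation of g is below e/4 and the
  kernel has mass 1; away from z0 the estimate 1 - |x|^2 \<le> 2 |x - z0| makes the kernel uniformly
  small.\<close>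

lemma boundary_limit:
  assumes g: "continuous_on (sphere 0 1) g" and z0: "norm z0 = 1" and e: "e > 0"
  obtains d where "d > 0" "\<And>x. norm x < 1 \<Longrightarrow> norm (x - z0) < d \<Longrightarrow> \<bar>u x - g z0\<bar> < e"
proof -
  have G: "G \<ge> 0" using g_bounded[OF z0] by linarith
  obtain \<delta> where \<delta>: "\<delta> > 0" "\<And>z. norm z = 1 \<Longrightarrow> dist z z0 < \<delta> \<Longrightarrow> \<bar>g z - g z0\<bar> < e / 4"
  proof -
    from continuous_on_iff[THEN iffD1, rule_format, OF g, of z0 "e / 4"] z0 e
    obtain \<delta> where "\<delta> > 0" "\<And>z. z \<in> sphere 0 1 \<Longrightarrow> dist z z0 < \<delta> \<Longrightarrow> dist (g z) (g z0) < e / 4"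
      by auto
    thus thesis by (intro that[of \<delta>]) (auto simp: dist_real_def)
  qed
  \<comment> \<open>An upper bound of |x - z|^(-n) at distance at least \<delta>/2.\<close>
  define c where "c = ((\<delta> / 2)\<^sup>2) powr (- (real CARD('n) / 2))"
  have c: "c \<ge> 0" by (simp add: c_def)
  \<comment> \<open>Far points contribute at most 4 G c |x - z0|, which has to stay below e/2. The
    summand 1 keeps the denominator positive when G c = 0.\<close>
  define d where "d = min (\<delta> / 2) (e / (2 * (4 * G * c + 1)))"
  have pos: "4 * G * c + 1 > 0" using G c by (simp add: add_nonneg_pos)
  show thesis
  proof
    show "d > 0" using \<delta> e pos by (simp add: d_def)
    fix x :: "real^'n" assume x: "norm x < 1" and xz: "norm (x - z0) < d"
    have P: "integrable sphere_measure (poisson_kernel x)" by (rule integrable_poisson_kernel[OF x])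
    have I: "integrable sphere_measure (\<lambda>z. poisson_kernel x z * g z)"
      by (rule integrable_kernel[OF continuous_on_poisson_kernel x])
    define b where "b = 4 * G * c * norm (x - z0)"
    have "u x - g z0 = (\<integral>z. poisson_kernel x z * g z - poisson_kernel x z * g z0 \<partial>sphere_measure)"
      unfolding u_def using P I integral_poisson_kernel[OF x] by (simp add: Bochner_Integration.integral_diff)
    also have "\<bar>\<dots>\<bar> \<le> (\<integral>z. \<bar>poisson_kernel x z * g z - poisson_kernel x z * g z0\<bar> \<partial>sphere_measure)"
      by (rule integral_abs_bound)
    also have "\<dots> \<le> (\<integral>z. poisson_kernel x z * (e / 4) + b \<partial>sphere_measure)"
    proof (rule integral_mono)
      interpret prob_space "sphere_measure :: (real^'n) measure" by (rule prob_space_sphere_measure)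
      show "integrable sphere_measure (\<lambda>z. \<bar>poisson_kernel x z * g z - poisson_kernel x z * g z0\<bar>)"
        using P I by (intro integrable_abs Bochner_Integration.integrable_diff integrable_mult_left)
      show "integrable sphere_measure (\<lambda>z. poisson_kernel x z * (e / 4) + b)"
        using P by (intro Bochner_Integration.integrable_add integrable_mult_left) simp_all
      fix z :: "real^'n" assume "z \<in> space sphere_measure"
      hence z: "norm z = 1" by simp
      have p0: "poisson_kernel x z \<ge> 0" using x by (simp add: poisson_kernel_nonneg)
      have b0: "b \<ge> 0" using G c by (simp add: b_def)
      have "poisson_kernel x z * \<bar>g z - g z0\<bar> \<le> poisson_kernel x z * (e / 4) + b"
      proof (cases "dist z z0 < \<delta>")
        case True
        have "poisson_kernel x z * \<bar>g z - g z0\<bar> \<le> poisson_kernel x z * (e / 4)"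
          using p0 \<delta>(2)[OF z True] by (intro mult_left_mono) auto
        thus ?thesis using b0 by simp
      next
        case False
        have "norm (z - z0) \<le> norm (x - z) + norm (x - z0)"
          using norm_triangle_ineq4[of "x - z0" "x - z"] by (simp add: algebra_simps)
        hence far: "\<delta> / 2 \<le> norm (x - z)" using False xz by (simp add: d_def dist_norm)
        have "(\<delta> / 2)\<^sup>2 \<le> (x - z) \<bullet> (x - z)"
          unfolding power2_norm_eq_inner[symmetric] using far \<delta>(1) by (intro power_mono) auto
        hence "dist_powr (- (real CARD('n) / 2)) x z \<le> c"
          unfolding dist_powr_def c_def using \<delta>(1) by (intro powr_mono2') auto
        moreover have "0 \<le> 1 - x \<bullet> x" "1 - x \<bullet> x \<le> 2 * norm (x - z0)"
        proof -
          have eq: "1 - x \<bullet> x = (1 + norm x) * (1 - norm x)"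
            by (simp add: power2_norm_eq_inner[symmetric] algebra_simps power2_eq_square)
          show "0 \<le> 1 - x \<bullet> x" unfolding eq using x by (intro mult_nonneg_nonneg) auto
          have "1 - x \<bullet> x \<le> 2 * (1 - norm x)"
            unfolding eq using x by (intro mult_right_mono) auto
          also have "1 - norm x \<le> norm (x - z0)"
            using norm_triangle_ineq3[of x z0] z0 by linarith
          finally show "1 - x \<bullet> x \<le> 2 * norm (x - z0)" by simp
        qed
        ultimately have "poisson_kernel x z \<le> 2 * norm (x - z0) * c"
          unfolding poisson_kernel_def by (intro mult_mono) (auto simp: dist_powr_def)
        moreover have "\<bar>g z - g z0\<bar> \<le> 2 * G" using g_bounded[OF z] g_bounded[OF z0] by linarith
        ultimately have "poisson_kernel x z * \<bar>g z - g z0\<bar> \<le> (2 * norm (x - z0) * c) * (2 * G)"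
          using p0 c by (intro mult_mono) auto
        thus ?thesis using p0 e by (simp add: b_def mult_ac add_increasing)
      qed
      thus "\<bar>poisson_kernel x z * g z - poisson_kernel x z * g z0\<bar> \<le> poisson_kernel x z * (e / 4) + b"
        using p0 by (simp add: abs_mult flip: right_diff_distrib)
    qed
    also have "\<dots> = e / 4 + b"
    proof -
      interpret prob_space "sphere_measure :: (real^'n) measure" by (rule prob_space_sphere_measure)
      show ?thesis
        using P integral_poisson_kernel[OF x] prob_space by simp
    qed
    also have "b \<le> e / 2"
    proof -
      have "norm (x - z0) \<le> e / (2 * (4 * G * c + 1))" using xz by (simp add: d_def)
      hence "(4 * G * c + 1) * norm (x - z0) \<le> e / 2" using pos by (simp add: field_simps)
      moreover have "b \<le> (4 * G * c + 1) * norm (x - z0)" by (simp add: b_def algebra_simps)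
      ultimately show ?thesis by linarith
    qed
    finally show "\<bar>u x - g z0\<bar> < e" using e by linarith
  qed
qed

lemma continuous_on_dirichlet:
  assumes g: "continuous_on (sphere 0 1) g"
  shows "continuous_on (cball 0 1) (\<lambda>x. if norm x < 1 then u x else g x)" (is "continuous_on _ ?v")
  unfolding continuous_on_iff
proof (intro ballI allI impI)
  fix x :: "real^'n" and e :: real assume "x \<in> cball 0 1" and e: "e > 0"
  hence x: "norm x \<le> 1" by simp
  show "\<exists>d>0. \<forall>y\<in>cball 0 1. dist y x < d \<longrightarrow> dist (?v y) (?v x) < e"
  proof (cases "norm x < 1")
    case True
    have "continuous (at x) u" using has_derivative_u[OF True] by (rule has_derivative_continuous)
    then obtain d where d: "d > 0" "\<And>y. dist y x < d \<Longrightarrow> dist (u y) (u x) < e"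
      using e unfolding continuous_at_eps_delta by blast
    have "norm y < 1" if "dist y x < 1 - norm x" for y
      using norm_triangle_ineq2[of y x] that by (simp add: dist_norm)
    thus ?thesis using d True by (intro exI[of _ "min d (1 - norm x)"]) auto
  next
    case False
    hence x1: "norm x = 1" using x by simp
    obtain d where d: "d > 0" "\<And>y. norm y < 1 \<Longrightarrow> norm (y - x) < d \<Longrightarrow> \<bar>u y - g x\<bar> < e"
      using boundary_limit[OF g x1 e] by blast
    obtain d' where d': "d' > 0" "\<And>y. norm y = 1 \<Longrightarrow> dist y x < d' \<Longrightarrow> dist (g y) (g x) < e"
      using g x1 e unfolding continuous_on_iff by (metis mem_sphere_0)
    show ?thesis
      using d d' x1 by (intro exI[of _ "min d d'"]) (auto simp: dist_norm)
  qed
qed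

end

section \<open>Dilated harmonic functions as Poisson integrals\<close>

lemma norm_scaleR_less_1:
  fixes y :: "'a::real_normed_vector"
  assumes "0 < r" "r < 1" "norm y \<le> 1"
  shows "norm (r *\<^sub>R y) < 1"
proof -
  have "r * norm y \<le> r * 1" using assms by (intro mult_left_mono) auto
  hence "r * norm y < 1" using assms(2) by linarith
  thus ?thesis using assms(1) by simp
qed

lemma continuous_on_scaled:
  fixes w :: "'a::real_normed_vector \<Rightarrow> 'b::topological_space"
  assumes w: "continuous_on (ball 0 1) w" and r: "0 < r" "r < 1"
  shows "continuous_on (cball 0 1) (\<lambda>y. w (r *\<^sub>R y))"
proof (rule continuous_on_compose2[OF w])
  show "continuous_on (cball 0 1) (\<lambda>y::'a. r *\<^sub>R y)" by (intro continuous_intros)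
  show "(\<lambda>y. r *\<^sub>R y) ` cball 0 1 \<subseteq> ball (0::'a) 1"
  proof (rule image_subsetI)
    fix y :: 'a assume "y \<in> cball 0 1"
    hence "norm (r *\<^sub>R y) < 1" using r by (intro norm_scaleR_less_1) auto
    thus "r *\<^sub>R y \<in> ball 0 1" by simp
  qed
qed

lemma harmonic_on_imp_continuous_on:
  assumes "harmonic_on S w" shows "continuous_on S w"
  using assms unfolding harmonic_on_def
  by (intro differentiable_imp_continuous_on) (auto simp: differentiable_on_def intro: differentiable_at_withinI)

lemma DERIV_axis_scaled:
  fixes f :: "real^'n::finite \<Rightarrow> real"
  assumes "f differentiable (at (r *\<^sub>R x))"
  shows "((\<lambda>t. f (r *\<^sub>R (x + t *\<^sub>R axis i 1))) has_real_derivative r * partial_deriv i f (r *\<^sub>R x)) (at 0)"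
proof -
  have f: "(f has_derivative frechet_derivative f (at (r *\<^sub>R x))) (at (r *\<^sub>R (x + 0 *\<^sub>R axis i 1)))"
    using assms[unfolded frechet_derivative_works] by simp
  have 1: "((\<lambda>t. r *\<^sub>R (x + t *\<^sub>R axis i 1)) has_derivative (\<lambda>t. (r * t) *\<^sub>R axis i 1)) (at (0::real))"
    by (auto intro!: derivative_eq_intros)
  interpret linear "frechet_derivative f (at (r *\<^sub>R x))"
    using assms by (rule linear_frechet_derivative)
  from diff_chain_at[OF 1 f]
  have "((\<lambda>t. f (r *\<^sub>R (x + t *\<^sub>R axis i 1))) has_derivative (\<lambda>t. t * (r * partial_deriv i f (r *\<^sub>R x)))) (at 0)"
    by (simp add: o_def scale partial_deriv_def mult_ac)
  thus ?thesis by (simp add: has_field_derivative_def mult_commute_abs)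
qed

text \<open>The dilated function is continuous up to the sphere and is compared with the Dirichlet
  solution for its own boundary values. The difference vanishes on the sphere, and the maximum
  principle applies to it with both signs.\<close>

theorem poisson_representation:
  fixes w :: "real^'n::finite \<Rightarrow> real"
  assumes w: "harmonic_on (ball 0 1) w" and r: "0 < r" "r < 1" and x: "norm x < 1"
  shows "w (r *\<^sub>R x) = (\<integral>z. poisson_kernel x z * w (r *\<^sub>R z) \<partial>sphere_measure)"
proof -
  have in_ball: "norm (r *\<^sub>R y) < 1" if "norm y \<le> 1" for y :: "real^'n"
    by (rule norm_scaleR_less_1[OF r that])
  have wd: "w differentiable (at y)" if "norm y < 1" for y using w that by (simp add: harmonic_on_def)
  have wd1: "partial_deriv i w differentiable (at y)" if "norm y < 1" for i y
    using w that by (simp add: harmonic_on_def)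
  have cont: "continuous_on (cball 0 1) (\<lambda>y. w (r *\<^sub>R y))"
    by (rule continuous_on_scaled[OF harmonic_on_imp_continuous_on[OF w] r])
  hence conts: "continuous_on (sphere 0 1) (\<lambda>y. w (r *\<^sub>R y))" by (rule continuous_on_subset) auto
  have "bounded ((\<lambda>y. w (r *\<^sub>R y)) ` sphere 0 1)"
    by (intro compact_imp_bounded compact_continuous_image conts compact_sphere)
  then obtain G where "\<forall>a\<in>(\<lambda>y. w (r *\<^sub>R y)) ` sphere 0 1. norm a \<le> G"
    unfolding bounded_iff by blast
  hence G: "\<bar>w (r *\<^sub>R z)\<bar> \<le> G" if "norm z = 1" for z using that by auto
  interpret bounded_boundary_data "\<lambda>z. w (r *\<^sub>R z)" G
    by standard (use G conts in \<open>auto intro: measurable_sphere_measure_contI\<close>)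
  \<comment> \<open>The values on the sphere are prescribed separately, because the Poisson integral
    attains them only as limits.\<close>
  define v where "v = (\<lambda>x. if norm x < 1 then u x else w (r *\<^sub>R x))"
  have le: "s * (w (r *\<^sub>R x) - v x) \<le> 0" for s
  proof (rule maximum_principle[of 1 "\<lambda>y. s * (w (r *\<^sub>R y) - v y)"
        "\<lambda>i y. s * (r * partial_deriv i w (r *\<^sub>R y) - u1 i y)"
        "\<lambda>i y. s * (r * (r * partial_deriv i (partial_deriv i w) (r *\<^sub>R y)) - u2 i i y)"])
    show "continuous_on (cball 0 1) (\<lambda>y. s * (w (r *\<^sub>R y) - v y))"
      unfolding v_def by (intro continuous_intros cont continuous_on_dirichlet[OF conts])
    show "s * (w (r *\<^sub>R z) - v z) \<le> 0" if "norm z = 1" for z using that by (simp add: v_def)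
    fix y :: "real^'n" and i assume y: "norm y < 1"
    have ry: "norm (r *\<^sub>R y) < 1" using in_ball y by simp
    have "((\<lambda>t. v (y + t *\<^sub>R axis i 1)) has_real_derivative u1 i y) (at 0)"
    proof (rule has_field_derivative_transform_within_open[OF DERIV_axis_gradient[OF has_derivative_u[OF y]]])
      show "open ((\<lambda>t::real. y + t *\<^sub>R axis i 1) -` ball 0 1)"
        by (intro open_vimage continuous_intros open_ball)
    qed (use y in \<open>auto simp: v_def\<close>)
    thus "((\<lambda>t. s * (w (r *\<^sub>R (y + t *\<^sub>R axis i 1)) - v (y + t *\<^sub>R axis i 1))) has_real_derivative
        s * (r * partial_deriv i w (r *\<^sub>R y) - u1 i y)) (at 0)"
      by (intro DERIV_cmult DERIV_diff DERIV_axis_scaled wd ry)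
    show "((\<lambda>t. s * (r * partial_deriv i w (r *\<^sub>R (y + t *\<^sub>R axis i 1)) - u1 i (y + t *\<^sub>R axis i 1))) has_real_derivative
        s * (r * (r * partial_deriv i (partial_deriv i w) (r *\<^sub>R y)) - u2 i i y)) (at 0)"
      by (intro DERIV_cmult DERIV_diff DERIV_axis_scaled wd1 ry DERIV_axis_gradient[OF has_derivative_u1[OF y]])
    have "(\<Sum>i\<in>UNIV. partial_deriv i (partial_deriv i w) (r *\<^sub>R y)) = 0"
      using w ry by (simp add: harmonic_on_def)
    thus "(\<Sum>i\<in>UNIV. s * (r * (r * partial_deriv i (partial_deriv i w) (r *\<^sub>R y)) - u2 i i y)) = 0"
      using laplacian_u[OF y] by (simp add: sum_subtractf flip: sum_distrib_left)
  qed (use x in auto)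
  from le[of 1] le[of "- 1"] have "w (r *\<^sub>R x) = v x" by simp
  thus ?thesis using x by (simp add: v_def u_def)
qed

section \<open>The optimal constant as an integral over the sphere\<close>

definition poisson_dir :: "real^'n::finite \<Rightarrow> real^'n \<Rightarrow> real^'n \<Rightarrow> real" where
  "poisson_dir l x z = (\<Sum>k\<in>UNIV. poisson_d1 k x z * l $ k)"

lemma continuous_on_poisson_dir:
  "continuous_on (ball 0 1 \<times> sphere 0 1) (\<lambda>p. poisson_dir l (fst p) (snd p))"
  unfolding poisson_dir_def by (intro continuous_intros continuous_on_poisson_d1)

lemma (in bounded_boundary_data) frechet_derivative_u:
  assumes x: "norm x < 1"
  shows "frechet_derivative u (at x) l = (\<integral>z. poisson_dir l x z * g z \<partial>sphere_measure)"
proof -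
  have "frechet_derivative u (at x) l = (\<Sum>k\<in>UNIV. u1 k x * l $ k)"
    using frechet_derivative_at[OF has_derivative_u[OF x]] by metis
  also have "\<dots> = (\<Sum>k\<in>UNIV. \<integral>z. poisson_d1 k x z * g z * l $ k \<partial>sphere_measure)"
    by (simp add: u1_def)
  also have "\<dots> = (\<integral>z. (\<Sum>k\<in>UNIV. poisson_d1 k x z * g z * l $ k) \<partial>sphere_measure)"
    by (intro Bochner_Integration.integral_sum[symmetric] integrable_mult_left integrable_kernel[OF continuous_on_poisson_d1 x])
  also have "(\<lambda>z. \<Sum>k\<in>UNIV. poisson_d1 k x z * g z * l $ k) = (\<lambda>z. poisson_dir l x z * g z)"
    by (simp add: poisson_dir_def sum_distrib_left sum_distrib_right mult_ac)
  finally show ?thesis .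
qed

lemma integrable_abs_poisson_dir:
  fixes x :: "real^'n::finite"
  assumes "norm x < 1"
  shows "integrable sphere_measure (\<lambda>z. \<bar>poisson_dir l x z\<bar>)"
proof -
  interpret bounded_boundary_data "\<lambda>_::real^'n. 1" 1 by standard auto
  show ?thesis
    using integrable_kernel[OF continuous_on_poisson_dir assms, of l] by (simp add: integrable_abs)
qed

lemma frechet_derivative_eq_partial_derivs:
  fixes f :: "real^'n::finite \<Rightarrow> real"
  assumes "f differentiable (at x)"
  shows "frechet_derivative f (at x) l = (\<Sum>k\<in>UNIV. partial_deriv k f x * l $ k)"
proof -
  interpret linear "frechet_derivative f (at x)"
    using assms by (rule linear_frechet_derivative)
  have "l = (\<Sum>k\<in>UNIV. l $ k *\<^sub>R axis k 1)"
    by (simp add: vec_eq_iff axis_def if_distrib[of "\<lambda>x. _ * x"] sum.delta cong: if_cong)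
  hence "frechet_derivative f (at x) l = frechet_derivative f (at x) (\<Sum>k\<in>UNIV. l $ k *\<^sub>R axis k 1)"
    by simp
  also have "\<dots> = (\<Sum>k\<in>UNIV. partial_deriv k f x * l $ k)"
    by (simp add: sum scale partial_deriv_def mult.commute)
  finally show ?thesis .
qed

lemma abs_le_SUP_ball:
  fixes w :: "real^'n::finite \<Rightarrow> real"
  assumes "bounded (w ` ball 0 1)" "norm y < 1"
  shows "\<bar>w y\<bar> \<le> (SUP y\<in>ball 0 1. \<bar>w y\<bar>)"
proof (rule cSUP_upper)
  from assms(1) obtain B where "\<forall>a\<in>w ` ball 0 1. norm a \<le> B"
    unfolding bounded_iff by blast
  thus "bdd_above ((\<lambda>y. \<bar>w y\<bar>) ` ball 0 1)" by (auto simp: bdd_above_def)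
qed (use assms in simp)

text \<open>For r < 1 the representation bounds r times the derivative at r x, the factor r coming
  from the chain rule. The limit is taken in this inequality, so boundary values of w itself never
  enter.\<close>

lemma gradient_estimate:
  fixes w :: "real^'n::finite \<Rightarrow> real"
  assumes w: "harmonic_on (ball 0 1) w" and bw: "bounded (w ` ball 0 1)" and x: "norm x < 1"
  shows "\<bar>frechet_derivative w (at x) l\<bar> \<le> (\<integral>z. \<bar>poisson_dir l x z\<bar> \<partial>sphere_measure) * (SUP y\<in>ball 0 1. \<bar>w y\<bar>)"
    (is "_ \<le> ?C * ?S")
proof -
  have wd: "w differentiable (at y)" if "norm y < 1" for y using w that by (simp add: harmonic_on_def)
  have est: "\<bar>r * frechet_derivative w (at (r *\<^sub>R x)) l\<bar> \<le> ?C * ?S" if r: "0 < r" "r < 1" for r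
  proof -
    have in_ball: "norm (r *\<^sub>R y) < 1" if "norm y \<le> 1" for y :: "real^'n"
      by (rule norm_scaleR_less_1[OF r that])
    have cont: "continuous_on (sphere 0 1) (\<lambda>y. w (r *\<^sub>R y))"
      by (rule continuous_on_subset[OF continuous_on_scaled[OF harmonic_on_imp_continuous_on[OF w] r]]) auto
    interpret bounded_boundary_data "\<lambda>z. w (r *\<^sub>R z)" ?S
    proof
      show "(\<lambda>z. w (r *\<^sub>R z)) \<in> borel_measurable sphere_measure"
        by (rule measurable_sphere_measure_contI[OF cont])
      show "\<bar>w (r *\<^sub>R z)\<bar> \<le> ?S" if "norm z = 1" for z
        by (rule abs_le_SUP_ball[OF bw in_ball]) (simp add: that)
    qed
    have "((\<lambda>y. w (r *\<^sub>R y)) has_derivative (\<lambda>h. frechet_derivative w (at (r *\<^sub>R x)) (r *\<^sub>R h))) (at x)"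
    proof -
      have "(w has_derivative frechet_derivative w (at (r *\<^sub>R x))) (at (r *\<^sub>R x))"
        using wd[OF in_ball, of x] x unfolding frechet_derivative_works by simp
      moreover have "((\<lambda>y. r *\<^sub>R y) has_derivative (\<lambda>h. r *\<^sub>R h)) (at x)"
        by (auto intro!: derivative_eq_intros)
      ultimately show ?thesis using diff_chain_at by (fastforce simp: o_def)
    qed
    hence "(u has_derivative (\<lambda>h. frechet_derivative w (at (r *\<^sub>R x)) (r *\<^sub>R h))) (at x)"
      by (rule has_derivative_transform_within_open[OF _ open_ball[of 0 1]])
        (use x poisson_representation[OF w r] in \<open>auto simp: u_def\<close>)
    hence "frechet_derivative u (at x) = (\<lambda>h. frechet_derivative w (at (r *\<^sub>R x)) (r *\<^sub>R h))"
      by (rule frechet_derivative_at[symmetric])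
    moreover have "frechet_derivative w (at (r *\<^sub>R x)) (r *\<^sub>R l) = r * frechet_derivative w (at (r *\<^sub>R x)) l"
      using linear_scale[OF linear_frechet_derivative[OF wd[OF in_ball]], of x r l] x by simp
    ultimately have "r * frechet_derivative w (at (r *\<^sub>R x)) l = (\<integral>z. poisson_dir l x z * w (r *\<^sub>R z) \<partial>sphere_measure)"
      using frechet_derivative_u[OF x, of l] by simp
    also have "\<bar>\<dots>\<bar> \<le> (\<integral>z. \<bar>poisson_dir l x z * w (r *\<^sub>R z)\<bar> \<partial>sphere_measure)"
      by (rule integral_abs_bound)
    also have "\<dots> \<le> (\<integral>z. \<bar>poisson_dir l x z\<bar> * ?S \<partial>sphere_measure)"
    proof (rule integral_mono)
      show "integrable sphere_measure (\<lambda>z. \<bar>poisson_dir l x z * w (r *\<^sub>R z)\<bar>)"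
        by (intro integrable_abs integrable_kernel[OF continuous_on_poisson_dir x])
      show "integrable sphere_measure (\<lambda>z. \<bar>poisson_dir l x z\<bar> * ?S)"
        by (intro integrable_mult_left integrable_abs_poisson_dir x)
      show "\<bar>poisson_dir l x z * w (r *\<^sub>R z)\<bar> \<le> \<bar>poisson_dir l x z\<bar> * ?S" if "z \<in> space sphere_measure" for z
        unfolding abs_mult using that g_bounded[of z] by (intro mult_left_mono) auto
    qed
    finally show ?thesis by simp
  qed
  have tend: "((\<lambda>r. \<bar>r * frechet_derivative w (at (r *\<^sub>R x)) l\<bar>) \<longlongrightarrow> \<bar>1 * frechet_derivative w (at x) l\<bar>) (at_left 1)"
  proof (intro tendsto_intros)
    \<comment> \<open>\<open>harmonic_on\<close> provides continuity of the partial derivatives, so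
      the directional derivative is expanded in them before passing to the limit.\<close>
    have "((\<lambda>r. \<Sum>k\<in>UNIV. partial_deriv k w (r *\<^sub>R x) * l $ k) \<longlongrightarrow> (\<Sum>k\<in>UNIV. partial_deriv k w x * l $ k)) (at_left 1)"
    proof (intro tendsto_intros)
      fix k
      have "continuous_on (ball 0 1) (partial_deriv k w)" using w by (simp add: harmonic_on_def)
      hence "isCont (partial_deriv k w) x" using x by (simp add: continuous_on_eq_continuous_at)
      moreover have "((\<lambda>r. r *\<^sub>R x) \<longlongrightarrow> 1 *\<^sub>R x) (at_left 1)" by (intro tendsto_intros)
      ultimately show "((\<lambda>r. partial_deriv k w (r *\<^sub>R x)) \<longlongrightarrow> partial_deriv k w x) (at_left 1)"
        by (intro isCont_tendsto_compose[where g = "partial_deriv k w"]) simp_all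
    qed
    moreover have "eventually (\<lambda>r. (\<Sum>k\<in>UNIV. partial_deriv k w (r *\<^sub>R x) * l $ k) = frechet_derivative w (at (r *\<^sub>R x)) l) (at_left 1)"
    proof -
      have "eventually (\<lambda>r::real. r \<in> {0<..<1}) (at_left 1)"
        by (rule eventually_at_leftI[of 0]) auto
      thus ?thesis
      proof eventually_elim
        case (elim r)
        hence "norm (r *\<^sub>R x) < 1" using x by (intro norm_scaleR_less_1) auto
        thus ?case by (intro frechet_derivative_eq_partial_derivs[symmetric] wd)
      qed
    qed
    ultimately show "((\<lambda>r. frechet_derivative w (at (r *\<^sub>R x)) l) \<longlongrightarrow> frechet_derivative w (at x) l) (at_left 1)"
      unfolding frechet_derivative_eq_partial_derivs[OF wd[OF x]] by (rule Lim_transform_eventually)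
  qed
  have "\<bar>1 * frechet_derivative w (at x) l\<bar> \<le> ?C * ?S"
  proof (rule tendsto_upperbound[OF tend])
    show "eventually (\<lambda>r. \<bar>r * frechet_derivative w (at (r *\<^sub>R x)) l\<bar> \<le> ?C * ?S) (at_left 1)"
      by (rule eventually_at_leftI[of 0]) (auto intro!: est)
  qed simp
  thus ?thesis by simp
qed

lemma harmonic_on_const: "harmonic_on S (\<lambda>_. c)"
proof -
  have "partial_deriv i (\<lambda>_. c') = (\<lambda>_. 0)" for i :: 'a and c'
    by (rule ext) (simp add: partial_deriv_def)
  thus ?thesis by (simp add: harmonic_on_def)
qed

text \<open>With the sign of the kernel derivative as data, the derivative of the Poisson integral
  at x is the whole integral of the absolute value, while its supremum is at most 1. Hence the
  constant of \<open>gradient_estimate\<close> is a minimum.\<close>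

theorem opt_const_eq_integral:
  fixes x :: "real^'n::finite"
  assumes x: "norm x < 1"
  shows "opt_const x l = (\<integral>z. \<bar>poisson_dir l x z\<bar> \<partial>sphere_measure)"
  unfolding opt_const_def
proof (rule cInf_eq_minimum)
  show "(\<integral>z. \<bar>poisson_dir l x z\<bar> \<partial>sphere_measure) \<in> {C. \<forall>u. harmonic_on (ball 0 1) u \<and> bounded (u ` ball 0 1) \<longrightarrow>
       \<bar>frechet_derivative u (at x) l\<bar> \<le> C * (SUP y\<in>ball 0 1. \<bar>u y\<bar>)}"
    using gradient_estimate[OF _ _ x] by blast
next
  fix C
  assume "C \<in> {C. \<forall>u. harmonic_on (ball 0 1) u \<and> bounded (u ` ball 0 1) \<longrightarrow>
       \<bar>frechet_derivative u (at x) l\<bar> \<le> C * (SUP y\<in>ball 0 1. \<bar>u y\<bar>)}"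
  hence C: "\<bar>frechet_derivative u (at x) l\<bar> \<le> C * (SUP y\<in>ball 0 1. \<bar>u y\<bar>)"
    if "harmonic_on (ball 0 1) u" "bounded (u ` ball 0 1)" for u using that by blast
  \<comment> \<open>Testing with a constant function forces C to be nonnegative, which allows the
    supremum of |u| to be replaced by its bound 1.\<close>
  have C0: "C \<ge> 0"
  proof -
    have "bounded ((\<lambda>_::real^'n. 1::real) ` ball 0 1)"
      by (rule bounded_subset[of "{1}"]) auto
    from C[OF harmonic_on_const this] show ?thesis by simp
  qed
  interpret bounded_boundary_data "\<lambda>z. sgn (poisson_dir l x z)" 1
  proof
    show "(\<lambda>z. sgn (poisson_dir l x z)) \<in> borel_measurable sphere_measure"
      using kernel_measurable[OF continuous_on_poisson_dir x] by measurable
  qed (simp add: abs_sgn_eq)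
  have le1: "\<bar>u y\<bar> \<le> 1" if "y \<in> ball 0 1" for y using abs_u_le that by simp
  have bu: "bounded (u ` ball 0 1)" using le1 by (auto simp: bounded_iff intro!: exI[of _ 1])
  have "(\<integral>z. \<bar>poisson_dir l x z\<bar> \<partial>sphere_measure) = frechet_derivative u (at x) l"
    unfolding frechet_derivative_u[OF x] by (simp add: abs_sgn)
  also have "\<dots> \<le> C * (SUP y\<in>ball 0 1. \<bar>u y\<bar>)" using C[OF harmonic_on_u bu] by simp
  also have "\<dots> \<le> C * 1" using C0 le1 by (intro mult_left_mono cSUP_least) auto
  finally show "(\<integral>z. \<bar>poisson_dir l x z\<bar> \<partial>sphere_measure) \<le> C" by simp
qed

section \<open>Evaluation of the integral\<close>

text \<open>Both terms of the gradient carry the power -n/2 - 1 of q = |x - z|^2 once a factor q is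
  split off q^(-n/2). With x on axis i and l in the plane of axes i and j, only two coordinates of z
  survive.\<close>

lemma poisson_dir_axis_eq:
  fixes i j :: "'n::finite" and \<rho> c s :: real
  assumes ij: "i \<noteq> j" and z: "norm z = 1" and \<rho>: "0 \<le> \<rho>" "\<rho> < 1"
  defines "n \<equiv> real CARD('n)"
  shows "\<bar>poisson_dir (c *\<^sub>R axis i 1 + s *\<^sub>R axis j 1) (\<rho> *\<^sub>R axis i 1) z\<bar> =
    (1 + \<rho>\<^sup>2 - 2 * \<rho> * z $ i) powr (- (n / 2) - 1) *
    \<bar>2 * \<rho> * c * (1 + \<rho>\<^sup>2 - 2 * \<rho> * z $ i) + n * (1 - \<rho>\<^sup>2) * (\<rho> * c - (c * z $ i + s * z $ j))\<bar>"
proof -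
  define l where "l = c *\<^sub>R axis i 1 + s *\<^sub>R axis j (1::real)"
  define x where "x = \<rho> *\<^sub>R axis i (1::real)"
  define q where "q = 1 + \<rho>\<^sup>2 - 2 * \<rho> * z $ i"
  have zz: "z \<bullet> z = 1" using z by (simp add: norm_eq_1)
  have yl: "y \<bullet> l = c * y $ i + s * y $ j" for y by (simp add: l_def inner_add_right inner_axis)
  have xl: "x \<bullet> l = \<rho> * c" using ij by (simp add: yl x_def axis_def)
  have xx: "x \<bullet> x = \<rho>\<^sup>2" by (simp add: x_def inner_axis power2_eq_square)
  have xz: "x \<bullet> z = \<rho> * z $ i" by (simp add: x_def inner_axis')
  have q: "(x - z) \<bullet> (x - z) = q"
    using zz xx xz by (simp add: q_def inner_diff_left inner_diff_right inner_commute)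
  have "norm x < 1" using \<rho> by (simp add: x_def)
  hence q0: "q > 0" using ball_sphere_neq[of x z] z q by simp
  have Q0: "q powr (- (n / 2)) = q powr (- (n / 2) - 1) * q"
    using q0 powr_add[of q 1 "- (n / 2) - 1"] by simp
  have "poisson_dir l x z = (\<Sum>k\<in>UNIV. (- 2 * q powr (- (n / 2)) * x $ k
     + (- n * (1 - \<rho>\<^sup>2) * q powr (- (n / 2) - 1)) * (x - z) $ k) * l $ k)"
    unfolding poisson_dir_def poisson_d1_def dist_powr_def q xx n_def[symmetric] by simp
  also have "\<dots> = - 2 * q powr (- (n / 2)) * (x \<bullet> l) + (- n * (1 - \<rho>\<^sup>2) * q powr (- (n / 2) - 1)) * ((x - z) \<bullet> l)"
    by (rule sum_gradient(1))
  also have "\<dots> = - (q powr (- (n / 2) - 1) * (2 * \<rho> * c * q + n * (1 - \<rho>\<^sup>2) * (\<rho> * c - (c * z $ i + s * z $ j))))"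
    unfolding inner_diff_left xl yl[of z] Q0 by (simp add: algebra_simps)
  finally show ?thesis
    unfolding l_def[symmetric] x_def[symmetric] q_def[symmetric] using q0 by (simp add: abs_mult)
qed

text \<open>The involution of the sphere that sends \<^term>\<open>z\<close> to the second intersection point of the
  sphere with the line through \<^term>\<open>z\<close> and \<open>\<rho> e\<^sub>1\<close>, followed by the antipodal map, acts on the
  first coordinate by \<open>moebius \<rho>\<close> and leaves the direction of the remaining ones unchanged.\<close>

definition moebius :: "real \<Rightarrow> real \<Rightarrow> real" where
  "moebius \<rho> s = (2 * \<rho> + s * (1 + \<rho>\<^sup>2)) / (1 + \<rho>\<^sup>2 + 2 * \<rho> * s)"

lemma moebius_denominator_pos:
  fixes \<rho> s :: real
  assumes "0 \<le> \<rho>" "\<rho> < 1" "- 1 \<le> s"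
  shows "1 + \<rho>\<^sup>2 + 2 * \<rho> * s > 0"
proof -
  have "(1 - \<rho>)\<^sup>2 > 0" using assms by simp
  moreover have "2 * \<rho> * (- 1) \<le> 2 * \<rho> * s" using assms by (intro mult_left_mono) auto
  ultimately show ?thesis by (simp add: power2_eq_square algebra_simps)
qed

text \<open>Polynomial identities after clearing the denominator D, which is |\<rho> e_1 + z|^2 for
  a unit vector z with first coordinate s. The ratio (1 - \<rho>^2) / D scales the length of the
  remaining coordinates, and its square is the derivative.\<close>

lemma moebius_facts:
  fixes \<rho> s :: real
  assumes \<rho>: "0 \<le> \<rho>" "\<rho> < 1" and s: "- 1 \<le> s"
  defines "D \<equiv> 1 + \<rho>\<^sup>2 + 2 * \<rho> * s"
  shows "1 - (moebius \<rho> s)\<^sup>2 = (1 - \<rho>\<^sup>2)\<^sup>2 * (1 - s\<^sup>2) / D\<^sup>2"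
    and "1 + \<rho>\<^sup>2 - 2 * \<rho> * moebius \<rho> s = (1 - \<rho>\<^sup>2)\<^sup>2 / D"
    and "\<rho> - moebius \<rho> s = - ((1 - \<rho>\<^sup>2) * (\<rho> + s) / D)"
    and "(moebius \<rho> has_real_derivative (1 - \<rho>\<^sup>2)\<^sup>2 / D\<^sup>2) (at s)"
proof -
  have D: "D > 0" unfolding D_def by (rule moebius_denominator_pos[OF \<rho> s])
  define N where "N = 2 * \<rho> + s * (1 + \<rho>\<^sup>2)"
  have h: "moebius \<rho> s = N / D" by (simp add: moebius_def N_def D_def)
  have "D\<^sup>2 - N\<^sup>2 = (1 - \<rho>\<^sup>2)\<^sup>2 * (1 - s\<^sup>2)" unfolding D_def N_def by algebra
  thus "1 - (moebius \<rho> s)\<^sup>2 = (1 - \<rho>\<^sup>2)\<^sup>2 * (1 - s\<^sup>2) / D\<^sup>2"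
    unfolding h using D by (simp add: power_divide field_simps)
  have "(1 + \<rho>\<^sup>2) * D - 2 * \<rho> * N = (1 - \<rho>\<^sup>2)\<^sup>2" unfolding D_def N_def by algebra
  thus "1 + \<rho>\<^sup>2 - 2 * \<rho> * moebius \<rho> s = (1 - \<rho>\<^sup>2)\<^sup>2 / D"
    unfolding h using D by (simp add: field_simps)
  have "\<rho> - moebius \<rho> s = (\<rho> * D - N) / D" unfolding h using D by (simp add: field_simps)
  also have "\<rho> * D - N = - ((1 - \<rho>\<^sup>2) * (\<rho> + s))" unfolding D_def N_def by algebra
  finally show "\<rho> - moebius \<rho> s = - ((1 - \<rho>\<^sup>2) * (\<rho> + s) / D)" by simp
  have "(moebius \<rho> has_real_derivative ((1 + \<rho>\<^sup>2) * D - N * (2 * \<rho>)) / (D * D)) (at s)"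
    unfolding moebius_def[abs_def] N_def D_def using D[unfolded D_def]
    by (intro DERIV_divide) (auto intro!: derivative_eq_intros)
  also have "(1 + \<rho>\<^sup>2) * D - N * (2 * \<rho>) = (1 - \<rho>\<^sup>2)\<^sup>2" unfolding D_def N_def by algebra
  finally show "(moebius \<rho> has_real_derivative (1 - \<rho>\<^sup>2)\<^sup>2 / D\<^sup>2) (at s)"
    by (simp add: power2_eq_square)
qed

text \<open>In the affine factor 2 \<rho> c and - n c (\<rho> + s) combine to - ((n - 2) \<rho> c +
  n c s), leaving <z, l> and a constant. With E = 1 - \<rho>^2 the exponents of E add up to (n - 3)
  + (- n - 2) + 4 = -1, those of D to (3 - n) + (n/2 + 1) - 3 = 1 - n/2.\<close>

lemma moebius_transformed_integrand:
  fixes \<rho> c \<sigma> n s v :: real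
  assumes \<rho>: "0 \<le> \<rho>" "\<rho> < 1" and s: "s \<in> {-1<..<1}"
  defines "D \<equiv> 1 + \<rho>\<^sup>2 + 2 * \<rho> * s" and "h \<equiv> moebius \<rho> s"
  shows "(1 - h\<^sup>2) powr ((n - 3) / 2) * ((1 + \<rho>\<^sup>2 - 2 * \<rho> * h) powr (- (n / 2) - 1) *
     \<bar>2 * \<rho> * c * (1 + \<rho>\<^sup>2 - 2 * \<rho> * h) + n * (1 - \<rho>\<^sup>2) * (\<rho> * c - (c * h + \<sigma> * (v * sqrt (1 - h\<^sup>2))))\<bar>)
     * ((1 - \<rho>\<^sup>2)\<^sup>2 / D\<^sup>2) =
   1 / (1 - \<rho>\<^sup>2) * ((1 - s\<^sup>2) powr ((n - 3) / 2) * (D powr (1 - n / 2) *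
     \<bar>(n - 2) * \<rho> * c + n * (c * s + \<sigma> * (v * sqrt (1 - s\<^sup>2)))\<bar>))"
proof -
  have s': "- 1 \<le> s" using s by simp
  have D: "D > 0" unfolding D_def by (rule moebius_denominator_pos[OF \<rho> s'])
  have S: "1 - s\<^sup>2 > 0" using s by (simp add: abs_square_less_1 abs_less_iff)
  define E where "E = 1 - \<rho>\<^sup>2"
  have E: "E > 0" using \<rho> by (simp add: E_def power_less_one_iff abs_square_less_1)
  have h1: "1 - h\<^sup>2 = E\<^sup>2 * (1 - s\<^sup>2) / D\<^sup>2" and h2: "1 + \<rho>\<^sup>2 - 2 * \<rho> * h = E\<^sup>2 / D"
    and h3: "\<rho> - h = - (E * (\<rho> + s) / D)"
    using moebius_facts[OF \<rho> s'] by (simp_all add: D_def h_def E_def)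
  have sq: "sqrt (1 - h\<^sup>2) = E * sqrt (1 - s\<^sup>2) / D"
    unfolding h1 using D E by (simp add: real_sqrt_divide real_sqrt_mult)
  have "2 * \<rho> * c * (1 + \<rho>\<^sup>2 - 2 * \<rho> * h) + n * (1 - \<rho>\<^sup>2) * (\<rho> * c - (c * h + \<sigma> * (v * sqrt (1 - h\<^sup>2))))
    = 2 * \<rho> * c * (E\<^sup>2 / D) + n * E * (c * (\<rho> - h) - \<sigma> * (v * (E * sqrt (1 - s\<^sup>2) / D)))"
    unfolding h2 sq E_def[symmetric] by (simp add: algebra_simps)
  also have "\<dots> = - (E\<^sup>2 / D * ((n - 2) * \<rho> * c + n * (c * s + \<sigma> * (v * sqrt (1 - s\<^sup>2)))))"
    unfolding h3 by (simp add: divide_inverse power2_eq_square algebra_simps)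
  finally have abs: "\<bar>2 * \<rho> * c * (1 + \<rho>\<^sup>2 - 2 * \<rho> * h) + n * (1 - \<rho>\<^sup>2) * (\<rho> * c - (c * h + \<sigma> * (v * sqrt (1 - h\<^sup>2))))\<bar>
    = E\<^sup>2 / D * \<bar>(n - 2) * \<rho> * c + n * (c * s + \<sigma> * (v * sqrt (1 - s\<^sup>2)))\<bar>"
    using D E by (simp add: abs_mult)
  have p1: "(1 - h\<^sup>2) powr ((n - 3) / 2) = E powr (n - 3) * (1 - s\<^sup>2) powr ((n - 3) / 2) * D powr (3 - n)"
  proof -
    have "(1 - h\<^sup>2) powr ((n - 3) / 2) = ((E powr 2) powr ((n - 3) / 2) * (1 - s\<^sup>2) powr ((n - 3) / 2)) / (D powr 2) powr ((n - 3) / 2)"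
      unfolding h1 using D E S by (simp add: powr_mult powr_divide)
    also have "\<dots> = E powr (n - 3) * (1 - s\<^sup>2) powr ((n - 3) / 2) / D powr (n - 3)"
    proof -
      have "2 * ((n - 3) / 2) = n - 3" by (simp add: field_simps)
      thus ?thesis by (simp only: powr_powr)
    qed
    also have "\<dots> = E powr (n - 3) * (1 - s\<^sup>2) powr ((n - 3) / 2) * D powr (- (n - 3))"
      by (simp only: powr_minus_divide) simp
    finally show ?thesis by simp
  qed
  have p2: "(E\<^sup>2 / D) powr (- (n / 2) - 1) = E powr (- n - 2) * D powr (n / 2 + 1)"
  proof -
    have "(E\<^sup>2 / D) powr (- (n / 2) - 1) = (E powr 2) powr (- (n / 2) - 1) / D powr (- (n / 2) - 1)"
      using D E by (simp add: powr_divide)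
    also have "(E powr 2) powr (- (n / 2) - 1) = E powr (- n - 2)"
      by (simp add: powr_powr algebra_simps)
    also have "E powr (- n - 2) / D powr (- (n / 2) - 1) = E powr (- n - 2) * D powr (- (- (n / 2) - 1))"
      by (simp only: powr_minus_divide) simp
    finally show ?thesis by (simp add: add.commute)
  qed
  have e2: "E\<^sup>2 = E powr 2" "1 / E = E powr (- 1)" using E by (simp_all add: powr_minus_divide)
  have d1: "1 / D = D powr (- 1)" "1 / D\<^sup>2 = D powr (- 2)" using D by (simp_all add: powr_minus_divide)
  have "E powr (n - 3) * E powr (- n - 2) * E\<^sup>2 * E\<^sup>2 = 1 / E"
    unfolding e2 powr_add[symmetric] by simp
  moreover have "D powr (3 - n) * D powr (n / 2 + 1) * (1 / D) * (1 / D\<^sup>2) = D powr (1 - n / 2)"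
    unfolding d1 powr_add[symmetric] by (rule arg_cong[of _ _ "\<lambda>x. D powr x"]) (simp add: field_simps)
  moreover have "a * y * d * (a' * d' * (e / D * x)) * (e / D\<^sup>2) =
    (a * a' * e * e) * (y * ((d * d' * (1 / D) * (1 / D\<^sup>2)) * x))" for a a' d d' e x y :: real
    by simp
  ultimately show ?thesis
    unfolding abs unfolding h2 p1 p2 E_def[symmetric] by (simp only:)
qed

text \<open>The map fixes -1 and 1 and has nonnegative derivative between them. The endpoints are
  added to substitute on a compact interval and removed again as a null set.\<close>

lemma nn_integral_moebius:
  fixes \<Phi> :: "real \<Rightarrow> ennreal"
  assumes [measurable]: "\<Phi> \<in> borel_measurable borel" and \<rho>: "0 \<le> \<rho>" "\<rho> < 1"
  shows "(\<integral>\<^sup>+s. \<Phi> s * indicator {-1<..<1} s \<partial>lborel) =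
    (\<integral>\<^sup>+s. \<Phi> (moebius \<rho> s) * ennreal ((1 - \<rho>\<^sup>2)\<^sup>2 / (1 + \<rho>\<^sup>2 + 2 * \<rho> * s)\<^sup>2) * indicator {-1<..<1} s \<partial>lborel)"
proof -
  have ends: "moebius \<rho> (- 1) = - 1" "moebius \<rho> 1 = 1"
  proof -
    have "(1 - \<rho>)\<^sup>2 > 0" "(1 + \<rho>)\<^sup>2 > 0" using \<rho> by auto
    hence "1 + \<rho>\<^sup>2 - 2 * \<rho> \<noteq> 0" "1 + \<rho>\<^sup>2 + 2 * \<rho> \<noteq> 0" by (auto simp: power2_eq_square algebra_simps)
    thus "moebius \<rho> (- 1) = - 1" "moebius \<rho> 1 = 1" by (simp_all add: moebius_def divide_eq_eq add.commute)
  qed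
  have "(\<integral>\<^sup>+s. \<Phi> s * indicator {-1<..<1} s \<partial>lborel) = (\<integral>\<^sup>+s. \<Phi> s * indicator {moebius \<rho> (- 1)..moebius \<rho> 1} s \<partial>lborel)"
    unfolding ends
    by (intro nn_integral_cong_AE AE_I[of _ _ "{-1, 1}"]) (auto simp: indicator_def emeasure_lborel_countable)
  also have "\<dots> = (\<integral>\<^sup>+s. \<Phi> (moebius \<rho> s) * ennreal ((1 - \<rho>\<^sup>2)\<^sup>2 / (1 + \<rho>\<^sup>2 + 2 * \<rho> * s)\<^sup>2) * indicator {-1..1} s \<partial>lborel)"
  proof (rule nn_integral_substitution_aux)
    show "continuous_on {-1..1} (\<lambda>s. (1 - \<rho>\<^sup>2)\<^sup>2 / (1 + \<rho>\<^sup>2 + 2 * \<rho> * s)\<^sup>2)"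
      using moebius_denominator_pos[OF \<rho>] by (intro continuous_intros) force
    show "(moebius \<rho> has_real_derivative (1 - \<rho>\<^sup>2)\<^sup>2 / (1 + \<rho>\<^sup>2 + 2 * \<rho> * s)\<^sup>2) (at s)" if "s \<in> {-1..1}" for s
      using that by (intro moebius_facts[OF \<rho>]) auto
  qed auto
  also have "\<dots> = (\<integral>\<^sup>+s. \<Phi> (moebius \<rho> s) * ennreal ((1 - \<rho>\<^sup>2)\<^sup>2 / (1 + \<rho>\<^sup>2 + 2 * \<rho> * s)\<^sup>2) * indicator {-1<..<1} s \<partial>lborel)"
    by (intro nn_integral_cong_AE AE_I[of _ _ "{-1, 1}"]) (auto simp: indicator_def emeasure_lborel_countable)
  finally show ?thesis .
qed

text \<open>The formula for two coordinates is used in both directions: the substitution acts on s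
  for fixed v, and the return to the sphere makes orthogonal transformations available
  again.\<close>

lemma nn_integral_poisson_dir:
  fixes i j :: "'n::finite" and \<rho> c \<sigma> :: real
  assumes card: "CARD('n) \<ge> 3" and ij: "i \<noteq> j" and \<rho>: "0 \<le> \<rho>" "\<rho> < 1"
  defines "n \<equiv> real CARD('n)"
  shows "(\<integral>\<^sup>+z. ennreal \<bar>poisson_dir (c *\<^sub>R axis i 1 + \<sigma> *\<^sub>R axis j 1) (\<rho> *\<^sub>R axis i 1) z\<bar> \<partial>sphere_measure) =
    ennreal (1 / (1 - \<rho>\<^sup>2)) *
    (\<integral>\<^sup>+z. ennreal ((1 + \<rho>\<^sup>2 + 2 * \<rho> * z $ i) powr (1 - n / 2) * \<bar>(n - 2) * \<rho> * c + n * (c * z $ i + \<sigma> * z $ j)\<bar>)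
      \<partial>(sphere_measure :: (real^'n) measure))"
proof -
  let ?J = "\<lambda>x. indicator {-1<..<1::real} x :: ennreal"
  define F1 where "F1 = (\<lambda>s t. (1 + \<rho>\<^sup>2 - 2 * \<rho> * s) powr (- (n / 2) - 1) *
    \<bar>2 * \<rho> * c * (1 + \<rho>\<^sup>2 - 2 * \<rho> * s) + n * (1 - \<rho>\<^sup>2) * (\<rho> * c - (c * s + \<sigma> * t))\<bar>)"
  define F2 where "F2 = (\<lambda>s t. (1 + \<rho>\<^sup>2 + 2 * \<rho> * s) powr (1 - n / 2) * \<bar>(n - 2) * \<rho> * c + n * (c * s + \<sigma> * t)\<bar>)"
  define w where "w = (\<lambda>v::real. (1 - v\<^sup>2) powr ((n - 4) / 2))"
  define W where "W = (\<lambda>s::real. (1 - s\<^sup>2) powr ((n - 3) / 2))"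
  define \<kappa> where "\<kappa> = ennreal ((n - 2) / (2 * pi))"
  have [measurable]: "w \<in> borel_measurable borel" "W \<in> borel_measurable borel" by (simp_all add: w_def W_def)
  have nonneg: "F1 s t \<ge> 0" "F2 s t \<ge> 0" "w s \<ge> 0" "W s \<ge> 0" for s t
    by (simp_all add: F1_def F2_def w_def W_def)
  have m1: "(\<lambda>p. ennreal (F1 (fst p) (snd p))) \<in> borel_measurable (borel \<Otimes>\<^sub>M borel)"
    unfolding F1_def by measurable
  have m2: "(\<lambda>p. ennreal (F2 (fst p) (snd p))) \<in> borel_measurable (borel \<Otimes>\<^sub>M borel)"
    unfolding F2_def by measurable
  have [measurable (raw)]: "(\<lambda>x. F1 (f x) (g x)) \<in> borel_measurable M" "(\<lambda>x. F2 (f x) (g x)) \<in> borel_measurable M"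
    if [measurable]: "f \<in> borel_measurable M" "g \<in> borel_measurable M" for f g and M :: "'x measure"
    unfolding F1_def F2_def by measurable
  define \<Phi> where "\<Phi> = (\<lambda>s. \<integral>\<^sup>+v. ennreal (W s * w v) * ?J v * ennreal (F1 s (v * sqrt (1 - s\<^sup>2))) \<partial>lborel)"
  have [measurable]: "\<Phi> \<in> borel_measurable borel" unfolding \<Phi>_def by measurable
  have "(\<integral>\<^sup>+z. ennreal \<bar>poisson_dir (c *\<^sub>R axis i 1 + \<sigma> *\<^sub>R axis j 1) (\<rho> *\<^sub>R axis i 1) z\<bar> \<partial>sphere_measure) =
    (\<integral>\<^sup>+z. ennreal (F1 (z $ i) (z $ j)) \<partial>(sphere_measure :: (real^'n) measure))"
    by (intro nn_integral_cong) (simp add: poisson_dir_axis_eq[OF ij _ \<rho>] F1_def n_def)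
  also have "\<dots> = \<kappa> * (\<integral>\<^sup>+s. \<integral>\<^sup>+v. ennreal (W s * w v) * ?J s * ?J v * ennreal (F1 s (v * sqrt (1 - s\<^sup>2))) \<partial>lborel \<partial>lborel)"
    using nn_integral_sphere_measure_two_coords[OF _ ij card, of "\<lambda>s t. ennreal (F1 s t)"] m1
    by (simp add: case_prod_unfold n_def \<kappa>_def w_def W_def)
  also have "(\<integral>\<^sup>+s. \<integral>\<^sup>+v. ennreal (W s * w v) * ?J s * ?J v * ennreal (F1 s (v * sqrt (1 - s\<^sup>2))) \<partial>lborel \<partial>lborel) =
    (\<integral>\<^sup>+s. \<Phi> s * ?J s \<partial>lborel)"
    unfolding \<Phi>_def by (intro nn_integral_cong, subst nn_integral_multc[symmetric]) (auto simp: mult_ac intro!: nn_integral_cong)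
  also have "\<dots> = (\<integral>\<^sup>+s. \<Phi> (moebius \<rho> s) * ennreal ((1 - \<rho>\<^sup>2)\<^sup>2 / (1 + \<rho>\<^sup>2 + 2 * \<rho> * s)\<^sup>2) * ?J s \<partial>lborel)"
    by (rule nn_integral_moebius[OF _ \<rho>]) simp
  also have "\<dots> = (\<integral>\<^sup>+s. ennreal (1 / (1 - \<rho>\<^sup>2)) * (\<integral>\<^sup>+v. ennreal (W s * w v) * ?J s * ?J v * ennreal (F2 s (v * sqrt (1 - s\<^sup>2))) \<partial>lborel) \<partial>lborel)"
  proof (intro nn_integral_cong)
    fix s :: real
    show "\<Phi> (moebius \<rho> s) * ennreal ((1 - \<rho>\<^sup>2)\<^sup>2 / (1 + \<rho>\<^sup>2 + 2 * \<rho> * s)\<^sup>2) * ?J s =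
      ennreal (1 / (1 - \<rho>\<^sup>2)) * (\<integral>\<^sup>+v. ennreal (W s * w v) * ?J s * ?J v * ennreal (F2 s (v * sqrt (1 - s\<^sup>2))) \<partial>lborel)"
    proof (cases "s \<in> {-1<..<1}")
      case True
      define h where "h = moebius \<rho> s"
      define k where "k = (1 - \<rho>\<^sup>2)\<^sup>2 / (1 + \<rho>\<^sup>2 + 2 * \<rho> * s)\<^sup>2"
      have k: "k \<ge> 0" by (simp add: k_def)
      have \<rho>1: "1 / (1 - \<rho>\<^sup>2) \<ge> 0" using \<rho> by (simp add: abs_square_le_1)
      have id: "W h * F1 h (v * sqrt (1 - h\<^sup>2)) * k = 1 / (1 - \<rho>\<^sup>2) * (W s * F2 s (v * sqrt (1 - s\<^sup>2)))" for v
        unfolding W_def F1_def F2_def h_def k_def by (rule moebius_transformed_integrand[OF \<rho> True])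
      have "\<Phi> h * ennreal k = (\<integral>\<^sup>+v. ennreal (W h * w v) * ?J v * ennreal (F1 h (v * sqrt (1 - h\<^sup>2))) * ennreal k \<partial>lborel)"
        unfolding \<Phi>_def by (rule nn_integral_multc[symmetric]) simp
      also have "\<dots> = (\<integral>\<^sup>+v. ennreal (1 / (1 - \<rho>\<^sup>2)) * (ennreal (W s * w v) * ?J v * ennreal (F2 s (v * sqrt (1 - s\<^sup>2)))) \<partial>lborel)"
      proof (intro nn_integral_cong)
        fix v :: real
        have "ennreal (W h * w v) * ennreal (F1 h (v * sqrt (1 - h\<^sup>2))) * ennreal k =
          ennreal (w v * (W h * F1 h (v * sqrt (1 - h\<^sup>2)) * k))"
          using nonneg k by (simp add: ennreal_mult'[symmetric] ennreal_mult[symmetric] mult_ac)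
        also have "\<dots> = ennreal (1 / (1 - \<rho>\<^sup>2)) * (ennreal (W s * w v) * ennreal (F2 s (v * sqrt (1 - s\<^sup>2))))"
          unfolding id using nonneg \<rho>1 by (simp only: ennreal_mult'[symmetric] ennreal_mult[symmetric] mult_nonneg_nonneg) (simp add: mult_ac)
        finally show "ennreal (W h * w v) * ?J v * ennreal (F1 h (v * sqrt (1 - h\<^sup>2))) * ennreal k =
          ennreal (1 / (1 - \<rho>\<^sup>2)) * (ennreal (W s * w v) * ?J v * ennreal (F2 s (v * sqrt (1 - s\<^sup>2))))"
          by (cases "v \<in> {-1<..<1}") (simp_all add: mult_ac)
      qed
      also have "\<dots> = ennreal (1 / (1 - \<rho>\<^sup>2)) * (\<integral>\<^sup>+v. ennreal (W s * w v) * ?J v * ennreal (F2 s (v * sqrt (1 - s\<^sup>2))) \<partial>lborel)"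
        by (rule nn_integral_cmult) simp
      finally show ?thesis using True unfolding h_def k_def by simp
    qed simp
  qed
  also have "\<dots> = ennreal (1 / (1 - \<rho>\<^sup>2)) * (\<integral>\<^sup>+s. \<integral>\<^sup>+v. ennreal (W s * w v) * ?J s * ?J v * ennreal (F2 s (v * sqrt (1 - s\<^sup>2))) \<partial>lborel \<partial>lborel)"
    by (rule nn_integral_cmult) simp
  also have "\<kappa> * \<dots> = ennreal (1 / (1 - \<rho>\<^sup>2)) * (\<kappa> * (\<integral>\<^sup>+s. \<integral>\<^sup>+v. ennreal (W s * w v) * ?J s * ?J v * ennreal (F2 s (v * sqrt (1 - s\<^sup>2))) \<partial>lborel \<partial>lborel))"
    by (rule mult.left_commute)
  also have "\<kappa> * (\<integral>\<^sup>+s. \<integral>\<^sup>+v. ennreal (W s * w v) * ?J s * ?J v * ennreal (F2 s (v * sqrt (1 - s\<^sup>2))) \<partial>lborel \<partial>lborel) =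
    (\<integral>\<^sup>+z. ennreal (F2 (z $ i) (z $ j)) \<partial>(sphere_measure :: (real^'n) measure))"
    using nn_integral_sphere_measure_two_coords[OF _ ij card, of "\<lambda>s t. ennreal (F2 s t)"] m2
    by (simp add: case_prod_unfold n_def \<kappa>_def w_def W_def)
  finally show ?thesis by (simp add: F2_def)
qed

section \<open>Alignment of the direction with the first axis\<close>

text \<open>For distinct i and j, a reflection in their coordinate plane that carries l = cos
  \<alpha> e_i + sin \<alpha> e_j to e_i. Being an involution it also carries e_i to l, so it
  exchanges z_i with <z, l>.\<close>

definition plane_reflection :: "'n::finite \<Rightarrow> 'n \<Rightarrow> real \<Rightarrow> real^'n \<Rightarrow> real^'n" where
  "plane_reflection i j \<alpha> z = (\<chi> k. if k = i then cos \<alpha> * z $ i + sin \<alpha> * z $ j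
     else if k = j then sin \<alpha> * z $ i - cos \<alpha> * z $ j else z $ k)"

lemma orthogonal_transformation_plane_reflection:
  assumes ij: "i \<noteq> j"
  shows "orthogonal_transformation (plane_reflection i j \<alpha>)"
  unfolding orthogonal_transformation
proof (intro conjI allI)
  show "linear (plane_reflection i j \<alpha>)"
    by (rule linearI) (auto simp: plane_reflection_def vec_eq_iff algebra_simps)
  fix v :: "real^'a"
  have split: "(\<Sum>k\<in>UNIV. f k) = f i + f j + (\<Sum>k\<in>UNIV - {i, j}. f k)" for f :: "'a \<Rightarrow> real"
    using ij by (simp add: sum.remove[of UNIV i] sum.remove[of "UNIV - {i}" j] insert_commute Diff_insert2[symmetric])
  have "(cos \<alpha> * v $ i + sin \<alpha> * v $ j)\<^sup>2 + (sin \<alpha> * v $ i - cos \<alpha> * v $ j)\<^sup>2 = ((sin \<alpha>)\<^sup>2 + (cos \<alpha>)\<^sup>2) * ((v $ i)\<^sup>2 + (v $ j)\<^sup>2)"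
    by algebra
  hence "(\<Sum>k\<in>UNIV. (plane_reflection i j \<alpha> v $ k)\<^sup>2) = (\<Sum>k\<in>UNIV. (v $ k)\<^sup>2)"
    unfolding split using ij by (simp add: plane_reflection_def)
  thus "norm (plane_reflection i j \<alpha> v) = norm v"
    by (simp add: norm_vec_def L2_set_def)
qed

section \<open>Integration of the second coordinate and the constants\<close>

text \<open>With t = sqrt(1 - s^2) the numbers c s + \<sigma> t and c s - \<sigma> t are coordinates
  of unit vectors, hence at most 1, and 2 \<rho> < 1 + \<rho>^2. The bound keeps the hypergeometric
  argument below 1.\<close>

lemma denominator_bound:
  fixes \<rho> c \<sigma> s :: real
  assumes \<rho>: "0 \<le> \<rho>" "\<rho> < 1" and cs: "\<sigma>\<^sup>2 + c\<^sup>2 = 1" and s: "s\<^sup>2 < 1"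
  shows "\<bar>2 * \<rho> * \<sigma> * sqrt (1 - s\<^sup>2)\<bar> < 1 + \<rho>\<^sup>2 - 2 * \<rho> * s * c"
proof -
  define t where "t = sqrt (1 - s\<^sup>2)"
  have t: "t\<^sup>2 = 1 - s\<^sup>2" using s by (simp add: t_def)
  have "(c * s + \<sigma> * t)\<^sup>2 + (\<sigma> * s - c * t)\<^sup>2 = 1" "(c * s - \<sigma> * t)\<^sup>2 + (\<sigma> * s + c * t)\<^sup>2 = 1"
    using cs t by algebra+
  hence "(c * s + \<sigma> * t)\<^sup>2 \<le> 1" "(c * s - \<sigma> * t)\<^sup>2 \<le> 1"
    by (smt (verit) zero_le_power2)+
  hence "c * s + \<sigma> * t \<le> 1" "c * s - \<sigma> * t \<le> 1" by (simp_all add: abs_square_le_1 abs_le_iff)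
  hence "2 * \<rho> * (c * s + \<sigma> * t) \<le> 2 * \<rho> * 1" "2 * \<rho> * (c * s - \<sigma> * t) \<le> 2 * \<rho> * 1"
    using \<rho> by (intro mult_left_mono; simp)+
  moreover have "(1 - \<rho>)\<^sup>2 > 0" using \<rho> by simp
  ultimately show ?thesis
    unfolding t_def[symmetric] by (simp add: abs_less_iff power2_eq_square algebra_simps)
qed

text \<open>For b = (n - 2)/2 the Beta value is sqrt(pi) Gamma(b) / Gamma((n - 1)/2), and b Gamma(b)
  = Gamma(n/2) absorbs the factor n - 2.\<close>

lemma sphere_constant_eq:
  fixes n :: real
  assumes n: "n \<ge> 3"
  shows "(n - 2) / (2 * pi) * Beta (1/2) ((n - 2) / 2) = Gamma (n / 2) / (Gamma (1/2) * Gamma ((n - 1) / 2))"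
proof -
  define b where "b = (n - 2) / 2"
  have b: "b > 0" using n by (simp add: b_def)
  have g: "Gamma (b + 1) = b * Gamma b" using b by (intro Gamma_plus1) (auto elim: nonpos_Ints_cases)
  have e: "b + 1 = n / 2" "1 / 2 + b = (n - 1) / 2" "(n - 2) / (2 * pi) = b / pi" by (simp_all add: b_def field_simps)
  have "sqrt pi / pi = 1 / sqrt pi" by (simp add: frac_eq_eq)
  moreover have "b / pi * (sqrt pi * Gamma b / X) = b * Gamma b * (sqrt pi / pi) / X" for X by simp
  ultimately have "b / pi * (sqrt pi * Gamma b / X) = b * Gamma b / (sqrt pi * X)" for X by simp
  thus ?thesis
    unfolding Beta_def b_def[symmetric] e g[unfolded e, symmetric] Gamma_one_half_real
    using g[unfolded e] by simp
qed

text \<open>The second claim accompanies the first because \<open>ennreal\<close> sends negative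
  reals to 0: it ensures that the integrand is not truncated when the real integral is
  recovered.\<close>

lemma opt_const_nn_integral:
  fixes \<rho> \<alpha> :: real and i j :: "'n::finite"
  assumes card: "CARD('n) \<ge> 3" and ij: "i \<noteq> j" and \<rho>: "0 \<le> \<rho>" "\<rho> < 1"
  defines "n \<equiv> real CARD('n)"
  shows "ennreal (opt_const (\<rho> *\<^sub>R axis i 1) (cos \<alpha> *\<^sub>R axis i 1 + sin \<alpha> *\<^sub>R axis j (1::real))) =
    ennreal (n / (1 - \<rho>\<^sup>2) * (Gamma (n/2) / (Gamma (1/2) * Gamma ((n-1)/2)))) *
    (\<integral>\<^sup>+x. ennreal (\<bar>(n-2)/n * \<rho> * cos \<alpha> - x\<bar> *
       ((1 - x\<^sup>2) powr ((n-3)/2) / (1 + \<rho>\<^sup>2 - 2*\<rho>*x*cos \<alpha>) powr (n/2 - 1)) *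
       hyp2F1 ((n-2)/4) (n/4) ((n-1)/2)
         (4 * \<rho>\<^sup>2 * (sin \<alpha>)\<^sup>2 * (1 - x\<^sup>2) / (1 + \<rho>\<^sup>2 - 2*\<rho>*x*cos \<alpha>)\<^sup>2)) * indicator {-1<..<1} x \<partial>lborel)"
    and "\<And>x. x \<in> {-1<..<1} \<Longrightarrow> hyp2F1 ((n-2)/4) (n/4) ((n-1)/2)
         (4 * \<rho>\<^sup>2 * (sin \<alpha>)\<^sup>2 * (1 - x\<^sup>2) / (1 + \<rho>\<^sup>2 - 2*\<rho>*x*cos \<alpha>)\<^sup>2) \<ge> 0"
proof -
  let ?J = "\<lambda>x. indicator {-1<..<1::real} x :: ennreal"
  define c \<sigma> where "c = cos \<alpha>" and "\<sigma> = sin \<alpha>"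
  have cs: "\<sigma>\<^sup>2 + c\<^sup>2 = 1" by (simp add: c_def \<sigma>_def)
  have n3: "n \<ge> 3" using card by (simp add: n_def)
  define l where "l = c *\<^sub>R axis i 1 + \<sigma> *\<^sub>R axis j (1::real)"
  define A where "A = (\<lambda>x. 1 + \<rho>\<^sup>2 - 2 * \<rho> * x * c)"
  define B where "B = (\<lambda>x. 2 * \<rho> * \<sigma> * sqrt (1 - x\<^sup>2))"
  \<comment> \<open>This number is the exponent n/2 - 1 of the denominator, and b - 1 = (n - 4)/2 is
    the exponent of the weight in v. With m = b, \<open>hypergeometric_integral\<close> yields the
    parameters (n - 2)/4, n/4 and (n - 1)/2.\<close>
  define b where "b = (n - 2) / 2"
  have b: "b > 0" using n3 by (simp add: b_def)
  define hyp where "hyp = (\<lambda>x. hyp2F1 ((n-2)/4) (n/4) ((n-1)/2) (4 * \<rho>\<^sup>2 * \<sigma>\<^sup>2 * (1 - x\<^sup>2) / (A x)\<^sup>2))"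
  have sq: "x\<^sup>2 < 1" if "x \<in> {-1<..<1}" for x :: real using that by (simp add: abs_square_less_1 abs_less_iff)
  have AB: "\<bar>B x\<bar> < A x" if "x \<in> {-1<..<1}" for x
    unfolding A_def B_def by (rule denominator_bound[OF \<rho> cs sq[OF that]])
  have B2: "(B x)\<^sup>2 = 4 * \<rho>\<^sup>2 * \<sigma>\<^sup>2 * (1 - x\<^sup>2)" if "x \<in> {-1<..<1}" for x
    using sq[OF that] by (simp add: B_def power_mult_distrib)
  have par: "b / 2 = (n - 2) / 4" "(b + 1) / 2 = n / 4" "b + 1 / 2 = (n - 1) / 2" "b - 1 = (n - 4) / 2" "n / 2 - 1 = b"
    by (simp_all add: b_def field_simps)
  have hyp: "hyp x = hyp2F1 (b / 2) ((b + 1) / 2) (b + 1 / 2) ((B x)\<^sup>2 / (A x)\<^sup>2)" if "x \<in> {-1<..<1}" for x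
    unfolding hyp_def par B2[OF that] ..
  have hyp0: "hyp x \<ge> 0" if x: "x \<in> {-1<..<1}" for x
  proof -
    have "\<bar>B x / A x\<bar> < 1" using AB[OF x] by (simp add: abs_divide)
    from hyp2F1_nonneg[OF b this, of b] show ?thesis by (simp add: hyp[OF x] power_divide)
  qed
  show "\<And>x. x \<in> {-1<..<1} \<Longrightarrow> hyp2F1 ((n-2)/4) (n/4) ((n-1)/2)
         (4 * \<rho>\<^sup>2 * (sin \<alpha>)\<^sup>2 * (1 - x\<^sup>2) / (1 + \<rho>\<^sup>2 - 2*\<rho>*x*cos \<alpha>)\<^sup>2) \<ge> 0"
    using hyp0 by (simp add: hyp_def A_def c_def \<sigma>_def)
  define F3 where "F3 = (\<lambda>s t. (1 + \<rho>\<^sup>2 - 2 * \<rho> * (c * s + \<sigma> * t)) powr (1 - n / 2) * \<bar>(n - 2) * \<rho> * c - n * s\<bar>)"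
  have m3: "(\<lambda>p. ennreal (F3 (fst p) (snd p))) \<in> borel_measurable (borel \<Otimes>\<^sub>M borel)"
    unfolding F3_def by measurable
  have x1: "norm (\<rho> *\<^sub>R axis i (1::real)) < 1" using \<rho> by simp
  have "ennreal (opt_const (\<rho> *\<^sub>R axis i 1) l) = (\<integral>\<^sup>+z. ennreal \<bar>poisson_dir l (\<rho> *\<^sub>R axis i 1) z\<bar> \<partial>sphere_measure)"
    unfolding opt_const_eq_integral[OF x1]
    by (rule nn_integral_eq_integral[symmetric, OF integrable_abs_poisson_dir[OF x1]]) simp
  also have "\<dots> = ennreal (1 / (1 - \<rho>\<^sup>2)) *
    (\<integral>\<^sup>+z. ennreal ((1 + \<rho>\<^sup>2 + 2 * \<rho> * z $ i) powr (1 - n / 2) * \<bar>(n - 2) * \<rho> * c + n * (c * z $ i + \<sigma> * z $ j)\<bar>)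
      \<partial>(sphere_measure :: (real^'n) measure))"
    unfolding l_def n_def by (rule nn_integral_poisson_dir[OF card ij \<rho>])
  also have "(\<integral>\<^sup>+z. ennreal ((1 + \<rho>\<^sup>2 + 2 * \<rho> * z $ i) powr (1 - n / 2) * \<bar>(n - 2) * \<rho> * c + n * (c * z $ i + \<sigma> * z $ j)\<bar>)
      \<partial>(sphere_measure :: (real^'n) measure)) = (\<integral>\<^sup>+z. ennreal (F3 (z $ i) (z $ j)) \<partial>(sphere_measure :: (real^'n) measure))"
  proof -
    \<comment> \<open>The minus sign undoes the antipodal map contained in the Moebius substitution
      and gives the signs of the claimed integrand.\<close>
    define T where "T = (\<lambda>z :: real^'n. - plane_reflection i j \<alpha> z)"
    have T: "orthogonal_transformation T"
      unfolding T_def orthogonal_transformation_neg by (rule orthogonal_transformation_plane_reflection[OF ij])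
    have Ti: "T z $ i = - (c * z $ i + \<sigma> * z $ j)" and Tj: "T z $ j = - (\<sigma> * z $ i - c * z $ j)" for z
      using ij by (simp_all add: T_def plane_reflection_def c_def \<sigma>_def)
    have "c * T z $ i + \<sigma> * T z $ j = - ((\<sigma>\<^sup>2 + c\<^sup>2) * z $ i)" for z
      unfolding Ti Tj by (simp add: power2_eq_square algebra_simps)
    hence dir: "c * T z $ i + \<sigma> * T z $ j = - z $ i" for z using cs by simp
    have "ennreal ((1 + \<rho>\<^sup>2 + 2 * \<rho> * T z $ i) powr (1 - n / 2) * \<bar>(n - 2) * \<rho> * c + n * (c * T z $ i + \<sigma> * T z $ j)\<bar>)
      = ennreal (F3 (z $ i) (z $ j))" for z
      unfolding dir unfolding Ti F3_def by (simp only: mult_minus_right add_uminus_conv_diff)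
    thus ?thesis
      using nn_integral_sphere_measure_orthogonal[OF _ T, of "\<lambda>z. ennreal ((1 + \<rho>\<^sup>2 + 2 * \<rho> * z $ i) powr (1 - n / 2) * \<bar>(n - 2) * \<rho> * c + n * (c * z $ i + \<sigma> * z $ j)\<bar>)"]
      by simp
  qed
  also have "\<dots> = ennreal ((n - 2) / (2 * pi)) *
    (\<integral>\<^sup>+s. \<integral>\<^sup>+v. ennreal ((1 - s\<^sup>2) powr ((n - 3) / 2) * (1 - v\<^sup>2) powr ((n - 4) / 2)) *
       ?J s * ?J v * ennreal (F3 s (v * sqrt (1 - s\<^sup>2))) \<partial>lborel \<partial>lborel)"
    using nn_integral_sphere_measure_two_coords[OF _ ij card, of "\<lambda>s t. ennreal (F3 s t)"] m3
    by (simp add: case_prod_unfold n_def)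
  also have "(\<integral>\<^sup>+s. \<integral>\<^sup>+v. ennreal ((1 - s\<^sup>2) powr ((n - 3) / 2) * (1 - v\<^sup>2) powr ((n - 4) / 2)) *
       ?J s * ?J v * ennreal (F3 s (v * sqrt (1 - s\<^sup>2))) \<partial>lborel \<partial>lborel) =
    (\<integral>\<^sup>+s. ennreal (n * Beta (1/2) b) * (ennreal (\<bar>(n-2)/n * \<rho> * c - s\<bar> *
       ((1 - s\<^sup>2) powr ((n-3)/2) / (A s) powr (n/2 - 1)) * hyp s) * ?J s) \<partial>lborel)"
  proof (intro nn_integral_cong)
    fix s :: real
    show "(\<integral>\<^sup>+v. ennreal ((1 - s\<^sup>2) powr ((n - 3) / 2) * (1 - v\<^sup>2) powr ((n - 4) / 2)) *
       ?J s * ?J v * ennreal (F3 s (v * sqrt (1 - s\<^sup>2))) \<partial>lborel) =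
      ennreal (n * Beta (1/2) b) * (ennreal (\<bar>(n-2)/n * \<rho> * c - s\<bar> *
       ((1 - s\<^sup>2) powr ((n-3)/2) / (A s) powr (n/2 - 1)) * hyp s) * ?J s)"
    proof (cases "s \<in> {-1<..<1}")
      case True
      define k where "k = (1 - s\<^sup>2) powr ((n - 3) / 2) * \<bar>(n - 2) * \<rho> * c - n * s\<bar>"
      have k: "k \<ge> 0" by (simp add: k_def)
      have A0: "A s > 0" using AB[OF True] by linarith
      have "(\<integral>\<^sup>+v. ennreal ((1 - s\<^sup>2) powr ((n - 3) / 2) * (1 - v\<^sup>2) powr ((n - 4) / 2)) *
         ?J s * ?J v * ennreal (F3 s (v * sqrt (1 - s\<^sup>2))) \<partial>lborel) =
        (\<integral>\<^sup>+v. ennreal k * (ennreal ((A s - B s * v) powr (- b) * (1 - v\<^sup>2) powr (b - 1)) * ?J v) \<partial>lborel)"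
      proof (intro nn_integral_cong)
        fix v :: real
        have "1 - n / 2 = - b" by (simp add: b_def field_simps)
        moreover have "1 + \<rho>\<^sup>2 - 2 * \<rho> * (c * s + \<sigma> * (v * sqrt (1 - s\<^sup>2))) = A s - B s * v"
          by (simp add: A_def B_def algebra_simps)
        ultimately have F: "F3 s (v * sqrt (1 - s\<^sup>2)) = (A s - B s * v) powr (- b) * \<bar>(n - 2) * \<rho> * c - n * s\<bar>"
          by (simp only: F3_def)
        have "ennreal ((1 - s\<^sup>2) powr ((n - 3) / 2) * (1 - v\<^sup>2) powr ((n - 4) / 2)) * ennreal (F3 s (v * sqrt (1 - s\<^sup>2)))
          = ennreal ((1 - s\<^sup>2) powr ((n - 3) / 2) * (1 - v\<^sup>2) powr ((n - 4) / 2) * F3 s (v * sqrt (1 - s\<^sup>2)))"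
          by (rule ennreal_mult'[symmetric]) simp
        also have "\<dots> = ennreal (k * ((A s - B s * v) powr (- b) * (1 - v\<^sup>2) powr (b - 1)))"
          unfolding F k_def par by (simp add: mult_ac)
        also have "\<dots> = ennreal k * ennreal ((A s - B s * v) powr (- b) * (1 - v\<^sup>2) powr (b - 1))"
          by (rule ennreal_mult'[OF k])
        finally show "ennreal ((1 - s\<^sup>2) powr ((n - 3) / 2) * (1 - v\<^sup>2) powr ((n - 4) / 2)) * ?J s * ?J v * ennreal (F3 s (v * sqrt (1 - s\<^sup>2)))
          = ennreal k * (ennreal ((A s - B s * v) powr (- b) * (1 - v\<^sup>2) powr (b - 1)) * ?J v)"
          using True by (cases "v \<in> {-1<..<1}") simp_all
      qed
      also have "\<dots> = ennreal k * (\<integral>\<^sup>+v. ennreal ((A s - B s * v) powr (- b) * (1 - v\<^sup>2) powr (b - 1)) * ?J v \<partial>lborel)"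
        by (rule nn_integral_cmult) simp
      also have "\<dots> = ennreal k * ennreal (A s powr (- b) * (Beta (1/2) b * hyp s))"
        unfolding hypergeometric_integral[OF b AB[OF True]] hyp[OF True] ..
      also have "\<dots> = ennreal (k * (A s powr (- b) * (Beta (1/2) b * hyp s)))"
        by (rule ennreal_mult'[OF k, symmetric])
      also have "k * (A s powr (- b) * (Beta (1/2) b * hyp s)) = (n * Beta (1/2) b) * (\<bar>(n-2)/n * \<rho> * c - s\<bar> *
         ((1 - s\<^sup>2) powr ((n-3)/2) / (A s) powr (n/2 - 1)) * hyp s)"
      proof -
        have "n * ((n-2)/n * \<rho> * c - s) = (n - 2) * \<rho> * c - n * s" using n3 by (simp add: field_simps)
        hence "\<bar>(n - 2) * \<rho> * c - n * s\<bar> = n * \<bar>(n-2)/n * \<rho> * c - s\<bar>"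
          using n3 abs_mult[of n "(n-2)/n * \<rho> * c - s"] by simp
        thus ?thesis unfolding k_def par(5) powr_minus_divide by simp
      qed
      also have "ennreal \<dots> = ennreal (n * Beta (1/2) b) * ennreal (\<bar>(n-2)/n * \<rho> * c - s\<bar> *
         ((1 - s\<^sup>2) powr ((n-3)/2) / (A s) powr (n/2 - 1)) * hyp s)"
        using n3 b by (intro ennreal_mult') (simp add: Beta_def)
      finally show ?thesis using True by simp
    qed simp
  qed
  also have "\<dots> = ennreal (n * Beta (1/2) b) * (\<integral>\<^sup>+s. ennreal (\<bar>(n-2)/n * \<rho> * c - s\<bar> *
       ((1 - s\<^sup>2) powr ((n-3)/2) / (A s) powr (n/2 - 1)) * hyp s) * ?J s \<partial>lborel)"
    unfolding hyp_def hyp2F1_def A_def by (rule nn_integral_cmult) measurable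
  also have "ennreal (1 / (1 - \<rho>\<^sup>2)) * (ennreal ((n - 2) / (2 * pi)) * (ennreal (n * Beta (1/2) b) * X)) =
    ennreal (n / (1 - \<rho>\<^sup>2) * (Gamma (n/2) / (Gamma (1/2) * Gamma ((n-1)/2)))) * X" for X
  proof -
    have \<rho>1: "1 / (1 - \<rho>\<^sup>2) \<ge> 0" using \<rho> by (simp add: abs_square_le_1)
    have "1 / (1 - \<rho>\<^sup>2) * ((n - 2) / (2 * pi) * (n * Beta (1/2) b)) =
      n / (1 - \<rho>\<^sup>2) * ((n - 2) / (2 * pi) * Beta (1/2) b)" by simp
    also have "(n - 2) / (2 * pi) * Beta (1/2) b = Gamma (n/2) / (Gamma (1/2) * Gamma ((n-1)/2))"
      unfolding b_def by (rule sphere_constant_eq[OF n3])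
    finally have eq: "1 / (1 - \<rho>\<^sup>2) * ((n - 2) / (2 * pi) * (n * Beta (1/2) b)) =
      n / (1 - \<rho>\<^sup>2) * (Gamma (n/2) / (Gamma (1/2) * Gamma ((n-1)/2)))" .
    have \<kappa>: "(n - 2) / (2 * pi) \<ge> 0" using n3 by simp
    have "ennreal (n / (1 - \<rho>\<^sup>2) * (Gamma (n/2) / (Gamma (1/2) * Gamma ((n-1)/2)))) =
      ennreal (1 / (1 - \<rho>\<^sup>2)) * (ennreal ((n - 2) / (2 * pi)) * ennreal (n * Beta (1/2) b))"
      unfolding eq[symmetric] ennreal_mult'[OF \<rho>1] ennreal_mult'[OF \<kappa>] ..
    thus ?thesis by (simp add: mult.assoc)
  qed
  finally show "ennreal (opt_const (\<rho> *\<^sub>R axis i 1) (cos \<alpha> *\<^sub>R axis i 1 + sin \<alpha> *\<^sub>R axis j (1::real))) =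
    ennreal (n / (1 - \<rho>\<^sup>2) * (Gamma (n/2) / (Gamma (1/2) * Gamma ((n-1)/2)))) *
    (\<integral>\<^sup>+x. ennreal (\<bar>(n-2)/n * \<rho> * cos \<alpha> - x\<bar> *
       ((1 - x\<^sup>2) powr ((n-3)/2) / (1 + \<rho>\<^sup>2 - 2*\<rho>*x*cos \<alpha>) powr (n/2 - 1)) *
       hyp2F1 ((n-2)/4) (n/4) ((n-1)/2)
         (4 * \<rho>\<^sup>2 * (sin \<alpha>)\<^sup>2 * (1 - x\<^sup>2) / (1 + \<rho>\<^sup>2 - 2*\<rho>*x*cos \<alpha>)\<^sup>2)) * indicator {-1<..<1} x \<partial>lborel)"
    unfolding hyp_def A_def l_def c_def \<sigma>_def .
qed

theorem theorem1:
  fixes \<rho> \<alpha> :: real and i j :: "'n::finite"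
  assumes "CARD('n) \<ge> 3" and "i \<noteq> j"
    and "0 \<le> \<rho>" and "\<rho> < 1" and "0 \<le> \<alpha>" and "\<alpha> \<le> pi / 2"
  defines "n \<equiv> real CARD('n)"
  shows "opt_const (\<rho> *\<^sub>R axis i 1) (cos \<alpha> *\<^sub>R axis i 1 + sin \<alpha> *\<^sub>R axis j (1::real)) =
    n / (1 - \<rho>^2) * (Gamma (n/2) / (Gamma (1/2) * Gamma ((n-1)/2))) *
    integral {-1..1} (\<lambda>x::real.
       \<bar>(n-2)/n * \<rho> * cos \<alpha> - x\<bar> *
       ((1 - x^2) powr ((n-3)/2) / (1 + \<rho>^2 - 2*\<rho>*x*cos \<alpha>) powr (n/2 - 1)) *
       hyp2F1 ((n-2)/4) (n/4) ((n-1)/2)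
         (4 * \<rho>^2 * (sin \<alpha>)^2 * (1 - x^2) / (1 + \<rho>^2 - 2*\<rho>*x*cos \<alpha>)^2))"
proof -
  define f where "f = (\<lambda>x::real. \<bar>(n-2)/n * \<rho> * cos \<alpha> - x\<bar> *
       ((1 - x^2) powr ((n-3)/2) / (1 + \<rho>^2 - 2*\<rho>*x*cos \<alpha>) powr (n/2 - 1)) *
       hyp2F1 ((n-2)/4) (n/4) ((n-1)/2)
         (4 * \<rho>^2 * (sin \<alpha>)^2 * (1 - x^2) / (1 + \<rho>^2 - 2*\<rho>*x*cos \<alpha>)^2))"
  define C where "C = opt_const (\<rho> *\<^sub>R axis i 1) (cos \<alpha> *\<^sub>R axis i 1 + sin \<alpha> *\<^sub>R axis j (1::real))"
  define K where "K = n / (1 - \<rho>^2) * (Gamma (n/2) / (Gamma (1/2) * Gamma ((n-1)/2)))"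
  define N where "N = (\<integral>\<^sup>+x. ennreal (f x) * indicator {-1<..<1} x \<partial>lborel)"
  have n3: "n \<ge> 3" using assms(1) by (simp add: n_def)
  have f0: "f x \<ge> 0" if "x \<in> {-1<..<1}" for x
    unfolding f_def n_def using opt_const_nn_integral(2)[OF assms(1-4) that]
    by (intro mult_nonneg_nonneg divide_nonneg_nonneg) auto
  have fm: "f \<in> borel_measurable borel" unfolding f_def hyp2F1_def by measurable
  have C: "ennreal C = ennreal K * N"
    unfolding C_def K_def N_def f_def n_def by (rule opt_const_nn_integral(1)[OF assms(1-4)])
  have K: "K > 0"
  proof -
    have "\<rho>^2 < 1" using assms(3,4) by (simp add: abs_square_less_1)
    moreover have "Gamma (n/2) > 0" "Gamma (1/2 :: real) > 0" "Gamma ((n-1)/2) > 0"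
      using n3 by (auto intro!: Gamma_real_pos)
    ultimately show ?thesis unfolding K_def using n3 by (intro mult_pos_pos divide_pos_pos) auto
  qed
  have C0: "C \<ge> 0"
  proof -
    have x1: "norm (\<rho> *\<^sub>R axis i (1::real)) < 1" using assms(3,4) by simp
    show ?thesis unfolding C_def opt_const_eq_integral[OF x1] by (intro integral_nonneg_AE) simp
  qed
  \<comment> \<open>C is a real number and K is positive, so N is finite. Integrability of the
    hypergeometric integrand follows from this identity rather than from an estimate.\<close>
  have "N = ennreal C / ennreal K"
    unfolding C using K ennreal_mult_divide_eq[of "ennreal K" N] by (simp add: mult.commute)
  also have "\<dots> = ennreal (C / K)" using C0 K by (rule divide_ennreal)
  finally have N: "N = ennreal (C / K)" .
  have "((\<lambda>x. f x * indicator {-1<..<1} x) has_integral C / K) UNIV"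
  proof (rule nn_integral_has_integral)
    show "(\<lambda>x. f x * indicator {-1<..<1} x) \<in> borel_measurable borel" using fm by measurable
    show "0 \<le> f x * indicator {-1<..<1} x" for x using f0 by (simp add: indicator_def)
    show "(\<integral>\<^sup>+x. ennreal (f x * indicator {-1<..<1} x) \<partial>lborel) = ennreal (C / K)"
      unfolding N[symmetric] N_def by (intro nn_integral_cong) (simp add: indicator_def)
    show "0 \<le> C / K" using C0 K by simp
  qed
  also have "(\<lambda>x. f x * indicator {-1<..<1} x) = (\<lambda>x. if x \<in> {-1<..<1} then f x else 0)"
    by (rule ext) (simp add: indicator_def)
  finally have "(f has_integral C / K) {-1..1}"
    by (simp only: has_integral_restrict_UNIV has_integral_Icc_iff_Ioo)
  hence "integral {-1..1} f = C / K" by (rule integral_unique)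
  hence "C = K * integral {-1..1} f" using K by simp
  thus ?thesis unfolding C_def K_def f_def .
qed

end
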